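(* Assume that the target density $f=F'$ satisfies $$\int_0^\infty x f(x)\,dx<\infty\quad\text{and}\quad\int_0^\infty x^4(f'(x))^2dx<\infty.$$ Then, as $n\to\infty$, $$\mathrm{MISE}(\hat F_{n,b}^{\mathrm{IGam}}) = \int_0^\infty\mathrm{Var}(\hat F_{n,b}^{\mathrm{IGam}}(x))\,dx+\int_0^\infty\big(\mathrm{Bias}[\hat F_{n,b}^{\mathrm{IGam}}(x)]\big)^2dx$$ $$= n^{-1}\int_0^\infty F(x)(1-F(x))\,dx - n^{-1}b^{1/2}\int_0^\infty\frac{x f(x)}{\sqrt{\pi}}\,dx + b^2\int_0^\infty\frac{x^4}{4}(f'(x))^2dx + o(n^{-1}b^{1/2})+o(b^2).$$ In particular, if $\int_0^\infty x^4(f'(x))^2dx>0$, the asymptotically optimal choice of $b$, with respect to $\mathrm{MISE}$, is $$b_{\mathrm{opt}} = n^{-2/3}\left[\frac{4\int_0^\infty\frac{x^4}{4}(f'(x))^2dx}{\int_0^\infty x f(x)/\sqrt{\pi}\,dx}\right]^{-2/3},$$ with $$\mathrm{MISE}(\hat F_{n,b_{\mathrm{opt}}}^{\mathrm{IGam}}) = n^{-1}\int_0^\infty F(x)(1-F(x))\,dx - n^{-4/3}\,\frac34\left[\frac{\big(\int_0^\infty x f(x)/\sqrt{\pi}\,dx\big)^4}{4\int_0^\infty\frac{x^4}{4}(f'(x))^2dx}\right]^{1/3}+o(n^{-4/3}).$$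
   Context: $F$ is a cumulative distribution function supported on $[0,\infty)$ having two continuous and bounded derivatives; $f=F'$. $X_1,X_2,\dots$ are i.i.d. with c.d.f. $F$. The smoothing parameter $b=b_n>0$ satisfies $b\to0$ as $n\to\infty$. The inverse Gamma kernel c.d.f. estimator is, for $x\in(0,\infty)$, $$\hat F_{n,b}^{\mathrm{IGam}}(x):=\frac1n\sum_{i=1}^n\overline K_{\mathrm{IGam}}(X_i\mid b^{-1}+1,\,x^{-1}b),\qquad \overline K_{\mathrm{IGam}}(t\mid\alpha,\theta):=1-\frac{\Gamma(\alpha,1/(t\theta))}{\Gamma(\alpha)},\quad \alpha,\theta>0,$$ where $\Gamma(\alpha,z):=\int_z^\infty t^{\alpha-1}e^{-t}\,dt$ and $\Gamma(\alpha):=\Gamma(\alpha,0)$. For an estimator $\hat F$, $\mathrm{Bias}[\hat F(x)]:=\mathbb{E}[\hat F(x)]-F(x)$ and $\mathrm{MISE}(\hat F):=\mathbb{E}\int_0^\infty(\hat F(x)-F(x))^2dx$. "Asymptotically optimal choice of $b$ with respect to MISE" means the minimizer over $b>0$ of the expansion of the MISE with the error terms $o(n^{-1}b^{1/2})$ and $o(b^2)$ dropped. Notation: $u=o(v)$ means $\lim|u/v|=0$ as $n\to\infty$. *)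

theory Defs
  imports "HOL-Probability.Probability" "HOL-Library.Landau_Symbols"
begin

definition upper_Gamma :: "real \<Rightarrow> real \<Rightarrow> real" where
  "upper_Gamma \<alpha> z = (LBINT t:{z<..}. t powr (\<alpha> - 1) * exp (- t))"

text \<open>
  Survival function at \<open>t > 0\<close> of the inverse Gamma distribution, i.e. of \<open>T\<close> such that
  \<open>1 / T\<close> is Gamma distributed with shape \<open>\<alpha>\<close> and scale \<open>\<theta>\<close>. The values for \<open>t \<le> 0\<close> are artefacts of the totality of division and are
  irrelevant below, since the observations are almost surely positive.
\<close>

definition igam_survival :: "real \<Rightarrow> real \<Rightarrow> real \<Rightarrow> real" where
  "igam_survival \<alpha> \<theta> t = 1 - upper_Gamma \<alpha> (1 / (t * \<theta>)) / Gamma \<alpha>"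

definition igam_cdf_estimator ::
    "(nat \<Rightarrow> 'a \<Rightarrow> real) \<Rightarrow> nat \<Rightarrow> real \<Rightarrow> real \<Rightarrow> 'a \<Rightarrow> real" where
  "igam_cdf_estimator X n b x \<omega> =
     1 / real n * (\<Sum>i = 1..n. igam_survival (1 / b + 1) (b / x) (X i \<omega>))"

text \<open>
  An estimator of a c.d.f. on \<open>(0, \<infinity>)\<close> maps a point \<open>x\<close> and an outcome \<open>\<omega>\<close> to a real number.
\<close>

definition bias :: "'a measure \<Rightarrow> (real \<Rightarrow> 'a \<Rightarrow> real) \<Rightarrow> (real \<Rightarrow> real) \<Rightarrow> real \<Rightarrow> real" where
  "bias M Fhat F x = prob_space.expectation M (Fhat x) - F x"

text \<open>
  The mean integrated squared error takes values in \<open>ennreal\<close>, so that it is meaningful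
  without any integrability assumption.
\<close>

definition MISE :: "'a measure \<Rightarrow> (real \<Rightarrow> 'a \<Rightarrow> real) \<Rightarrow> (real \<Rightarrow> real) \<Rightarrow> ennreal" where
  "MISE M Fhat F =
     (\<integral>\<^sup>+ \<omega>. (\<integral>\<^sup>+ x \<in> {0<..}. ennreal ((Fhat x \<omega> - F x)\<^sup>2) \<partial>lborel) \<partial>M)"

end

theory Submission
  imports Defs
begin

text \<open>
  Let \<open>V = b Y\<close> with \<open>Y\<close> Gamma distributed of shape \<open>1 / b + 1\<close>. The kernel at an observation \<open>t\<close> is \<open>P (V \<le> x / t)\<close>,
  so with \<open>W = 1 / V\<close>, which has mean \<open>1\<close>, the estimator has mean \<open>m x = E F(x W)\<close>, and the second moment of
  one summand is \<open>E F(x / max V\<^sub>1 V\<^sub>2)\<close>. Since \<open>\<integral> (1 - F (x / v)) dx = \<mu> v\<close> with \<open>\<mu> = \<integral> x f(x) dx\<close>, the integrated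
  variance multiplied by \<open>n\<close> is exactly
  \<open>\<integral> F (1 - F) + \<mu> (1 - E max V\<^sub>1 V\<^sub>2) - \<integral> (m - F) (m + F)\<close>. The mean of the maximum has a closed form whose
  expansion \<open>1 + sqrt (b / \<pi>) + o(sqrt b)\<close> follows from log-convexity of the Gamma function.

  The bias is \<open>m x - F x = E (dev W x)\<close>, where \<open>dev w x = F (x w) - F x - (w - 1) x f(x)\<close>. Scheffe's lemma gives
  \<open>\<integral> |dev w x| dx = o(|w - 1|)\<close> as \<open>w\<close> tends to \<open>1\<close>, so \<open>\<integral> |m - F| = o(sqrt b)\<close> and the last integral above is negligible.
  For the squared bias, weighted Cauchy-Schwarz inequalities applied to the integral form of the Taylor
  remainder give \<open>\<integral> (m - F)\<^sup>2 \<le> b\<^sup>2 / 4 (1 + O(b)) \<integral> x\<^sup>4 f'(x)\<^sup>2 dx\<close>; the matching lower bound is Fatou's lemma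
  together with the pointwise limit \<open>(m x - F x) / b \<rightarrow> x\<^sup>2 f'(x) / 2\<close>.
\<close>

section \<open>The Gamma distribution\<close>

text \<open>Only \<open>x * f x\<close> and \<open>x ^ 4 * (f' x) ^ 2\<close> are integrable by
  hypothesis, so pointwise expansions cannot be integrated under a dominating function. The variance
  is therefore integrated by an identity whose parts are controlled by tails such as
  \<open>1 - F\<close>, and the bias by norm estimates. Finiteness is claimed for every
  \<open>n \<ge> 1\<close>, while \<open>b n\<close> may be large for small \<open>n\<close> and W
  has moments only of order below \<open>1 / b + 1\<close>. Errors are hence measured by
  \<open>(w - 1) ^ 2 / w\<close> and \<open>(w - 1) ^ 4 / w ^ 3\<close>: near \<open>w = 1\<close>
  these are equivalent to plain powers, and with \<open>w = 1 / v\<close> they are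
  \<open>1 / v\<close> plus a polynomial in \<open>v\<close>, so their means exist for every
  \<open>b > 0\<close> and are polynomials in \<open>b\<close>. The constant of the squared bias
  survives because both Cauchy-Schwarz steps are sharp to leading order: near 1 each weight is
  proportional to the function it is paired with, and the two resulting factors are
  \<open>b / 2\<close> and \<open>b / 2 + O(b ^ 2)\<close>. Apart from the factor
  \<open>1 / n\<close>, both remainders depend on \<open>b\<close> alone, so one limit serves the
  given sequence and \<open>b_opt\<close>.\<close>

lemma has_bochner_integral_Gamma:
  fixes s :: real
  assumes "s > 0"
  shows "has_bochner_integral lborel (\<lambda>t. indicator {0<..} t * (t powr (s - 1) * exp (- t))) (Gamma s)"
proof (rule has_bochner_integral_nn_integral)
  have "(\<integral>\<^sup>+ t. ennreal (indicator {0<..} t * (t powr (s - 1) * exp (- t))) \<partial>lborel) =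
        (\<integral>\<^sup>+ t. ennreal (indicator {0..} t * t powr (s - 1) / exp t) \<partial>lborel)"
    using AE_lborel_singleton[of 0]
    by (intro nn_integral_cong_AE, eventually_elim) (auto simp: indicator_def exp_minus divide_inverse)
  also have "\<dots> = ennreal (Gamma s)"
    using Gamma_conv_nn_integral_real[OF assms] by simp
  finally show "(\<integral>\<^sup>+ t. ennreal (indicator {0<..} t * (t powr (s - 1) * exp (- t))) \<partial>lborel) = ennreal (Gamma s)" .
qed (use assms in auto)

definition gamma_measure :: "real \<Rightarrow> real measure" where
  "gamma_measure a = density lborel
     (\<lambda>y. ennreal (indicator {0<..} y * (y powr (a - 1) * exp (- y)) / Gamma a))"

lemma sets_gamma_measure [simp, measurable_cong]: "sets (gamma_measure a) = sets borel"
  by (simp add: gamma_measure_def)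

lemma space_gamma_measure [simp]: "space (gamma_measure a) = UNIV"
  by (simp add: gamma_measure_def)

lemma AE_gamma_measure_pos: "AE y in gamma_measure a. 0 < y"
  unfolding gamma_measure_def by (subst AE_density) (auto simp: indicator_def intro!: AE_I2)

lemma gamma_measure_moment:
  assumes "a > 0" "a + c > 0"
  shows "has_bochner_integral (gamma_measure a) (\<lambda>y. y powr c) (Gamma (a + c) / Gamma a)"
  unfolding gamma_measure_def
proof (rule has_bochner_integral_density)
  have "has_bochner_integral lborel
      (\<lambda>t. indicator {0<..} t * (t powr (a + c - 1) * exp (- t)) / Gamma a) (Gamma (a + c) / Gamma a)"
    by (intro has_bochner_integral_divide has_bochner_integral_Gamma) (use assms in auto)
  also have "(\<lambda>t. indicator {0<..} t * (t powr (a + c - 1) * exp (- t)) / Gamma a) =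
      (\<lambda>y. (indicator {0<..} y * (y powr (a - 1) * exp (- y)) / Gamma a) *\<^sub>R y powr c)"
    by (auto simp: fun_eq_iff indicator_def powr_add powr_diff)
  finally show "has_bochner_integral lborel
     (\<lambda>y. (indicator {0<..} y * (y powr (a - 1) * exp (- y)) / Gamma a) *\<^sub>R y powr c)
     (Gamma (a + c) / Gamma a)" .
qed (use assms in \<open>auto simp: Gamma_real_nonneg\<close>)

lemma prob_space_gamma_measure:
  assumes "a > 0"
  shows "prob_space (gamma_measure a)"
proof
  have "emeasure (gamma_measure a) (space (gamma_measure a)) =
      (\<integral>\<^sup>+ y. ennreal (indicator {0<..} y * (y powr (a - 1) * exp (- y)) / Gamma a) \<partial>lborel)"
    unfolding gamma_measure_def by (subst emeasure_density) (auto intro!: nn_integral_cong)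
  also have "\<dots> = ennreal (Gamma a / Gamma a)"
    using has_bochner_integral_divide[OF has_bochner_integral_Gamma[OF assms], of "Gamma a"] assms
    by (subst nn_integral_eq_integral) (auto simp: has_bochner_integral_iff)
  finally show "emeasure (gamma_measure a) (space (gamma_measure a)) = 1"
    using less_imp_neq[OF Gamma_real_pos[OF assms]] by simp
qed

lemma emeasure_gamma_measure_greaterThan:
  assumes "a > 0" "z \<ge> 0"
  shows "emeasure (gamma_measure a) {z<..} = ennreal (upper_Gamma a z / Gamma a)"
proof -
  have "emeasure (gamma_measure a) {z<..} =
      (\<integral>\<^sup>+ y. ennreal (indicator {z<..} y * (y powr (a - 1) * exp (- y)) / Gamma a) \<partial>lborel)"
    unfolding gamma_measure_def using assms
    by (subst emeasure_density) (auto intro!: nn_integral_cong simp: indicator_def)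
  also have "\<dots> = ennreal (\<integral> y. indicator {z<..} y * (y powr (a - 1) * exp (- y)) / Gamma a \<partial>lborel)"
  proof (rule nn_integral_eq_integral)
    have "integrable lborel (\<lambda>t. indicator {0<..} t * (t powr (a - 1) * exp (- t)))"
      using has_bochner_integral_Gamma[OF assms(1)] by (simp add: has_bochner_integral_iff)
    then have "integrable lborel (\<lambda>t. indicator {z<..} t * (t powr (a - 1) * exp (- t)))"
      by (rule Bochner_Integration.integrable_bound)
         (use assms in \<open>auto simp: indicator_def intro!: AE_I2\<close>)
    then show "integrable lborel (\<lambda>t. indicator {z<..} t * (t powr (a - 1) * exp (- t)) / Gamma a)"
      by simp
  qed (use assms in auto)
  finally show ?thesis
    by (simp add: upper_Gamma_def set_lebesgue_integral_def)
qed

text \<open>Integration by parts: \<open>t powr a * exp (- t)\<close> is an antiderivative of the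
  difference of the two integrands and vanishes at infinity, which leaves the boundary term at
  \<open>z\<close>.\<close>

lemma upper_Gamma_plus_1:
  assumes "a > 0" "z > 0"
  shows "upper_Gamma (a + 1) z = a * upper_Gamma a z + z powr a * exp (- z)"
proof -
  have int: "set_integrable lborel {z<..} (\<lambda>t. t powr (s - 1) * exp (- t))" if "s > 0" for s
  proof -
    have "integrable lborel (\<lambda>t. indicator {0<..} t * (t powr (s - 1) * exp (- t)))"
      using has_bochner_integral_Gamma[OF that] by (simp add: has_bochner_integral_iff)
    then show ?thesis
      unfolding set_integrable_def
      by (rule Bochner_Integration.integrable_bound)
         (use assms in \<open>auto simp: indicator_def intro!: AE_I2\<close>)
  qed
  have i1: "set_integrable lborel {z<..} (\<lambda>t. a * (t powr (a - 1) * exp (- t)))"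
    using int[OF assms(1)] by simp
  have i2: "set_integrable lborel {z<..} (\<lambda>t. t powr a * exp (- t))"
    using int[of "a + 1"] assms by simp
  have "(LBINT t=ereal z..\<infinity>. a * (t powr (a - 1) * exp (- t)) - t powr a * exp (- t)) =
      0 - z powr a * exp (- z)"
  proof (rule interval_integral_FTC_integrable)
    show "((\<lambda>t. t powr a * exp (- t)) has_vector_derivative
        a * (x powr (a - 1) * exp (- x)) - x powr a * exp (- x)) (at x)"
      if "ereal z < ereal x" for x
      using that assms unfolding has_real_derivative_iff_has_vector_derivative[symmetric]
      by (auto intro!: derivative_eq_intros simp: powr_diff field_simps)
    show "isCont (\<lambda>x. a * (x powr (a - 1) * exp (- x)) - x powr a * exp (- x)) x"
      if "ereal z < ereal x" for x
      using that assms by (auto intro!: continuous_intros)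
    show "set_integrable lborel (einterval (ereal z) \<infinity>)
        (\<lambda>x. a * (x powr (a - 1) * exp (- x)) - x powr a * exp (- x))"
      using set_integral_diff(1)[OF i1 i2] by (simp add: einterval_eq_Ici)
    have "((\<lambda>t. t powr a * exp (- t)) \<longlongrightarrow> z powr a * exp (- z)) (at_right z)"
      using assms by (intro tendsto_intros) auto
    then show "(((\<lambda>t. t powr a * exp (- t)) \<circ> real_of_ereal) \<longlongrightarrow> z powr a * exp (- z)) (at_right (ereal z))"
      by (simp add: ereal_tendsto_simps)
    have "((\<lambda>t. t powr a * exp (- t)) \<longlongrightarrow> 0) at_top"
      by real_asymp
    then show "(((\<lambda>t. t powr a * exp (- t)) \<circ> real_of_ereal) \<longlongrightarrow> 0) (at_left \<infinity>)"
      by (simp add: ereal_tendsto_simps)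
  qed auto
  also have "(LBINT t=ereal z..\<infinity>. a * (t powr (a - 1) * exp (- t)) - t powr a * exp (- t)) =
      a * upper_Gamma a z - upper_Gamma (a + 1) z"
    unfolding interval_integral_to_infinity_eq upper_Gamma_def
    by (subst set_integral_diff(2)[OF i1 i2]) simp
  finally show ?thesis by simp
qed

section \<open>Mean of the maximum of two independent Gamma variables\<close>

lemma emeasure_gamma_measure_singleton [simp]: "emeasure (gamma_measure a) {z} = 0"
proof -
  have "AE y in lborel. ennreal (indicator {0<..} y * (y powr (a - 1) * exp (- y)) / Gamma a) * indicator {z} y = 0"
    using AE_lborel_singleton[of z] by eventually_elim auto
  then show ?thesis
    unfolding gamma_measure_def by (subst emeasure_density) (auto intro: nn_integral_zero')
qed

lemma AE_gamma_measure_neq: "AE y in gamma_measure a. y \<noteq> z"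
  by (rule AE_I[of _ _ "{z}"]) auto

text \<open>The density of shape \<open>a\<close> times \<open>y\<close> is \<open>a\<close> times
  the density of shape \<open>a + 1\<close>, so the truncated mean is a tail probability of the next
  shape; \<open>upper_Gamma_plus_1\<close> brings it back to shape \<open>a\<close>. The extra term
  is \<open>z\<close> times the density at \<open>z\<close>.\<close>

lemma nn_integral_gamma_measure_tail:
  assumes "a > 0" "z > 0"
  shows "(\<integral>\<^sup>+ y. ennreal y * indicator {z<..} y \<partial>gamma_measure a) =
    ennreal a * emeasure (gamma_measure a) {z<..} + ennreal (z powr a * exp (- z) / Gamma a)"
proof -
  have G: "Gamma (a + 1) = a * Gamma a" "Gamma a > 0"
    using assms by (auto intro!: Gamma_plus1 dest: nonpos_Ints_nonpos)
  have "(\<integral>\<^sup>+ y. ennreal y * indicator {z<..} y \<partial>gamma_measure a) =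
      (\<integral>\<^sup>+ y. ennreal a * (ennreal (indicator {0<..} y * (y powr (a + 1 - 1) * exp (- y)) / Gamma (a + 1)) * indicator {z<..} y) \<partial>lborel)"
    unfolding gamma_measure_def using assms G
    by (subst nn_integral_density)
       (auto intro!: nn_integral_cong simp: indicator_def ennreal_mult[symmetric] powr_diff powr_add)
  also have "\<dots> = ennreal a * emeasure (gamma_measure (a + 1)) {z<..}"
    unfolding gamma_measure_def
    by (subst emeasure_density) (auto simp: nn_integral_cmult)
  also have "\<dots> = ennreal (a * upper_Gamma a z / Gamma a + z powr a * exp (- z) / Gamma a)"
    using assms G by (simp add: emeasure_gamma_measure_greaterThan upper_Gamma_plus_1 ennreal_mult'[symmetric] add_divide_distrib distrib_left)
  also have "\<dots> = ennreal a * emeasure (gamma_measure a) {z<..} + ennreal (z powr a * exp (- z) / Gamma a)"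
  proof -
    have "0 \<le> upper_Gamma a z"
      unfolding upper_Gamma_def set_lebesgue_integral_def by (intro Bochner_Integration.integral_nonneg) auto
    then show ?thesis
      using assms G by (simp add: emeasure_gamma_measure_greaterThan ennreal_mult'[symmetric] ennreal_plus[symmetric] del: ennreal_plus)
  qed
  finally show ?thesis .
qed

text \<open>Legendre's duplication formula. The left side is twice the mean of the boundary term of
  \<open>nn_integral_gamma_measure_tail\<close>, as it arises in the mean of the maximum.\<close>

lemma Gamma_duplication_ratio:
  assumes "a > (0::real)"
  shows "2 * (Gamma (2 * a) / (2 powr (2 * a) * (Gamma a)\<^sup>2)) = Gamma (a + 1 / 2) / (sqrt pi * Gamma a)"
proof -
  have "complex_of_real (Gamma a * Gamma (a + 1 / 2)) =
      complex_of_real (exp ((1 - 2 * a) * ln 2) * sqrt pi * Gamma (2 * a))"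
  proof -
    have "a \<notin> \<int>\<^sub>\<le>\<^sub>0" "a + 1 / 2 \<notin> \<int>\<^sub>\<le>\<^sub>0"
      using assms by (auto dest: nonpos_Ints_nonpos)
    then have "complex_of_real a \<notin> \<int>\<^sub>\<le>\<^sub>0" "complex_of_real (a + 1 / 2) \<notin> \<int>\<^sub>\<le>\<^sub>0"
      by (simp_all only: of_real_in_nonpos_Ints_iff not_False_eq_True)
    then show ?thesis
      using Gamma_legendre_duplication[of "complex_of_real a"]
      by (simp add: Gamma_complex_of_real[symmetric] exp_of_real[symmetric])
  qed
  then have "Gamma a * Gamma (a + 1 / 2) = exp ((1 - 2 * a) * ln 2) * sqrt pi * Gamma (2 * a)"
    by (simp only: of_real_eq_iff)
  also have "exp ((1 - 2 * a) * ln 2) = 2 / 2 powr (2 * a)"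
    by (simp add: powr_def left_diff_distrib exp_diff)
  finally have "Gamma (a + 1 / 2) = 2 / 2 powr (2 * a) * sqrt pi * Gamma (2 * a) / Gamma a"
    using Gamma_real_pos[OF assms] by (simp add: field_simps)
  then show ?thesis
    using Gamma_real_pos[OF assms] by (simp add: field_simps power2_eq_square)
qed

text \<open>The integrand times the Gamma density is a multiple of
  \<open>t powr (2 * a - 1) * exp (- (2 * t))\<close>, so substituting \<open>2 * t\<close> turns
  the integral into \<open>Gamma (2 * a)\<close>.\<close>

lemma nn_integral_gamma_measure_density:
  assumes "a > 0"
  shows "(\<integral>\<^sup>+ z. ennreal (z powr a * exp (- z) / Gamma a) \<partial>gamma_measure a) =
    ennreal (Gamma (2 * a) / (2 powr (2 * a) * (Gamma a)\<^sup>2))"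
proof -
  \<comment> \<open>One factor \<open>Gamma a\<close> comes from each of the two densities, and the
    power of 2 from \<open>(2 * t) powr (2 * a - 1)\<close>; the Jacobian 2 is kept apart and enters
    as \<open>2 * c\<close>.\<close>
  define c where "c = 2 powr (2 * a - 1) * (Gamma a)\<^sup>2"
  have G: "Gamma a > 0" using assms by simp
  have c: "c > 0" using G by (simp add: c_def)
  have "ennreal (Gamma (2 * a)) =
      (\<integral>\<^sup>+ t. ennreal (indicator {0<..} t * (t powr (2 * a - 1) * exp (- t))) \<partial>lborel)"
    using has_bochner_integral_Gamma[of "2 * a"] assms
    by (subst nn_integral_eq_integral) (auto simp: has_bochner_integral_iff)
  also have "\<dots> = ennreal \<bar>2\<bar> * (\<integral>\<^sup>+ t. ennreal (indicator {0<..} (0 + 2 * t) *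
       ((0 + 2 * t) powr (2 * a - 1) * exp (- (0 + 2 * t)))) \<partial>lborel)"
    by (rule nn_integral_real_affine) auto
  also have "(\<integral>\<^sup>+ t. ennreal (indicator {0<..} (0 + 2 * t) *
       ((0 + 2 * t) powr (2 * a - 1) * exp (- (0 + 2 * t)))) \<partial>lborel) =
      (\<integral>\<^sup>+ t. ennreal c * (ennreal (indicator {0<..} t * (t powr (a - 1) * exp (- t)) / Gamma a) *
          ennreal (t powr a * exp (- t) / Gamma a)) \<partial>lborel)"
  proof (rule nn_integral_cong)
    fix t :: real
    have "(2 * t) powr (2 * a - 1) * exp (- (2 * t)) =
        c * ((t powr (a - 1) * exp (- t)) / Gamma a * (t powr a * exp (- t) / Gamma a))" if "t > 0"
    proof -
      have "t powr (2 * a - 1) = t powr (a - 1) * t powr a"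
        using that by (simp add: powr_add[symmetric])
      moreover have "exp (- (2 * t)) = exp (- t) * exp (- t)"
        by (simp add: exp_add[symmetric])
      ultimately show ?thesis
        using that G by (simp add: c_def powr_mult field_simps power2_eq_square)
    qed
    then show "ennreal (indicator {0<..} (0 + 2 * t) * ((0 + 2 * t) powr (2 * a - 1) * exp (- (0 + 2 * t)))) =
        ennreal c * (ennreal (indicator {0<..} t * (t powr (a - 1) * exp (- t)) / Gamma a) *
          ennreal (t powr a * exp (- t) / Gamma a))"
      using c G by (auto simp: indicator_def ennreal_mult[symmetric])
  qed
  also have "\<dots> = ennreal c * (\<integral>\<^sup>+ z. ennreal (z powr a * exp (- z) / Gamma a) \<partial>gamma_measure a)"
    unfolding gamma_measure_def by (subst nn_integral_density) (auto simp: nn_integral_cmult)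
  finally have *: "ennreal (Gamma (2 * a)) =
      ennreal (2 * c) * (\<integral>\<^sup>+ z. ennreal (z powr a * exp (- z) / Gamma a) \<partial>gamma_measure a)"
    using c by (simp add: ennreal_mult mult.assoc)
  have "(\<integral>\<^sup>+ z. ennreal (z powr a * exp (- z) / Gamma a) \<partial>gamma_measure a) =
      ennreal (1 / (2 * c)) * ennreal (Gamma (2 * a))"
    unfolding * mult.assoc[symmetric] using c by (simp add: ennreal_mult[symmetric])
  also have "\<dots> = ennreal (Gamma (2 * a) / (2 powr (2 * a) * (Gamma a)\<^sup>2))"
    using assms c by (subst ennreal_mult[symmetric]) (auto simp: c_def powr_diff)
  finally show ?thesis .
qed

text \<open>Ties are null, so by symmetry the mean is twice that of \<open>Y\<close> restricted to
  \<open>Y > Z\<close>. By the tail formula this is \<open>a\<close> times twice the probability of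
  \<open>Y > Z\<close>, plus twice the mean of the boundary term.\<close>

lemma nn_integral_gamma_measure_max:
  assumes "a > 0"
  shows "(\<integral>\<^sup>+ z. \<integral>\<^sup>+ y. ennreal (max y z) \<partial>gamma_measure a \<partial>gamma_measure a) =
    ennreal (a + Gamma (a + 1 / 2) / (sqrt pi * Gamma a))"
proof -
  define M where "M = gamma_measure a"
  have [measurable_cong]: "sets M = sets borel" and [simp]: "space M = UNIV"
    by (simp_all add: M_def)
  interpret prob_space M unfolding M_def by (rule prob_space_gamma_measure) fact
  interpret pair_sigma_finite M M ..
  have pos: "AE y in M. 0 < y" and neq: "AE y in M. y \<noteq> z" for z
    unfolding M_def by (rule AE_gamma_measure_pos AE_gamma_measure_neq)+
  have [measurable]: "(\<lambda>x. indicator {fst x<..} (snd x) :: ennreal) \<in> borel_measurable (M \<Otimes>\<^sub>M M)"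
  proof -
    have "(\<lambda>x. indicator {x. fst x < snd x} x :: ennreal) \<in> borel_measurable (M \<Otimes>\<^sub>M M)"
      by measurable
    then show ?thesis by (simp add: indicator_def)
  qed
  have [measurable]: "(\<lambda>x. indicator {snd x<..} (fst x) :: ennreal) \<in> borel_measurable (M \<Otimes>\<^sub>M M)"
  proof -
    have "(\<lambda>x. indicator {x. snd x < fst x} x :: ennreal) \<in> borel_measurable (M \<Otimes>\<^sub>M M)"
      by measurable
    then show ?thesis by (simp add: indicator_def)
  qed
  have swap: "indicator {y<..} z = (indicator {..<z} y :: ennreal)" for y z :: real
    by (auto simp: indicator_def)
  define T where "T = (\<integral>\<^sup>+ z. \<integral>\<^sup>+ y. ennreal y * indicator {z<..} y \<partial>M \<partial>M)"
  define p where "p = (\<integral>\<^sup>+ z. \<integral>\<^sup>+ y. indicator {z<..} y \<partial>M \<partial>M)"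
  have tail_measurable [measurable]: "(\<lambda>z. \<integral>\<^sup>+ y. indicator {z<..} y \<partial>M) \<in> borel_measurable M"
      "(\<lambda>z. \<integral>\<^sup>+ y. indicator {y<..} z \<partial>M) \<in> borel_measurable M"
    by measurable
  have [measurable]: "(\<lambda>z. emeasure M {z<..}) \<in> borel_measurable M"
    using tail_measurable(1) by simp
  \<comment> \<open>Only \<open>p + p\<close> enters the result, so exchanging the two variables in
    one copy replaces a computation of \<open>p = 1 / 2\<close>.\<close>
  have "p + p = (\<integral>\<^sup>+ z. \<integral>\<^sup>+ y. indicator {z<..} y \<partial>M \<partial>M) + (\<integral>\<^sup>+ y. \<integral>\<^sup>+ z. indicator {z<..} y \<partial>M \<partial>M)"
    unfolding p_def by (subst (4) Fubini') (auto simp: case_prod_beta)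
  also have "\<dots> = (\<integral>\<^sup>+ z. \<integral>\<^sup>+ y. indicator {z<..} y + indicator {y<..} z \<partial>M \<partial>M)"
  proof -
    have "(\<integral>\<^sup>+ y. indicator {z<..} y + indicator {y<..} z \<partial>M) =
        (\<integral>\<^sup>+ y. indicator {z<..} y \<partial>M) + (\<integral>\<^sup>+ y. indicator {y<..} z \<partial>M)" for z
      by (rule nn_integral_add) (auto simp: swap[of _ z])
    then show ?thesis by (subst nn_integral_add[symmetric]) auto
  qed
  also have "\<dots> = (\<integral>\<^sup>+ z. \<integral>\<^sup>+ y. 1 \<partial>M \<partial>M)"
  proof (rule nn_integral_cong, rule nn_integral_cong_AE)
    fix z show "AE y in M. indicator {z<..} y + indicator {y<..} z = (1::ennreal)"
      using neq[of z] by eventually_elim (auto simp: indicator_def)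
  qed
  also have "\<dots> = 1" using emeasure_space_1 by simp
  finally have p: "p + p = 1" .
  have "(\<integral>\<^sup>+ z. \<integral>\<^sup>+ y. ennreal (max y z) \<partial>M \<partial>M) =
      (\<integral>\<^sup>+ z. \<integral>\<^sup>+ y. ennreal y * indicator {z<..} y + ennreal z * indicator {y<..} z \<partial>M \<partial>M)"
  proof (rule nn_integral_cong, rule nn_integral_cong_AE)
    fix z show "AE y in M. ennreal (max y z) = ennreal y * indicator {z<..} y + ennreal z * indicator {y<..} z"
      using neq[of z] by eventually_elim (auto simp: indicator_def max_def)
  qed
  also have "\<dots> = T + (\<integral>\<^sup>+ z. \<integral>\<^sup>+ y. ennreal z * indicator {y<..} z \<partial>M \<partial>M)"
  proof -
    have "(\<integral>\<^sup>+ y. ennreal y * indicator {z<..} y + ennreal z * indicator {y<..} z \<partial>M) =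
        (\<integral>\<^sup>+ y. ennreal y * indicator {z<..} y \<partial>M) + (\<integral>\<^sup>+ y. ennreal z * indicator {y<..} z \<partial>M)" for z
      by (rule nn_integral_add) (auto simp: swap[of _ z])
    then show ?thesis unfolding T_def by (subst nn_integral_add[symmetric]) auto
  qed
  also have "(\<integral>\<^sup>+ z. \<integral>\<^sup>+ y. ennreal z * indicator {y<..} z \<partial>M \<partial>M) = T"
    unfolding T_def by (subst Fubini') (auto simp: case_prod_beta)
  finally have "(\<integral>\<^sup>+ z. \<integral>\<^sup>+ y. ennreal (max y z) \<partial>M \<partial>M) = T + T" .
  moreover have "T = (\<integral>\<^sup>+ z. ennreal a * emeasure M {z<..} + ennreal (z powr a * exp (- z) / Gamma a) \<partial>M)"
    unfolding T_def
    by (rule nn_integral_cong_AE, use pos in eventually_elim)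
       (use assms nn_integral_gamma_measure_tail in \<open>simp add: M_def\<close>)
  moreover have "\<dots> = ennreal a * p + ennreal (Gamma (2 * a) / (2 powr (2 * a) * (Gamma a)\<^sup>2))"
  proof -
    show ?thesis
      using nn_integral_gamma_measure_density[OF assms, folded M_def]
      by (subst nn_integral_add) (auto simp: nn_integral_cmult p_def)
  qed
  moreover have "ennreal (2 * (Gamma (2 * a) / (2 powr (2 * a) * (Gamma a)\<^sup>2))) =
      ennreal (Gamma (2 * a) / (2 powr (2 * a) * (Gamma a)\<^sup>2)) + ennreal (Gamma (2 * a) / (2 powr (2 * a) * (Gamma a)\<^sup>2))"
    using assms by (subst ennreal_plus[symmetric]) auto
  ultimately have "(\<integral>\<^sup>+ z. \<integral>\<^sup>+ y. ennreal (max y z) \<partial>M \<partial>M) = ennreal a * (p + p) +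
      ennreal (2 * (Gamma (2 * a) / (2 powr (2 * a) * (Gamma a)\<^sup>2)))"
    by (simp only: distrib_left ac_simps)
  then show ?thesis
    using assms unfolding p Gamma_duplication_ratio[OF assms] by (simp add: M_def)
qed

section \<open>The law of the kernel\<close>

lemma Gamma_real_nonzero [simp]: "x > 0 \<Longrightarrow> Gamma x \<noteq> (0::real)"
  using Gamma_real_pos[of x] by linarith

text \<open>The law of \<open>1 / W\<close>, where \<open>x W\<close> has the inverse Gamma law of the kernel at \<open>x\<close>.\<close>

definition scaled_gamma :: "real \<Rightarrow> real measure" where
  "scaled_gamma b = distr (gamma_measure (1 / b + 1)) borel ((*) b)"

lemma sets_scaled_gamma [simp, measurable_cong]: "sets (scaled_gamma b) = sets borel"
  by (simp add: scaled_gamma_def)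

lemma space_scaled_gamma [simp]: "space (scaled_gamma b) = UNIV"
  by (simp add: scaled_gamma_def)

lemma prob_space_scaled_gamma: "b > 0 \<Longrightarrow> prob_space (scaled_gamma b)"
  unfolding scaled_gamma_def
  by (intro prob_space.prob_space_distr prob_space_gamma_measure) (auto simp: add_pos_pos)

lemma AE_scaled_gamma_pos: "b > 0 \<Longrightarrow> AE v in scaled_gamma b. 0 < v"
  unfolding scaled_gamma_def
  by (subst AE_distr_iff) (auto intro: AE_mp[OF AE_gamma_measure_pos])

lemma scaled_gamma_moment:
  assumes "b > 0" "1 / b + 1 + c > 0"
  shows "has_bochner_integral (scaled_gamma b) (\<lambda>v. v powr c)
    (b powr c * (Gamma (1 / b + 1 + c) / Gamma (1 / b + 1)))"
  unfolding scaled_gamma_def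
proof (rule has_bochner_integral_distr)
  have "has_bochner_integral (gamma_measure (1 / b + 1)) (\<lambda>y. b powr c * y powr c)
     (b powr c * (Gamma (1 / b + 1 + c) / Gamma (1 / b + 1)))"
    by (intro has_bochner_integral_mult_right gamma_measure_moment) (use assms in \<open>auto simp: add_pos_pos\<close>)
  moreover have "AE y in gamma_measure (1 / b + 1). b powr c * y powr c = (b * y) powr c"
    using AE_gamma_measure_pos by eventually_elim (use assms in \<open>simp add: powr_mult\<close>)
  ultimately show "has_bochner_integral (gamma_measure (1 / b + 1)) (\<lambda>y. (b * y) powr c)
     (b powr c * (Gamma (1 / b + 1 + c) / Gamma (1 / b + 1)))"
    by (subst (asm) has_bochner_integral_cong_AE) auto
qed auto

text \<open>With \<open>a = 1 / b + 1\<close> one has \<open>b * (a - 1) = 1\<close>, which makes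
  the mean of \<open>1 / v\<close> exactly 1. The other moments are products of
  \<open>b * a = 1 + b\<close>, \<open>b * (a + 1) = 1 + 2 * b\<close> and
  \<open>b * (a + 2) = 1 + 3 * b\<close>. All later means of error weights reduce to these
  four.\<close>

lemma scaled_gamma_moments:
  assumes "b > 0"
  shows "has_bochner_integral (scaled_gamma b) (\<lambda>v. 1 / v) 1"
    and "has_bochner_integral (scaled_gamma b) (\<lambda>v. v) (1 + b)"
    and "has_bochner_integral (scaled_gamma b) (\<lambda>v. v ^ 2) ((1 + b) * (1 + 2 * b))"
    and "has_bochner_integral (scaled_gamma b) (\<lambda>v. v ^ 3) ((1 + b) * (1 + 2 * b) * (1 + 3 * b))"
proof -
  define a where "a = 1 / b + 1"
  have a: "a > 1" "b * a = 1 + b" using assms by (auto simp: a_def field_simps)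
  have step: "Gamma (s + 1) = s * Gamma s" if "s > 0" for s :: real
    using that by (auto intro!: Gamma_plus1 dest: nonpos_Ints_nonpos)
  have G0: "Gamma a \<noteq> 0" "Gamma (a - 1) \<noteq> 0"
    using a by auto
  have cong: "has_bochner_integral (scaled_gamma b) g y"
    if "has_bochner_integral (scaled_gamma b) (\<lambda>v. v powr c) x" "\<And>v. v > 0 \<Longrightarrow> v powr c = g v" "x = y"
      and [measurable]: "g \<in> borel_measurable borel" for c g x y
  proof -
    have "AE v in scaled_gamma b. v powr c = g v"
      using AE_scaled_gamma_pos[OF assms] by eventually_elim (use that in auto)
    then show ?thesis using that(1) unfolding that(3)
      by (subst (asm) has_bochner_integral_cong_AE) auto
  qed
  note M = scaled_gamma_moment[OF assms, folded a_def]
  have "b powr -1 * (Gamma (a + -1) / Gamma a) = 1 / (b * (a - 1))"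
    using a G0 assms step[of "a - 1"] by (auto simp: powr_minus_divide)
  also have "b * (a - 1) = 1" using a(2) by (simp add: right_diff_distrib)
  finally show "has_bochner_integral (scaled_gamma b) (\<lambda>v. 1 / v) 1"
    by (intro cong[OF M[of "-1"]]) (use a in \<open>auto simp: powr_minus_divide\<close>)
  show "has_bochner_integral (scaled_gamma b) (\<lambda>v. v) (1 + b)"
    by (rule cong[OF M[of 1]])
       (use a G0 assms step[of a] in \<open>auto\<close>)
  have "Gamma (a + 2) = a * (a + 1) * Gamma a"
    using step[of a] step[of "a + 1"] a by (simp add: add.assoc)
  moreover have "b\<^sup>2 * (a * (a + 1)) = (b * a) * (b * a + b)"
    by (simp add: power2_eq_square algebra_simps)
  ultimately show "has_bochner_integral (scaled_gamma b) (\<lambda>v. v ^ 2) ((1 + b) * (1 + 2 * b))"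
    by (intro cong[OF M[of 2]])
       (use a G0 assms in \<open>auto\<close>)
  have "Gamma (a + 3) = a * (a + 1) * (a + 2) * Gamma a"
    using step[of a] step[of "a + 1"] step[of "a + 2"] a by (simp add: add.assoc)
  moreover have "b ^ 3 * (a * (a + 1) * (a + 2)) = (b * a) * (b * a + b) * (b * a + 2 * b)"
    by (simp add: power3_eq_cube algebra_simps)
  ultimately show "has_bochner_integral (scaled_gamma b) (\<lambda>v. v ^ 3) ((1 + b) * (1 + 2 * b) * (1 + 3 * b))"
    by (intro cong[OF M[of 3]])
       (use a G0 assms in \<open>auto simp: add.commute\<close>)
qed

text \<open>The mean of the maximum of two independent variables with law \<open>scaled_gamma b\<close>.\<close>

definition mean_max :: "real \<Rightarrow> real" where
  "mean_max b = 1 + b + b * (Gamma (1 / b + 3 / 2) / (sqrt pi * Gamma (1 / b + 1)))"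

lemma nn_integral_scaled_gamma_max:
  assumes "b > 0"
  shows "(\<integral>\<^sup>+ v. \<integral>\<^sup>+ w. ennreal (max w v) \<partial>scaled_gamma b \<partial>scaled_gamma b) = ennreal (mean_max b)"
proof -
  define a where "a = 1 / b + 1"
  have a: "a > 1" "b * a = 1 + b" "a + 1 / 2 = 1 / b + 3 / 2" using assms by (auto simp: a_def field_simps)
  interpret prob_space "gamma_measure a" by (rule prob_space_gamma_measure) (use a in auto)
  have "(\<integral>\<^sup>+ v. \<integral>\<^sup>+ w. ennreal (max w v) \<partial>scaled_gamma b \<partial>scaled_gamma b) =
      (\<integral>\<^sup>+ z. \<integral>\<^sup>+ y. ennreal (max (b * y) (b * z)) \<partial>gamma_measure a \<partial>gamma_measure a)"
    unfolding scaled_gamma_def a_def[symmetric]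
    by (subst nn_integral_distr; (subst nn_integral_distr)?) (auto intro!: nn_integral_cong simp: nn_integral_distr)
  also have "\<dots> = (\<integral>\<^sup>+ z. \<integral>\<^sup>+ y. ennreal b * ennreal (max y z) \<partial>gamma_measure a \<partial>gamma_measure a)"
    using assms by (intro nn_integral_cong) (auto simp: ennreal_mult'[symmetric] max_mult_distrib_left)
  also have "\<dots> = ennreal b * (\<integral>\<^sup>+ z. \<integral>\<^sup>+ y. ennreal (max y z) \<partial>gamma_measure a \<partial>gamma_measure a)"
    by (simp add: nn_integral_cmult)
  also have "\<dots> = ennreal (mean_max b)"
    using a assms by (simp add: nn_integral_gamma_measure_max ennreal_mult'[symmetric] mean_max_def
      distrib_left a_def[symmetric])
  finally show ?thesis .
qed

text \<open>Log-convexity at the midpoint of \<open>s\<close> and \<open>s + 1\<close> gives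
  \<open>Gamma (s + 1 / 2) ^ 2 \<le> s * Gamma s ^ 2\<close>. Taking \<open>s = a\<close> yields the
  upper bound and \<open>s = a - 1 / 2\<close> the lower one; they agree to leading order.\<close>

lemma Gamma_sqrt_bounds:
  assumes "a > (1 / 2 :: real)"
  shows "sqrt (a - 1 / 2) \<le> Gamma (a + 1 / 2) / Gamma a" "Gamma (a + 1 / 2) / Gamma a \<le> sqrt a"
proof -
  have step: "Gamma (s + 1) = s * Gamma s" if "s > 0" for s :: real
    using that by (auto intro!: Gamma_plus1 dest: nonpos_Ints_nonpos)
  have mid: "(Gamma (s + 1 / 2))\<^sup>2 \<le> Gamma s * Gamma (s + 1)" if s: "s > 0" for s :: real
  proof -
    have "(ln \<circ> Gamma) ((1 - 1 / 2) *\<^sub>R s + (1 / 2) *\<^sub>R (s + 1)) \<le>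
        (1 - 1 / 2) * (ln \<circ> Gamma) s + (1 / 2) * (ln \<circ> Gamma) (s + 1)"
      by (rule convex_onD[OF log_convex_Gamma_real]) (use s in auto)
    also have "(1 - 1 / 2) *\<^sub>R s + (1 / 2) *\<^sub>R (s + 1) = s + 1 / 2" by (simp add: field_simps)
    finally have "ln ((Gamma (s + 1 / 2))\<^sup>2) \<le> ln (Gamma s * Gamma (s + 1))"
      using s by (simp add: ln_realpow ln_mult)
    then show ?thesis using s by (subst (asm) ln_le_cancel_iff) (auto simp: add_pos_pos)
  qed
  have G: "Gamma a > 0" "Gamma (a + 1 / 2) > 0" "Gamma (a - 1 / 2) > 0" using assms by auto
  have "(Gamma (a + 1 / 2) / Gamma a)\<^sup>2 \<le> a"
    using mid[of a] step[of a] assms G by (simp add: power_divide field_simps power2_eq_square)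
  then show "Gamma (a + 1 / 2) / Gamma a \<le> sqrt a"
    using G by (simp add: real_le_rsqrt)
  have *: "Gamma (a + 1 / 2) = (a - 1 / 2) * Gamma (a - 1 / 2)"
  proof -
    have "0 < a - 1 / 2" using assms by simp
    from step[OF this] show ?thesis by (simp add: add.commute)
  qed
  have "(Gamma a)\<^sup>2 \<le> Gamma (a - 1 / 2) * Gamma (a + 1 / 2)"
    using mid[of "a - 1 / 2"] assms by (simp add: add.commute)
  then have "(a - 1 / 2) * (Gamma a)\<^sup>2 \<le> (Gamma (a + 1 / 2))\<^sup>2"
    using mult_left_mono[of "(Gamma a)\<^sup>2" _ "a - 1 / 2"] assms by (simp add: * power2_eq_square mult_ac)
  then have "a - 1 / 2 \<le> (Gamma (a + 1 / 2) / Gamma a)\<^sup>2"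
    using G by (simp add: power_divide field_simps)
  then show "sqrt (a - 1 / 2) \<le> Gamma (a + 1 / 2) / Gamma a"
    using G by (simp add: real_le_lsqrt)
qed

text \<open>After division by \<open>sqrt b\<close> the summand \<open>b\<close> of
  \<open>mean_max b - 1\<close> vanishes in the limit, and the Gamma quotient, squeezed to
  \<open>1 / sqrt b\<close>, leaves \<open>1 / sqrt pi\<close>.\<close>

lemma mean_max_asymp: "((\<lambda>b. (mean_max b - 1) / sqrt b) \<longlongrightarrow> 1 / sqrt pi) (at_right 0)"
proof -
  have "((\<lambda>b. sqrt b * (Gamma (1 / b + 1 + 1 / 2) / Gamma (1 / b + 1))) \<longlongrightarrow> 1) (at_right 0)"
  proof (rule tendsto_sandwich)
    show "\<forall>\<^sub>F b in at_right 0. sqrt b * sqrt (1 / b + 1 - 1 / 2) \<le> sqrt b * (Gamma (1 / b + 1 + 1 / 2) / Gamma (1 / b + 1))"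
      using eventually_at_right_less[of "0::real"]
      by eventually_elim (intro mult_left_mono Gamma_sqrt_bounds, auto simp: add_pos_pos)
    show "\<forall>\<^sub>F b in at_right 0. sqrt b * (Gamma (1 / b + 1 + 1 / 2) / Gamma (1 / b + 1)) \<le> sqrt b * sqrt (1 / b + 1)"
      using eventually_at_right_less[of "0::real"]
      by eventually_elim (intro mult_left_mono Gamma_sqrt_bounds, auto simp: add_pos_pos)
    show "((\<lambda>b::real. sqrt b * sqrt (1 / b + 1 - 1 / 2)) \<longlongrightarrow> 1) (at_right 0)" by real_asymp
    show "((\<lambda>b::real. sqrt b * sqrt (1 / b + 1)) \<longlongrightarrow> 1) (at_right 0)" by real_asymp
  qed
  moreover have "((\<lambda>b::real. sqrt b) \<longlongrightarrow> 0) (at_right 0)" by real_asymp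
  ultimately have "((\<lambda>b. sqrt b + sqrt b * (Gamma (1 / b + 1 + 1 / 2) / Gamma (1 / b + 1)) / sqrt pi) \<longlongrightarrow> 0 + 1 / sqrt pi) (at_right 0)"
    by (intro tendsto_add tendsto_divide tendsto_const) auto
  moreover have "\<forall>\<^sub>F b in at_right 0. sqrt b + sqrt b * (Gamma (1 / b + 1 + 1 / 2) / Gamma (1 / b + 1)) / sqrt pi =
      (mean_max b - 1) / sqrt b"
    using eventually_at_right_less[of "0::real"]
  proof eventually_elim
    fix b :: real assume b: "0 < b"
    define R where "R = Gamma (1 / b + 3 / 2) / Gamma (1 / b + 1)"
    have "(mean_max b - 1) / sqrt b = (b + b * (R / sqrt pi)) / sqrt b"
      by (simp add: mean_max_def R_def mult.commute)
    also have "\<dots> = b / sqrt b + (b / sqrt b) * R / sqrt pi"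
      by (simp add: add_divide_distrib)
    finally show "sqrt b + sqrt b * (Gamma (1 / b + 1 + 1 / 2) / Gamma (1 / b + 1)) / sqrt pi =
        (mean_max b - 1) / sqrt b"
      using b by (simp add: real_div_sqrt R_def add.assoc)
  qed
  ultimately show ?thesis by (auto dest: Lim_transform_eventually)
qed

section \<open>Dilations of the target distribution function\<close>

text \<open>The last factor is an \<open>ennreal\<close> integral, so \<open>\<phi> ^ 2 / p\<close>
  need not be integrable. Since division by zero yields 0, \<open>\<phi>\<close> has to vanish where
  \<open>p\<close> does.\<close>

lemma weighted_Cauchy_Schwarz:
  fixes \<phi> p :: "'a \<Rightarrow> real"
  assumes \<phi>: "integrable M \<phi>" and p: "integrable M p"
    and p_nonneg: "AE x in M. 0 \<le> p x" and p_zero: "AE x in M. p x = 0 \<longrightarrow> \<phi> x = 0"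
  shows "ennreal ((\<integral> x. \<phi> x \<partial>M)\<^sup>2) \<le> ennreal (\<integral> x. p x \<partial>M) * (\<integral>\<^sup>+ x. ennreal ((\<phi> x)\<^sup>2 / p x) \<partial>M)"
proof (cases "(\<integral> x. p x \<partial>M) = 0")
  case True
  then have "AE x in M. p x = 0"
    using integral_nonneg_eq_0_iff_AE[OF p p_nonneg] by simp
  then have "AE x in M. \<phi> x = 0"
    using p_zero by eventually_elim simp
  then have "(\<integral> x. \<phi> x \<partial>M) = 0"
    by (rule integral_eq_zero_AE)
  then show ?thesis by simp
next
  case False
  define P where "P = (\<integral> x. p x \<partial>M)"
  have P: "P > 0"
    using False integral_nonneg_AE[OF p_nonneg] by (simp add: P_def)
  have [measurable]: "\<phi> \<in> borel_measurable M" "p \<in> borel_measurable M"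
    using \<phi> p by auto
  have nonneg: "AE x in M. 0 \<le> (\<phi> x)\<^sup>2 / p x"
    using p_nonneg by eventually_elim simp
  show ?thesis
  proof (cases "(\<integral>\<^sup>+ x. ennreal ((\<phi> x)\<^sup>2 / p x) \<partial>M) = \<infinity>")
    case True
    then show ?thesis using P by (simp add: P_def[symmetric] ennreal_mult_top)
  next
    case False
    then have int: "integrable M (\<lambda>x. (\<phi> x)\<^sup>2 / p x)"
      using nonneg by (intro integrableI_nonneg) (auto simp: top.not_eq_extremum)
    \<comment> \<open>For every \<open>l\<close> the square of \<open>\<phi> - l * p\<close> gives
      \<open>2 * l * \<phi> - l ^ 2 * p \<le> \<phi> ^ 2 / p\<close>; this \<open>l\<close>
      maximises the integral of the left side.\<close>
    define l where "l = (\<integral> x. \<phi> x \<partial>M) / P"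
    have "(\<integral> x. 2 * l * \<phi> x - l\<^sup>2 * p x \<partial>M) \<le> (\<integral> x. (\<phi> x)\<^sup>2 / p x \<partial>M)"
    proof (rule integral_mono_AE)
      show "AE x in M. 2 * l * \<phi> x - l\<^sup>2 * p x \<le> (\<phi> x)\<^sup>2 / p x"
        using p_nonneg p_zero
      proof eventually_elim
        case (elim x)
        have "0 \<le> (\<phi> x - l * p x)\<^sup>2" by simp
        then show ?case
          using elim by (cases "p x = 0") (auto simp: field_simps power2_eq_square)
      qed
    qed (use \<phi> p int in auto)
    also have "(\<integral> x. 2 * l * \<phi> x - l\<^sup>2 * p x \<partial>M) = (\<integral> x. \<phi> x \<partial>M)\<^sup>2 / P"
      using \<phi> p P by (simp add: l_def P_def[symmetric] field_simps power2_eq_square)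
    finally have "(\<integral> x. \<phi> x \<partial>M)\<^sup>2 \<le> P * (\<integral> x. (\<phi> x)\<^sup>2 / p x \<partial>M)"
      using P by (simp add: field_simps)
    then have "ennreal ((\<integral> x. \<phi> x \<partial>M)\<^sup>2) \<le> ennreal (P * (\<integral> x. (\<phi> x)\<^sup>2 / p x \<partial>M))"
      by (rule ennreal_leI)
    also have "\<dots> = ennreal P * (\<integral>\<^sup>+ x. ennreal ((\<phi> x)\<^sup>2 / p x) \<partial>M)"
      using P int nonneg by (simp add: ennreal_mult' nn_integral_eq_integral)
    finally show ?thesis by (simp add: P_def)
  qed
qed

text \<open>\<open>f\<close> and \<open>f'\<close> vanish on the nonpositive half-line, so that
  their moments can be taken over the whole line. Derivatives are required only at positive points,
  since at 0 the theorem supplies one-sided ones.\<close>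

locale igam_target = real_distribution D for D +
  fixes f f' :: "real \<Rightarrow> real"
  assumes cdf_nonpos: "x \<le> 0 \<Longrightarrow> cdf D x = 0"
    and f_nonpos: "x \<le> 0 \<Longrightarrow> f x = 0" and f'_nonpos: "x \<le> 0 \<Longrightarrow> f' x = 0"
    and cdf_deriv: "0 < x \<Longrightarrow> (cdf D has_real_derivative f x) (at x)"
    and f_deriv: "0 < x \<Longrightarrow> (f has_real_derivative f' x) (at x)"
    and f'_cont: "continuous_on {0<..} f'"
    and int_f: "integrable lborel (\<lambda>x. x * f x)"
    and int_f': "integrable lborel (\<lambda>x. x ^ 4 * (f' x)\<^sup>2)"
begin

abbreviation "F \<equiv> cdf D"

definition "\<mu> = (\<integral> x. x * f x \<partial>lborel)"
definition "Q = (\<integral> x. x ^ 4 * (f' x)\<^sup>2 \<partial>lborel)"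

lemma F_bounds: "0 \<le> F x" "F x \<le> 1"
  using cdf_nonneg cdf_bounded_prob by auto

lemma F_measurable [measurable]: "F \<in> borel_measurable borel"
  by (rule borel_measurable_mono) (auto simp: mono_def cdf_nondecreasing)

lemma f'_measurable [measurable]: "f' \<in> borel_measurable borel"
proof -
  have "(\<lambda>x. indicator {0<..} x *\<^sub>R f' x) \<in> borel_measurable borel"
    by (rule borel_measurable_continuous_on_indicator) (auto simp: f'_cont)
  also have "(\<lambda>x. indicator {0<..} x *\<^sub>R f' x) = f'"
    by (auto simp: fun_eq_iff indicator_def f'_nonpos)
  finally show ?thesis .
qed

lemma f_measurable [measurable]: "f \<in> borel_measurable borel"
proof -
  have "continuous_on {0<..} f"
    using f_deriv by (auto intro!: DERIV_isCont continuous_at_imp_continuous_on)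
  then have "(\<lambda>x. indicator {0<..} x *\<^sub>R f x) \<in> borel_measurable borel"
    by (intro borel_measurable_continuous_on_indicator) auto
  also have "(\<lambda>x. indicator {0<..} x *\<^sub>R f x) = f"
    by (auto simp: fun_eq_iff indicator_def f_nonpos)
  finally show ?thesis .
qed

lemma f_nonneg: "0 \<le> f x"
proof (cases "x > 0")
  case True
  have "mono_on UNIV F" by (auto simp: mono_on_def cdf_nondecreasing)
  then show ?thesis
    by (rule mono_on_imp_deriv_nonneg[OF _ cdf_deriv[OF True]]) auto
qed (auto simp: f_nonpos)

lemma x_f_nonneg: "0 \<le> x * f x"
  using f_nonneg[of x] f_nonpos[of x] by (cases "x \<le> 0") auto

lemma \<mu>_nonneg: "0 \<le> \<mu>"
  unfolding \<mu>_def by (intro Bochner_Integration.integral_nonneg x_f_nonneg)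

lemma Q_nonneg: "0 \<le> Q"
  unfolding Q_def by (intro Bochner_Integration.integral_nonneg) auto

text \<open>Fubini for \<open>f y\<close> on the region \<open>0 < x \<le> y\<close>: integrating
  over \<open>x\<close> first gives \<open>y * f y\<close>, over \<open>y\<close> first
  \<open>1 - F x\<close>.\<close>

lemma nn_integral_tail: "(\<integral>\<^sup>+ x. ennreal (indicator {0<..} x * (1 - F x)) \<partial>lborel) = ennreal \<mu>"
proof -
  have "ennreal \<mu> = (\<integral>\<^sup>+ y. ennreal (y * f y) \<partial>lborel)"
    unfolding \<mu>_def using int_f x_f_nonneg by (subst nn_integral_eq_integral) auto
  also have "\<dots> = (\<integral>\<^sup>+ y. \<integral>\<^sup>+ x. ennreal (f y) * indicator {(x, y). 0 < x \<and> x \<le> y} (x, y) \<partial>lborel \<partial>lborel)"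
  proof (rule nn_integral_cong)
    fix y :: real
    have "(\<integral>\<^sup>+ x. ennreal (f y) * indicator {(x, y). 0 < x \<and> x \<le> y} (x, y) \<partial>lborel) =
        (\<integral>\<^sup>+ x. ennreal (f y) * indicator {0<..y} x \<partial>lborel)"
      by (intro nn_integral_cong) (auto simp: indicator_def)
    also have "\<dots> = ennreal (y * f y)"
      by (cases "y > 0")
         (auto simp: nn_integral_cmult ennreal_mult'[symmetric] f_nonneg mult.commute f_nonpos)
    finally show "ennreal (y * f y) =
        (\<integral>\<^sup>+ x. ennreal (f y) * indicator {(x, y). 0 < x \<and> x \<le> y} (x, y) \<partial>lborel)" ..
  qed
  also have "\<dots> = (\<integral>\<^sup>+ x. \<integral>\<^sup>+ y. ennreal (f y) * indicator {(x, y). 0 < x \<and> x \<le> y} (x, y) \<partial>lborel \<partial>lborel)"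
    by (rule lborel_pair.Fubini'[symmetric]) measurable
  also have "\<dots> = (\<integral>\<^sup>+ x. ennreal (indicator {0<..} x * (1 - F x)) \<partial>lborel)"
  proof (rule nn_integral_cong)
    fix x :: real
    show "(\<integral>\<^sup>+ y. ennreal (f y) * indicator {(x, y). 0 < x \<and> x \<le> y} (x, y) \<partial>lborel) =
        ennreal (indicator {0<..} x * (1 - F x))"
    proof (cases "x > 0")
      case True
      have "(\<integral>\<^sup>+ y. ennreal (f y) * indicator {(x, y). 0 < x \<and> x \<le> y} (x, y) \<partial>lborel) =
          (\<integral>\<^sup>+ y. ennreal (f y) * indicator {x..} y \<partial>lborel)"
        using True by (intro nn_integral_cong) (auto simp: indicator_def)
      also have "\<dots> = ennreal (1 - F x)"
        by (rule nn_integral_FTC_atLeast)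
           (use True in \<open>auto simp: f_nonneg intro!: cdf_deriv cdf_lim_at_top_prob\<close>)
      finally show ?thesis using True by simp
    qed auto
  qed
  finally show ?thesis ..
qed

text \<open>The value is linear in \<open>v = 1 / w\<close>. For this reason averages over a law of
  \<open>v\<close> will depend on the law only through its mean.\<close>

lemma has_bochner_integral_tail:
  assumes "0 < w"
  shows "has_bochner_integral lborel (\<lambda>x. indicator {0<..} x * (1 - F (x * w))) (\<mu> / w)"
proof (rule has_bochner_integral_nn_integral)
  have "ennreal \<mu> = ennreal \<bar>w\<bar> *
      (\<integral>\<^sup>+ x. ennreal (indicator {0<..} (0 + w * x) * (1 - F (0 + w * x))) \<partial>lborel)"
    using nn_integral_real_affine[of "\<lambda>x. ennreal (indicator {0<..} x * (1 - F x))" w 0] assms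
    by (simp add: nn_integral_tail)
  also have "(\<lambda>x. ennreal (indicator {0<..} (0 + w * x) * (1 - F (0 + w * x)))) =
      (\<lambda>x. ennreal (indicator {0<..} x * (1 - F (x * w))))"
    using assms by (auto simp: fun_eq_iff indicator_def zero_less_mult_iff mult.commute)
  finally have *: "ennreal \<mu> = ennreal w * (\<integral>\<^sup>+ x. ennreal (indicator {0<..} x * (1 - F (x * w))) \<partial>lborel)"
    using assms by simp
  have "(\<integral>\<^sup>+ x. ennreal (indicator {0<..} x * (1 - F (x * w))) \<partial>lborel) = ennreal (1 / w) * ennreal \<mu>"
    unfolding * mult.assoc[symmetric] using assms by (simp add: ennreal_mult'[symmetric])
  then show "(\<integral>\<^sup>+ x. ennreal (indicator {0<..} x * (1 - F (x * w))) \<partial>lborel) = ennreal (\<mu> / w)"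
    using assms by (simp add: ennreal_mult'[symmetric])
qed (use assms \<mu>_nonneg F_bounds in auto)

text \<open>The first-order Taylor remainder of \<open>w \<mapsto> F (x w)\<close> at \<open>w = 1\<close>.\<close>

definition dev :: "real \<Rightarrow> real \<Rightarrow> real" where
  "dev w x = F (x * w) - F x - (w - 1) * (x * f x)"

lemma dev_1 [simp]: "dev 1 x = 0"
  by (simp add: dev_def)

lemma dev_measurable [measurable]: "(\<lambda>(w, x). dev w x) \<in> borel_measurable (borel \<Otimes>\<^sub>M borel)"
  unfolding dev_def by measurable

text \<open>\<open>dev\<close> is a difference of two tails minus a multiple of
  \<open>x * f x\<close>. Monotonicity of \<open>F\<close> gives the tail difference a constant
  sign, so its absolute integral is the difference of the two tail integrals,
  \<open>|\<mu> / w - \<mu>|\<close>.\<close>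

lemma integrable_dev: "0 < w \<Longrightarrow> integrable lborel (\<lambda>x. indicator {0<..} x * dev w x)"
  and integral_dev_bound: "0 < w \<Longrightarrow>
    (\<integral> x. indicator {0<..} x * \<bar>dev w x\<bar> \<partial>lborel) \<le> \<mu> * (\<bar>1 / w - 1\<bar> + \<bar>w - 1\<bar>)"
proof -
  assume w: "0 < w"
  let ?h = "\<lambda>w x. indicator {0<..} x * (1 - F (x * w))"
  have h: "integrable lborel (?h w)" "integrable lborel (?h 1)"
     "(\<integral> x. ?h w x \<partial>lborel) = \<mu> / w" "(\<integral> x. ?h 1 x \<partial>lborel) = \<mu>"
    using has_bochner_integral_tail[OF w] has_bochner_integral_tail[of 1]
    by (auto simp: has_bochner_integral_iff)
  have eq: "indicator {0<..} x * dev w x = ?h 1 x - ?h w x - (w - 1) * (x * f x)" for x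
    by (auto simp: indicator_def dev_def f_nonpos)
  show "integrable lborel (\<lambda>x. indicator {0<..} x * dev w x)"
    unfolding eq using h int_f by (intro Bochner_Integration.integrable_diff integrable_mult_right) auto
  have "(\<integral> x. indicator {0<..} x * \<bar>dev w x\<bar> \<partial>lborel) \<le> (\<integral> x. \<bar>?h 1 x - ?h w x\<bar> + \<bar>w - 1\<bar> * (x * f x) \<partial>lborel)"
  proof (rule integral_mono')
    show "integrable lborel (\<lambda>x. \<bar>?h 1 x - ?h w x\<bar> + \<bar>w - 1\<bar> * (x * f x))"
      using h int_f by (intro Bochner_Integration.integrable_add integrable_mult_right integrable_abs
        Bochner_Integration.integrable_diff) auto
    fix x :: real
    have "indicator {0<..} x * \<bar>dev w x\<bar> = \<bar>indicator {0<..} x * dev w x\<bar>"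
      by (simp add: abs_mult)
    also have "\<dots> \<le> \<bar>?h 1 x - ?h w x\<bar> + \<bar>(w - 1) * (x * f x)\<bar>"
      unfolding eq by linarith
    finally show "indicator {0<..} x * \<bar>dev w x\<bar> \<le> \<bar>?h 1 x - ?h w x\<bar> + \<bar>w - 1\<bar> * (x * f x)"
      by (simp only: abs_mult[of "w - 1"] abs_of_nonneg[OF x_f_nonneg])
  qed (auto simp: x_f_nonneg)
  also have "\<dots> = (\<integral> x. \<bar>?h 1 x - ?h w x\<bar> \<partial>lborel) + \<bar>w - 1\<bar> * \<mu>"
    unfolding \<mu>_def using h int_f
    by (subst Bochner_Integration.integral_add) auto
  also have "(\<integral> x. \<bar>?h 1 x - ?h w x\<bar> \<partial>lborel) = \<bar>\<mu> / w - \<mu>\<bar>"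
  proof (cases "w \<ge> 1")
    case True
    have "(\<integral> x. \<bar>?h 1 x - ?h w x\<bar> \<partial>lborel) = (\<integral> x. ?h 1 x - ?h w x \<partial>lborel)"
      using True by (intro Bochner_Integration.integral_cong) (auto simp: indicator_def cdf_nondecreasing)
    also have "\<dots> = \<mu> - \<mu> / w" using h by simp
    moreover have "\<mu> / w \<le> \<mu>"
      using True w \<mu>_nonneg mult_left_mono[of 1 w \<mu>] by (simp add: divide_le_eq)
    ultimately show ?thesis by simp
  next
    case False
    have "(\<integral> x. \<bar>?h 1 x - ?h w x\<bar> \<partial>lborel) = (\<integral> x. ?h w x - ?h 1 x \<partial>lborel)"
      using False by (intro Bochner_Integration.integral_cong)
        (auto simp: indicator_def intro!: cdf_nondecreasing abs_of_nonpos[THEN trans])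
    also have "\<dots> = \<mu> / w - \<mu>" using h by simp
    moreover have "\<mu> \<le> \<mu> / w"
      using False w \<mu>_nonneg mult_left_mono[of w 1 \<mu>] by (simp add: le_divide_eq)
    ultimately show ?thesis by simp
  qed
  also have "\<bar>\<mu> / w - \<mu>\<bar> = \<mu> * \<bar>1 / w - 1\<bar>"
  proof -
    have "\<mu> / w - \<mu> = \<mu> * (1 / w - 1)" by (simp add: right_diff_distrib)
    then show ?thesis using \<mu>_nonneg by (simp add: abs_mult)
  qed
  finally show "(\<integral> x. indicator {0<..} x * \<bar>dev w x\<bar> \<partial>lborel) \<le> \<mu> * (\<bar>1 / w - 1\<bar> + \<bar>w - 1\<bar>)"
    by (simp add: algebra_simps)
qed

text \<open>The difference quotients \<open>h n\<close> are nonnegative, tend pointwise to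
  \<open>x * f x\<close>, and have integrals \<open>\<mu> / w n\<close>, which tend to the integral
  \<open>\<mu>\<close> of the limit. Scheffe's lemma turns this into convergence in L1 without a
  dominating function.\<close>

lemma dev_scaled_tendsto_0:
  "((\<lambda>w. (\<integral> x. indicator {0<..} x * \<bar>dev w x\<bar> \<partial>lborel) / \<bar>w - 1\<bar>) \<longlongrightarrow> 0) (at 1 within {0<..})"
  unfolding tendsto_at_iff_sequentially
proof (intro allI impI)
  fix w :: "nat \<Rightarrow> real"
  assume w: "\<forall>i. w i \<in> {0<..} - {1}" and lim: "w \<longlonglongrightarrow> 1"
  have w0: "0 < w n" "w n \<noteq> 1" for n using w by auto
  define h where "h n x = indicator {0<..} x * ((F (x * w n) - F x) / (w n - 1))" for n and x :: real
  have h_nonneg: "0 \<le> h n x" for n x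
    by (cases "x > 0"; cases "w n > 1")
       (auto simp: h_def indicator_def zero_le_divide_iff cdf_nondecreasing)
  let ?t = "\<lambda>w x. indicator {0<..} x * (1 - F (x * w))"
  have h: "has_bochner_integral lborel (h n) (\<mu> / w n)" for n
  proof -
    have "has_bochner_integral lborel (\<lambda>x. (?t 1 x - ?t (w n) x) / (w n - 1)) ((\<mu> / 1 - \<mu> / w n) / (w n - 1))"
      by (intro has_bochner_integral_divide has_bochner_integral_diff has_bochner_integral_tail w0) auto
    also have "(\<lambda>x. (?t 1 x - ?t (w n) x) / (w n - 1)) = h n"
      by (auto simp: fun_eq_iff h_def indicator_def)
    also have "(\<mu> / 1 - \<mu> / w n) / (w n - 1) = \<mu> / w n"
      using w0[of n] by (simp add: field_simps)
    finally show ?thesis .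
  qed
  have "(\<lambda>n. \<integral>\<^sup>+ x. norm (h n x - x * f x) \<partial>lborel) \<longlonglongrightarrow> 0"
  proof (rule Scheffe_lemma1)
    show "integrable lborel (h n)" for n using h by (simp add: has_bochner_integral_iff)
    show "integrable lborel (\<lambda>x. x * f x)" by (rule int_f)
    show "AE x in lborel. (\<lambda>n. h n x) \<longlonglongrightarrow> x * f x"
    proof (rule AE_I2)
      fix x :: real
      show "(\<lambda>n. h n x) \<longlonglongrightarrow> x * f x"
      proof (cases "x > 0")
        case True
        have "((\<lambda>w. F (x * w)) has_real_derivative f (x * 1) * x) (at 1)"
          by (rule DERIV_chain2[where f = F, OF cdf_deriv]) (use True in \<open>auto intro!: derivative_eq_intros\<close>)
        then have "((\<lambda>w. (F (x * w) - F x) / (w - 1)) \<longlongrightarrow> x * f x) (at 1)"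
          by (simp add: has_field_derivative_iff mult.commute)
        then have "(\<lambda>n. (F (x * w n) - F x) / (w n - 1)) \<longlonglongrightarrow> x * f x"
          using lim w0 unfolding tendsto_at_iff_sequentially[of _ _ 1 UNIV] by (auto simp: comp_def)
        then show ?thesis using True by (simp add: h_def)
      qed (simp add: h_def f_nonpos)
    qed
    have "(\<integral>\<^sup>+ x. norm (h n x) \<partial>lborel) = ennreal (\<mu> / w n)" for n
      using h[of n] h_nonneg by (simp add: has_bochner_integral_iff nn_integral_eq_integral)
    moreover have "(\<lambda>n. ennreal (\<mu> / w n)) \<longlonglongrightarrow> ennreal (\<mu> / 1)"
      by (intro tendsto_ennrealI tendsto_divide tendsto_const lim) auto
    ultimately have "limsup (\<lambda>n. \<integral>\<^sup>+ x. norm (h n x) \<partial>lborel) = ennreal \<mu>"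
      by (simp add: lim_imp_Limsup)
    also have "ennreal \<mu> = (\<integral>\<^sup>+ x. norm (x * f x) \<partial>lborel)"
      using int_f x_f_nonneg by (simp add: nn_integral_eq_integral \<mu>_def)
    finally show "limsup (\<lambda>n. \<integral>\<^sup>+ x. norm (h n x) \<partial>lborel) \<le> (\<integral>\<^sup>+ x. norm (x * f x) \<partial>lborel)"
      by simp
  qed
  also have "(\<lambda>n. \<integral>\<^sup>+ x. norm (h n x - x * f x) \<partial>lborel) =
      (\<lambda>n. ennreal ((\<integral> x. indicator {0<..} x * \<bar>dev (w n) x\<bar> \<partial>lborel) / \<bar>w n - 1\<bar>))"
  proof
    fix n
    have "norm (h n x - x * f x) = indicator {0<..} x * \<bar>dev (w n) x\<bar> / \<bar>w n - 1\<bar>" for x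
    proof (cases "x > 0")
      case True
      then have "h n x - x * f x = dev (w n) x / (w n - 1)"
        using w0[of n] by (simp add: h_def dev_def diff_divide_distrib)
      then show ?thesis using True by (simp add: abs_divide)
    qed (simp add: h_def f_nonpos)
    then have "(\<integral>\<^sup>+ x. norm (h n x - x * f x) \<partial>lborel) =
        (\<integral>\<^sup>+ x. ennreal (indicator {0<..} x * \<bar>dev (w n) x\<bar> / \<bar>w n - 1\<bar>) \<partial>lborel)"
      by simp
    also have "\<dots> = ennreal (\<integral> x. indicator {0<..} x * \<bar>dev (w n) x\<bar> / \<bar>w n - 1\<bar> \<partial>lborel)"
      using integrable_abs[OF integrable_dev[OF w0(1)[of n]]]
      by (intro nn_integral_eq_integral integrable_divide) (auto simp: abs_mult)
    finally show "(\<integral>\<^sup>+ x. norm (h n x - x * f x) \<partial>lborel) =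
      ennreal ((\<integral> x. indicator {0<..} x * \<bar>dev (w n) x\<bar> \<partial>lborel) / \<bar>w n - 1\<bar>)" by simp
  qed
  finally show "((\<lambda>w. (\<integral> x. indicator {0<..} x * \<bar>dev w x\<bar> \<partial>lborel) / \<bar>w - 1\<bar>) \<circ> w) \<longlonglongrightarrow> 0"
    by (simp add: comp_def ennreal_tendsto_0_iff)
qed

text \<open>The error terms here and in \<open>dev_pointwise_bound\<close> are functions of \<open>w\<close> that grow linearly at infinity,
  since higher moments of \<open>w\<close> need not exist.\<close>

lemma dev_L1_bound:
  assumes "\<epsilon> > 0"
  shows "\<exists>C\<ge>0. \<forall>w>0.
    (\<integral> x. indicator {0<..} x * \<bar>dev w x\<bar> \<partial>lborel) \<le> \<epsilon> * \<bar>w - 1\<bar> + C * ((w - 1)\<^sup>2 / w)"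
proof -
  let ?I = "\<lambda>w. \<integral> x. indicator {0<..} x * \<bar>dev w x\<bar> \<partial>lborel"
  have "\<forall>\<^sub>F w in at 1 within {0<..}. \<bar>?I w / \<bar>w - 1\<bar>\<bar> < \<epsilon>"
    using tendstoD[OF dev_scaled_tendsto_0 assms] by simp
  then obtain \<delta> where \<delta>: "\<delta> > 0" "\<And>w. w > 0 \<Longrightarrow> w \<noteq> 1 \<Longrightarrow> \<bar>w - 1\<bar> < \<delta> \<Longrightarrow> \<bar>?I w / \<bar>w - 1\<bar>\<bar> < \<epsilon>"
    unfolding eventually_at by (auto simp: dist_real_def)
  define C where "C = \<mu> * (1 + 2 / \<delta>)"
  have C: "C \<ge> 0" using \<mu>_nonneg \<delta>(1) by (simp add: C_def)
  show ?thesis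
  proof (intro exI[of _ C] conjI C allI impI)
    fix w :: real assume w: "w > 0"
    have nonneg: "0 \<le> (w - 1)\<^sup>2 / w" using w by simp
    show "?I w \<le> \<epsilon> * \<bar>w - 1\<bar> + C * ((w - 1)\<^sup>2 / w)"
    proof (cases "\<bar>w - 1\<bar> < \<delta>")
      case True
      have "?I w \<le> \<epsilon> * \<bar>w - 1\<bar>"
      proof (cases "w = 1")
        case False
        then have "?I w / \<bar>w - 1\<bar> \<le> \<epsilon>" using \<delta>(2)[OF w False True] by linarith
        then show ?thesis using False by (simp add: divide_le_eq)
      qed simp
      then show ?thesis using mult_nonneg_nonneg[OF C nonneg] by linarith
    next
      case False
      \<comment> \<open>Away from 1 the crude bound of \<open>integral_dev_bound\<close> equals
        \<open>\<mu> * |w - 1| * (1 + w) / w\<close>. Bounding \<open>1 + w\<close> by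
        \<open>2 + |w - 1|\<close> and 2 by a multiple of \<open>|w - 1|\<close> turns it into the
        quadratic weight and explains the choice of \<open>C\<close>.\<close>
      then have "2 \<le> 2 / \<delta> * \<bar>w - 1\<bar>" using \<delta>(1) by (simp add: field_simps)
      then have "1 + w \<le> (1 + 2 / \<delta>) * \<bar>w - 1\<bar>" by (simp add: distrib_right)
      then have le: "\<bar>w - 1\<bar> * (1 + w) / w \<le> \<bar>w - 1\<bar> * ((1 + 2 / \<delta>) * \<bar>w - 1\<bar>) / w"
        using w by (intro divide_right_mono mult_left_mono) auto
      have "\<bar>1 / w - 1\<bar> = \<bar>w - 1\<bar> / w"
        using w by (simp add: abs_if field_simps)
      then have "\<bar>1 / w - 1\<bar> + \<bar>w - 1\<bar> = \<bar>w - 1\<bar> * (1 + w) / w"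
        using w by (simp add: field_simps)
      also note le
      also have "\<bar>w - 1\<bar> * ((1 + 2 / \<delta>) * \<bar>w - 1\<bar>) / w = (1 + 2 / \<delta>) * ((w - 1)\<^sup>2 / w)"
        by (simp add: power2_eq_square abs_mult_self_eq mult_ac)
      finally have "\<mu> * (\<bar>1 / w - 1\<bar> + \<bar>w - 1\<bar>) \<le> C * ((w - 1)\<^sup>2 / w)"
        unfolding C_def mult.assoc by (rule mult_left_mono) (rule \<mu>_nonneg)
      then show ?thesis
        using integral_dev_bound[OF w] mult_nonneg_nonneg[of \<epsilon> "\<bar>w - 1\<bar>"] assms by linarith
    qed
  qed
qed

text \<open>Lagrange form of the remainder for \<open>s \<mapsto> F (x * s)\<close> at 1. It serves
  pointwise estimates near \<open>w = 1\<close>, where continuity of \<open>f'\<close> controls the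
  unknown point \<open>t\<close>; integration over \<open>x\<close> calls for the integral form
  instead.\<close>

lemma dev_Taylor:
  assumes "x > 0" "w > 0" "w \<noteq> 1"
  obtains t where "\<bar>t - 1\<bar> < \<bar>w - 1\<bar>" "t > 0" "dev w x = (w - 1)\<^sup>2 / 2 * (x\<^sup>2 * f' (x * t))"
proof -
  define diff where "diff m = (if m = 0 then (\<lambda>s. F (x * s)) else if m = 1 then (\<lambda>s. x * f (x * s))
    else (\<lambda>s. x\<^sup>2 * f' (x * s)))" for m :: nat
  have "\<exists>t. (if w < 1 then w < t \<and> t < 1 else 1 < t \<and> t < w) \<and>
      F (x * w) = (\<Sum>m<2. diff m 1 / fact m * (w - 1) ^ m) + diff 2 t / fact 2 * (w - 1) ^ 2"
  proof (rule Taylor[where a = "min 1 w" and b = "max 1 w" and diff = diff])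
    show "\<forall>m t. m < 2 \<and> min 1 w \<le> t \<and> t \<le> max 1 w \<longrightarrow> (diff m has_real_derivative diff (Suc m) t) (at t)"
    proof (intro allI impI)
      fix m :: nat and t :: real assume *: "m < 2 \<and> min 1 w \<le> t \<and> t \<le> max 1 w"
      then have t: "x * t > 0" using assms by (auto simp: min_def split: if_splits)
      have "((\<lambda>s. F (x * s)) has_real_derivative f (x * t) * x) (at t)"
        by (rule DERIV_chain2[where f = F and g = "\<lambda>s. x * s", OF cdf_deriv[OF t]]) (auto intro!: derivative_eq_intros)
      moreover have "((\<lambda>s. f (x * s)) has_real_derivative f' (x * t) * x) (at t)"
        by (rule DERIV_chain2[where f = f and g = "\<lambda>s. x * s", OF f_deriv[OF t]]) (auto intro!: derivative_eq_intros)
      then have "((\<lambda>s. x * f (x * s)) has_real_derivative x * (f' (x * t) * x)) (at t)"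
        by (rule DERIV_cmult)
      ultimately show "(diff m has_real_derivative diff (Suc m) t) (at t)"
        using * by (auto simp: diff_def less_2_cases_iff mult_ac power2_eq_square)
    qed
  qed (use assms in \<open>auto simp: diff_def\<close>)
  then obtain t where t: "if w < 1 then w < t \<and> t < 1 else 1 < t \<and> t < w"
    and eq: "F (x * w) = (\<Sum>m<2. diff m 1 / fact m * (w - 1) ^ m) + diff 2 t / fact 2 * (w - 1) ^ 2"
    by blast
  show thesis
  proof (rule that)
    show "\<bar>t - 1\<bar> < \<bar>w - 1\<bar>" "t > 0" using t assms by (auto split: if_splits)
    show "dev w x = (w - 1)\<^sup>2 / 2 * (x\<^sup>2 * f' (x * t))"
      using eq by (simp add: dev_def diff_def numeral_2_eq_2 lessThan_Suc field_simps)
  qed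
qed

text \<open>Near 1 Taylor's formula gives the \<open>\<epsilon>\<close> term. Far from 1
  \<open>dev\<close> grows at most linearly, and there the quartic weight, which is the quadratic
  one times \<open>((w - 1) / w) ^ 2\<close>, is at least a fixed multiple of the quadratic one.
  Under the kernel law the quartic weight has mean of order \<open>b ^ 2\<close>, so its constant
  \<open>C\<close> is harmless.\<close>

lemma dev_pointwise_bound:
  assumes "x > 0" "\<epsilon> > 0"
  shows "\<exists>C\<ge>0. \<forall>w>0.
    \<bar>dev w x - x\<^sup>2 * f' x / 2 * ((w - 1)\<^sup>2 / w)\<bar> \<le> \<epsilon> * ((w - 1)\<^sup>2 / w) + C * ((w - 1) ^ 4 / w ^ 3)"
proof -
  define \<psi> where "\<psi> s = x\<^sup>2 * f' (x * s) / 2" for s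
  have "isCont f' (x * 1)"
    using f'_cont assms by (simp add: continuous_on_eq_continuous_at)
  then have "isCont \<psi> 1"
    unfolding \<psi>_def by (intro continuous_intros isCont_o2[where f = "\<lambda>s. x * s" and g = f']) auto
  then obtain \<delta>1 where \<delta>1: "\<delta>1 > 0" "\<And>s. \<bar>s - 1\<bar> < \<delta>1 \<Longrightarrow> \<bar>\<psi> s - \<psi> 1\<bar> < \<epsilon> / 4"
  proof -
    have "\<forall>\<^sub>F s in nhds 1. dist (\<psi> s) (\<psi> 1) < \<epsilon> / 4"
      using \<open>isCont \<psi> 1\<close> assms by (intro tendstoD) (auto simp: isCont_def tendsto_at_iff_tendsto_nhds)
    then show ?thesis
      using that unfolding eventually_nhds_metric by (auto simp: dist_real_def)
  qed
  \<comment> \<open>\<open>\<delta>1\<close> gives closeness of \<open>\<psi> t\<close> to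
    \<open>\<psi> 1\<close>, the bound 1 gives \<open>w < 2\<close>, and the last bound limits the
    error \<open>(w - 1) * \<psi> 1\<close>, caused by the denominator \<open>w\<close> of the
    weight, to \<open>\<epsilon> / 2\<close>.\<close>
  define \<delta> where "\<delta> = min (min \<delta>1 1) (\<epsilon> / (2 * (\<bar>\<psi> 1\<bar> + 1)))"
  have \<delta>: "\<delta> > 0" "\<delta> \<le> \<delta>1" "\<delta> \<le> 1" "\<delta> * \<bar>\<psi> 1\<bar> \<le> \<epsilon> / 2"
  proof -
    have "\<delta> * (\<bar>\<psi> 1\<bar> + 1) \<le> \<epsilon> / (2 * (\<bar>\<psi> 1\<bar> + 1)) * (\<bar>\<psi> 1\<bar> + 1)"
      by (intro mult_right_mono) (auto simp: \<delta>_def)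
    also have "\<epsilon> / (2 * (\<bar>\<psi> 1\<bar> + 1)) * (\<bar>\<psi> 1\<bar> + 1) = \<epsilon> / 2"
    proof -
      have "\<epsilon> / (2 * k) * k = \<epsilon> / 2" if "k > 0" for k :: real
        using that by simp
      from this[of "\<bar>\<psi> 1\<bar> + 1"] show ?thesis by linarith
    qed
    finally have *: "\<delta> * (\<bar>\<psi> 1\<bar> + 1) \<le> \<epsilon> / 2" .
    show "\<delta> > 0" using \<delta>1(1) assms by (auto simp: \<delta>_def intro!: divide_pos_pos mult_pos_pos)
    then show "\<delta> * \<bar>\<psi> 1\<bar> \<le> \<epsilon> / 2" using * by (simp add: distrib_left)
  qed (auto simp: \<delta>_def)
  \<comment> \<open>The minimum of \<open>|w - 1| / w\<close> over
    \<open>|w - 1| \<ge> \<delta>\<close>, attained at \<open>w = 1 + \<delta>\<close>.\<close>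
  define \<kappa> where "\<kappa> = \<delta> / (1 + \<delta>)"
  have \<kappa>: "\<kappa> > 0" using \<delta> by (simp add: \<kappa>_def)
  \<comment> \<open>The far bound is \<open>(1 + x * f x) * (1 + w)\<close> for \<open>dev\<close>
    plus \<open>|\<psi> 1| * q\<close> for the main term, with \<open>1 + w\<close> at most
    \<open>(1 + 2 / \<delta>) * q / \<kappa>\<close>; dividing by \<open>\<kappa> ^ 2\<close> later
    exchanges \<open>q\<close> for the quartic weight.\<close>
  define A where "A = (1 + x * f x) * (1 + 2 / \<delta>) / \<kappa> + \<bar>\<psi> 1\<bar>"
  have A: "A \<ge> 0" using x_f_nonneg[of x] \<delta> \<kappa> by (simp add: A_def)
  show ?thesis
  proof (intro exI[of _ "A / \<kappa>\<^sup>2"] conjI allI impI)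
    show "A / \<kappa>\<^sup>2 \<ge> 0" using A by simp
    fix w :: real assume w: "w > 0"
    define q where "q = (w - 1)\<^sup>2 / w"
    have q: "q \<ge> 0" using w by (simp add: q_def)
    have r: "(w - 1) ^ 4 / w ^ 3 = q * ((w - 1) / w)\<^sup>2"
      using w by (simp add: q_def power_divide field_simps power2_eq_square power3_eq_cube power4_eq_xxxx)
    show "\<bar>dev w x - x\<^sup>2 * f' x / 2 * ((w - 1)\<^sup>2 / w)\<bar> \<le> \<epsilon> * ((w - 1)\<^sup>2 / w) + A / \<kappa>\<^sup>2 * ((w - 1) ^ 4 / w ^ 3)"
    proof (cases "w = 1")
      case False
      have goal: "\<bar>dev w x - \<psi> 1 * q\<bar> \<le> \<epsilon> * q + A / \<kappa>\<^sup>2 * (q * ((w - 1) / w)\<^sup>2)"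
      proof (cases "\<bar>w - 1\<bar> < \<delta>")
        case True
        obtain t where t: "\<bar>t - 1\<bar> < \<bar>w - 1\<bar>" and "dev w x = (w - 1)\<^sup>2 / 2 * (x\<^sup>2 * f' (x * t))"
          using dev_Taylor[OF assms(1) w False] by metis
        then have "dev w x - \<psi> 1 * q = q * (w * (\<psi> t - \<psi> 1) + (w - 1) * \<psi> 1)"
          using w by (simp add: q_def \<psi>_def field_simps)
        also have "\<bar>\<dots>\<bar> = q * \<bar>w * (\<psi> t - \<psi> 1) + (w - 1) * \<psi> 1\<bar>"
          using q by (simp add: abs_mult)
        also have "\<dots> \<le> q * \<epsilon>"
        proof (rule mult_left_mono[OF _ q])
          have "\<bar>w * (\<psi> t - \<psi> 1)\<bar> \<le> 2 * (\<epsilon> / 4)"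
            unfolding abs_mult using \<delta>1(2)[of t] t True \<delta> w by (intro mult_mono) auto
          moreover have "\<bar>(w - 1) * \<psi> 1\<bar> \<le> \<delta> * \<bar>\<psi> 1\<bar>"
            unfolding abs_mult using True by (intro mult_right_mono) auto
          ultimately show "\<bar>w * (\<psi> t - \<psi> 1) + (w - 1) * \<psi> 1\<bar> \<le> \<epsilon>"
            using \<delta>(4) by linarith
        qed
        finally have "\<bar>dev w x - \<psi> 1 * q\<bar> \<le> \<epsilon> * q" by (simp add: mult.commute)
        moreover have "0 \<le> A / \<kappa>\<^sup>2 * (q * ((w - 1) / w)\<^sup>2)" using A q by simp
        ultimately show ?thesis by linarith
      next
        case far: False
        have "\<kappa> * w \<le> \<bar>w - 1\<bar>"
        proof (cases "w > 1")
          case True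
          then have "\<delta> * w \<le> (w - 1) * (1 + \<delta>)" using far by (simp add: algebra_simps)
          then show ?thesis using True \<delta>(1) by (simp add: \<kappa>_def field_simps)
        next
          case False
          have "\<kappa> * w \<le> \<kappa> * 1" using False \<kappa> by (intro mult_left_mono) auto
          also have "\<kappa> \<le> \<delta>" using \<delta>(1) by (simp add: \<kappa>_def field_simps)
          finally show ?thesis using far by simp
        qed
        then have ratio: "\<kappa> \<le> \<bar>w - 1\<bar> / w" using w by (simp add: field_simps)
        have "2 \<le> 2 / \<delta> * \<bar>w - 1\<bar>" using far \<delta>(1) by (simp add: field_simps)
        then have "1 + w \<le> (1 + 2 / \<delta>) * \<bar>w - 1\<bar>" by (simp add: distrib_right)
        also have "\<bar>w - 1\<bar> \<le> q / \<kappa>"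
        proof -
          have "\<kappa> * \<bar>w - 1\<bar> \<le> \<bar>w - 1\<bar> / w * \<bar>w - 1\<bar>" using ratio by (rule mult_right_mono) auto
          also have "\<dots> = q" by (simp add: q_def power2_eq_square abs_mult_self_eq)
          finally show ?thesis using \<kappa> by (simp add: field_simps)
        qed
        finally have lin: "1 + w \<le> (1 + 2 / \<delta>) * (q / \<kappa>)" using \<delta>(1) by (simp add: mult_left_mono)
        have "\<bar>dev w x\<bar> \<le> 1 + \<bar>w - 1\<bar> * (x * f x)"
        proof -
          have "\<bar>(w - 1) * (x * f x)\<bar> = \<bar>w - 1\<bar> * (x * f x)"
            by (simp only: abs_mult[of "w - 1"] abs_of_nonneg[OF x_f_nonneg])
          moreover have "\<bar>F (x * w) - F x\<bar> \<le> 1"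
            using F_bounds[of x] F_bounds[of "x * w"] by (simp add: abs_if)
          ultimately show ?thesis unfolding dev_def by linarith
        qed
        also have "\<dots> \<le> (1 + w) + (1 + w) * (x * f x)"
          using w x_f_nonneg[of x] by (intro add_mono mult_right_mono) auto
        also have "\<dots> = (1 + x * f x) * (1 + w)" by (simp add: algebra_simps)
        also have "\<dots> \<le> (1 + x * f x) * ((1 + 2 / \<delta>) * (q / \<kappa>))"
          using lin x_f_nonneg[of x] by (intro mult_left_mono) auto
        finally have "\<bar>dev w x\<bar> \<le> (1 + x * f x) * ((1 + 2 / \<delta>) * (q / \<kappa>))" .
        moreover have "\<bar>\<psi> 1 * q\<bar> = \<bar>\<psi> 1\<bar> * q" using q by (simp add: abs_mult)
        ultimately have "\<bar>dev w x - \<psi> 1 * q\<bar> \<le> (1 + x * f x) * ((1 + 2 / \<delta>) * (q / \<kappa>)) + \<bar>\<psi> 1\<bar> * q"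
          by linarith
        also have "\<dots> = A / \<kappa>\<^sup>2 * (q * \<kappa>\<^sup>2)"
        proof -
          have "A / \<kappa>\<^sup>2 * (q * \<kappa>\<^sup>2) = A * q" using \<kappa> by simp
          then show ?thesis by (simp add: A_def distrib_right)
        qed
        also have "\<dots> \<le> A / \<kappa>\<^sup>2 * (q * ((w - 1) / w)\<^sup>2)"
        proof (intro mult_left_mono q)
          have "\<kappa>\<^sup>2 \<le> (\<bar>w - 1\<bar> / w)\<^sup>2" using ratio \<kappa> by (intro power_mono) auto
          then show "\<kappa>\<^sup>2 \<le> ((w - 1) / w)\<^sup>2" by (simp add: power_divide)
        qed (use A in auto)
        finally show ?thesis using q assms by (simp add: add_increasing)
      qed
      then show ?thesis unfolding r by (simp add: q_def \<psi>_def)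
    qed simp
  qed
qed

end

text \<open>The absolute value makes one formula serve both orders of \<open>a\<close> and \<open>w\<close>.\<close>

lemma has_bochner_integral_segment:
  fixes \<Phi> h :: "real \<Rightarrow> real"
  assumes "\<And>s. min a w \<le> s \<Longrightarrow> s \<le> max a w \<Longrightarrow> (\<Phi> has_real_derivative (w - s) * h s) (at s)"
    and "\<And>s. min a w \<le> s \<Longrightarrow> s \<le> max a w \<Longrightarrow> isCont h s"
  shows "has_bochner_integral lborel (\<lambda>s. indicator {min a w..max a w} s * (\<bar>w - s\<bar> * h s)) (\<Phi> w - \<Phi> a)"
proof -
  have FTC: "has_bochner_integral lborel (\<lambda>s. (w - s) * h s * indicator {min a w..max a w} s)
      (\<Phi> (max a w) - \<Phi> (min a w))"
    by (rule has_bochner_integral_FTC_Icc_real) (use assms in \<open>auto intro!: continuous_intros\<close>)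
  show ?thesis
  proof (cases "a \<le> w")
    case True
    then have "(\<lambda>s. indicator {min a w..max a w} s * (\<bar>w - s\<bar> * h s)) =
        (\<lambda>s. (w - s) * h s * indicator {min a w..max a w} s)"
      by (auto simp: fun_eq_iff indicator_def)
    with FTC True show ?thesis by (simp add: max_def min_def split: if_splits)
  next
    case False
    then have "(\<lambda>s. indicator {min a w..max a w} s * (\<bar>w - s\<bar> * h s)) =
        (\<lambda>s. - ((w - s) * h s * indicator {min a w..max a w} s))"
      by (auto simp: fun_eq_iff indicator_def algebra_simps)
    with has_bochner_integral_minus[OF FTC] False show ?thesis by simp
  qed
qed

section \<open>Square integral of the Taylor remainder in \<open>x\<close>\<close>

context igam_target
begin

lemma nn_integral_f'_scaled:
  assumes "s > 0"
  shows "(\<integral>\<^sup>+ x. ennreal (x ^ 4 * (f' (x * s))\<^sup>2) \<partial>lborel) = ennreal (Q / s ^ 5)"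
proof -
  have "ennreal Q = (\<integral>\<^sup>+ x. ennreal (x ^ 4 * (f' x)\<^sup>2) \<partial>lborel)"
    unfolding Q_def using int_f' by (subst nn_integral_eq_integral) auto
  also have "\<dots> = ennreal \<bar>s\<bar> * (\<integral>\<^sup>+ x. ennreal ((0 + s * x) ^ 4 * (f' (0 + s * x))\<^sup>2) \<partial>lborel)"
    by (rule nn_integral_real_affine) (use assms in auto)
  also have "\<dots> = ennreal \<bar>s\<bar> * (\<integral>\<^sup>+ x. ennreal (s ^ 4) * ennreal (x ^ 4 * (f' (x * s))\<^sup>2) \<partial>lborel)"
  proof -
    have "(0 + s * x) ^ 4 * (f' (0 + s * x))\<^sup>2 = s ^ 4 * (x ^ 4 * (f' (x * s))\<^sup>2)" for x
      by (simp add: power_mult_distrib mult_ac)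
    moreover have "ennreal (s ^ 4 * (x ^ 4 * (f' (x * s))\<^sup>2)) = ennreal (s ^ 4) * ennreal (x ^ 4 * (f' (x * s))\<^sup>2)" for x
      by (rule ennreal_mult) auto
    ultimately show ?thesis by (simp only:)
  qed
  also have "\<dots> = ennreal (s ^ 5) * (\<integral>\<^sup>+ x. ennreal (x ^ 4 * (f' (x * s))\<^sup>2) \<partial>lborel)"
  proof -
    have "s ^ 5 = \<bar>s\<bar> * s ^ 4" using assms by (simp add: eval_nat_numeral)
    then show ?thesis by (subst nn_integral_cmult) (auto simp: ennreal_mult mult.assoc)
  qed
  finally have *: "ennreal Q = \<dots>" .
  have "(\<integral>\<^sup>+ x. ennreal (x ^ 4 * (f' (x * s))\<^sup>2) \<partial>lborel) = ennreal (1 / s ^ 5) * ennreal Q"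
    unfolding * mult.assoc[symmetric] using assms by (simp add: ennreal_mult[symmetric])
  then show ?thesis using assms Q_nonneg by (simp add: ennreal_mult[symmetric])
qed

text \<open>
  Cauchy-Schwarz with weight \<open>s\<close> to the power \<open>-3\<close>: then both factors on the right have finite means under the
  inverse Gamma law of \<open>w\<close> for every \<open>b > 0\<close>, although \<open>w\<^sup>2\<close> has infinite mean for \<open>b \<ge> 1\<close>.
\<close>

lemma dev_L2_bound:
  assumes w: "w > 0"
  shows "(\<integral>\<^sup>+ x. ennreal (indicator {0<..} x * (dev w x)\<^sup>2) \<partial>lborel) \<le>
    ennreal ((w - 1)\<^sup>2 / (2 * w) * ((w - 1 - ln w) * Q))"
proof -
  let ?I = "{min 1 w..max 1 w}"
  have pos: "s > 0" if "s \<in> ?I" for s using that w by (auto simp: min_def split: if_splits)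
  have p: "has_bochner_integral lborel (\<lambda>s. indicator ?I s * (\<bar>w - s\<bar> * (1 / s ^ 3)))
      ((- w / (2 * w\<^sup>2) + 1 / w) - (- w / (2 * 1\<^sup>2) + 1 / 1))"
  proof (rule has_bochner_integral_segment)
    fix s assume "min 1 w \<le> s" "s \<le> max 1 w"
    then have s: "s > 0" using pos by auto
    show "((\<lambda>s. - w / (2 * s\<^sup>2) + 1 / s) has_real_derivative (w - s) * (1 / s ^ 3)) (at s)"
      using s by (auto intro!: derivative_eq_intros simp: field_simps power2_eq_square power3_eq_cube power4_eq_xxxx)
    show "isCont (\<lambda>s. 1 / s ^ 3) s" using s by (auto intro!: continuous_intros)
  qed
  also have "(- w / (2 * w\<^sup>2) + 1 / w) - (- w / (2 * 1\<^sup>2) + 1 / 1) = (w - 1)\<^sup>2 / (2 * w)"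
    using w by (simp add: field_simps power2_eq_square)
  finally have p: "has_bochner_integral lborel (\<lambda>s. indicator ?I s * (\<bar>w - s\<bar> * (1 / s ^ 3))) ((w - 1)\<^sup>2 / (2 * w))" .
  have r: "has_bochner_integral lborel (\<lambda>s. indicator ?I s * (\<bar>w - s\<bar> * (1 / s\<^sup>2)))
      ((- w / w - ln w) - (- w / 1 - ln 1))"
  proof (rule has_bochner_integral_segment)
    fix s assume "min 1 w \<le> s" "s \<le> max 1 w"
    then have s: "s > 0" using pos by auto
    show "((\<lambda>s. - w / s - ln s) has_real_derivative (w - s) * (1 / s\<^sup>2)) (at s)"
      using s by (auto intro!: derivative_eq_intros simp: field_simps power2_eq_square)
    show "isCont (\<lambda>s. 1 / s\<^sup>2) s" using s by (auto intro!: continuous_intros)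
  qed
  have pointwise: "ennreal ((dev w x)\<^sup>2) \<le> ennreal ((w - 1)\<^sup>2 / (2 * w)) *
      (\<integral>\<^sup>+ s. ennreal (indicator ?I s * (\<bar>w - s\<bar> * s ^ 3)) * ennreal (x ^ 4 * (f' (x * s))\<^sup>2) \<partial>lborel)"
    if x: "x > 0" for x
  proof -
    \<comment> \<open>Integral form of the Taylor remainder: the antiderivative
      \<open>F (x * s) + (w - s) * (x * f (x * s))\<close> has the difference \<open>dev w x\<close>
      between \<open>s = 1\<close> and \<open>s = w\<close>.\<close>
    have d: "has_bochner_integral lborel (\<lambda>s. indicator ?I s * (\<bar>w - s\<bar> * (x\<^sup>2 * f' (x * s))))
      ((F (x * w) + (w - w) * (x * f (x * w))) - (F (x * 1) + (w - 1) * (x * f (x * 1))))"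
    proof (rule has_bochner_integral_segment)
      fix s assume "min 1 w \<le> s" "s \<le> max 1 w"
      then have xs: "x * s > 0" using pos x by auto
      have D1: "((\<lambda>s. F (x * s)) has_real_derivative f (x * s) * x) (at s)"
        by (rule DERIV_chain2[where f = F and g = "\<lambda>s. x * s", OF cdf_deriv[OF xs]]) (auto intro!: derivative_eq_intros)
      have D2: "((\<lambda>s. f (x * s)) has_real_derivative f' (x * s) * x) (at s)"
        by (rule DERIV_chain2[where f = f and g = "\<lambda>s. x * s", OF f_deriv[OF xs]]) (auto intro!: derivative_eq_intros)
      show "((\<lambda>s. F (x * s) + (w - s) * (x * f (x * s))) has_real_derivative (w - s) * (x\<^sup>2 * f' (x * s))) (at s)"
      proof (rule DERIV_cong[OF DERIV_add[OF D1 DERIV_mult[OF _ DERIV_cmult[OF D2]]]])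
        show "((\<lambda>s. w - s) has_real_derivative -1) (at s)" by (auto intro!: derivative_eq_intros)
      qed (simp add: algebra_simps power2_eq_square)
      have "isCont f' (x * s)"
        using f'_cont xs by (simp add: continuous_on_eq_continuous_at)
      then show "isCont (\<lambda>s. x\<^sup>2 * f' (x * s)) s"
        by (intro continuous_intros isCont_o2[where f = "\<lambda>s. x * s" and g = f']) auto
    qed
    let ?\<phi> = "\<lambda>s. indicator ?I s * (\<bar>w - s\<bar> * (x\<^sup>2 * f' (x * s)))"
    let ?p = "\<lambda>s. indicator ?I s * (\<bar>w - s\<bar> * (1 / s ^ 3))"
    have "ennreal ((\<integral> s. ?\<phi> s \<partial>lborel)\<^sup>2) \<le>
        ennreal (\<integral> s. ?p s \<partial>lborel) * (\<integral>\<^sup>+ s. ennreal ((?\<phi> s)\<^sup>2 / ?p s) \<partial>lborel)"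
      by (rule weighted_Cauchy_Schwarz)
         (use d p pos in \<open>auto simp: has_bochner_integral_iff indicator_def less_imp_le intro!: AE_I2\<close>)
    also have "(\<integral> s. ?\<phi> s \<partial>lborel) = dev w x"
      using d by (simp add: has_bochner_integral_iff dev_def)
    also have "(\<integral> s. ?p s \<partial>lborel) = (w - 1)\<^sup>2 / (2 * w)"
      using p by (simp add: has_bochner_integral_iff)
    also have "(\<lambda>s. ennreal ((?\<phi> s)\<^sup>2 / ?p s)) =
        (\<lambda>s. ennreal (indicator ?I s * (\<bar>w - s\<bar> * s ^ 3)) * ennreal (x ^ 4 * (f' (x * s))\<^sup>2))"
    proof
      fix s
      have "(?\<phi> s)\<^sup>2 / ?p s = (indicator ?I s * (\<bar>w - s\<bar> * s ^ 3)) * (x ^ 4 * (f' (x * s))\<^sup>2)"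
      proof (cases "s \<in> ?I \<and> s \<noteq> w")
        case True
        then have "\<bar>w - s\<bar> \<noteq> 0" by auto
        have "(\<bar>w - s\<bar> * (x\<^sup>2 * f' (x * s)))\<^sup>2 / (\<bar>w - s\<bar> * (1 / s ^ 3)) =
            (\<bar>w - s\<bar> / \<bar>w - s\<bar>) * (\<bar>w - s\<bar> * s ^ 3) * (x ^ 4 * (f' (x * s))\<^sup>2)"
          by (simp add: power_mult_distrib power2_eq_square power4_eq_xxxx)
        then show ?thesis using True \<open>\<bar>w - s\<bar> \<noteq> 0\<close> by simp
      qed auto
      then show "ennreal ((?\<phi> s)\<^sup>2 / ?p s) =
          ennreal (indicator ?I s * (\<bar>w - s\<bar> * s ^ 3)) * ennreal (x ^ 4 * (f' (x * s))\<^sup>2)"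
        by (simp only:) (simp add: ennreal_mult'')
    qed
    finally show ?thesis .
  qed
  have "(\<integral>\<^sup>+ x. ennreal (indicator {0<..} x * (dev w x)\<^sup>2) \<partial>lborel) \<le>
      (\<integral>\<^sup>+ x. ennreal ((w - 1)\<^sup>2 / (2 * w)) *
        (\<integral>\<^sup>+ s. ennreal (indicator ?I s * (\<bar>w - s\<bar> * s ^ 3)) * ennreal (x ^ 4 * (f' (x * s))\<^sup>2) \<partial>lborel) \<partial>lborel)"
    using pointwise by (intro nn_integral_mono) (auto simp: indicator_def)
  also have "\<dots> = ennreal ((w - 1)\<^sup>2 / (2 * w)) *
      (\<integral>\<^sup>+ x. \<integral>\<^sup>+ s. ennreal (indicator ?I s * (\<bar>w - s\<bar> * s ^ 3)) * ennreal (x ^ 4 * (f' (x * s))\<^sup>2) \<partial>lborel \<partial>lborel)"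
    by (rule nn_integral_cmult) measurable
  also have "(\<integral>\<^sup>+ x. \<integral>\<^sup>+ s. ennreal (indicator ?I s * (\<bar>w - s\<bar> * s ^ 3)) * ennreal (x ^ 4 * (f' (x * s))\<^sup>2) \<partial>lborel \<partial>lborel) =
      (\<integral>\<^sup>+ s. \<integral>\<^sup>+ x. ennreal (indicator ?I s * (\<bar>w - s\<bar> * s ^ 3)) * ennreal (x ^ 4 * (f' (x * s))\<^sup>2) \<partial>lborel \<partial>lborel)"
    by (rule lborel_pair.Fubini'[symmetric]) measurable
  \<comment> \<open>Dilation contributes \<open>s\<close> to the power -5, which leaves the power -2
    beside the factor \<open>s ^ 3\<close> from the inverse weight; integrated against
    \<open>|w - s|\<close> this gives \<open>w - 1 - ln w\<close>.\<close>
  also have "\<dots> = (\<integral>\<^sup>+ s. ennreal (indicator ?I s * (\<bar>w - s\<bar> * (1 / s\<^sup>2)) * Q) \<partial>lborel)"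
  proof (rule nn_integral_cong)
    fix s :: real
    show "(\<integral>\<^sup>+ x. ennreal (indicator ?I s * (\<bar>w - s\<bar> * s ^ 3)) * ennreal (x ^ 4 * (f' (x * s))\<^sup>2) \<partial>lborel) =
        ennreal (indicator ?I s * (\<bar>w - s\<bar> * (1 / s\<^sup>2)) * Q)"
    proof (cases "s \<in> ?I")
      case True
      then have s: "s > 0" using pos by auto
      have eq: "\<bar>w - s\<bar> * s ^ 3 * (Q / s ^ 5) = \<bar>w - s\<bar> * (1 / s\<^sup>2) * Q"
        using s by (simp add: eval_nat_numeral field_simps)
      have "(\<integral>\<^sup>+ x. ennreal (indicator ?I s * (\<bar>w - s\<bar> * s ^ 3)) * ennreal (x ^ 4 * (f' (x * s))\<^sup>2) \<partial>lborel) =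
          ennreal (\<bar>w - s\<bar> * s ^ 3) * ennreal (Q / s ^ 5)"
        using True by (subst nn_integral_cmult) (auto simp: nn_integral_f'_scaled[OF s])
      also have "\<dots> = ennreal (\<bar>w - s\<bar> * s ^ 3 * (Q / s ^ 5))"
        using s Q_nonneg by (intro ennreal_mult[symmetric]) auto
      finally show ?thesis unfolding eq using True by simp
    qed simp
  qed
  also have "\<dots> = ennreal ((w - 1 - ln w) * Q)"
  proof -
    have "has_bochner_integral lborel (\<lambda>s. indicator ?I s * (\<bar>w - s\<bar> * (1 / s\<^sup>2)) * Q)
        (((- w / w - ln w) - (- w / 1 - ln 1)) * Q)"
      by (rule has_bochner_integral_mult_left) (rule r)
    also have "(- w / w - ln w) - (- w / 1 - ln 1) = w - 1 - ln w"
      using w by simp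
    finally have r': "has_bochner_integral lborel (\<lambda>s. indicator ?I s * (\<bar>w - s\<bar> * (1 / s\<^sup>2)) * Q) ((w - 1 - ln w) * Q)" .
    have "(\<integral>\<^sup>+ s. ennreal (indicator ?I s * (\<bar>w - s\<bar> * (1 / s\<^sup>2)) * Q) \<partial>lborel) =
        ennreal (\<integral> s. indicator ?I s * (\<bar>w - s\<bar> * (1 / s\<^sup>2)) * Q \<partial>lborel)"
      by (rule nn_integral_eq_integral[OF integrable.intros[OF r']]) (auto simp: Q_nonneg)
    then show ?thesis by (simp only: has_bochner_integral_integral_eq[OF r'])
  qed
  also have "ennreal ((w - 1)\<^sup>2 / (2 * w)) * ennreal ((w - 1 - ln w) * Q) =
      ennreal ((w - 1)\<^sup>2 / (2 * w) * ((w - 1 - ln w) * Q))"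
    using w Q_nonneg ln_le_minus_one[OF w] by (intro ennreal_mult[symmetric]) auto
  finally show ?thesis .
qed

end

section \<open>Integrated bias\<close>

text \<open>Fatou's lemma bounds the lower limit of the integrals from below, and the bounds
  \<open>c n\<close> bound the upper limit from above by the same number. This replaces dominated
  convergence.\<close>

lemma tendsto_nn_integral_of_upper_bound:
  fixes u :: "nat \<Rightarrow> 'a \<Rightarrow> ennreal"
  assumes [measurable]: "\<And>n. u n \<in> borel_measurable M"
    and lim: "AE x in M. (\<lambda>n. u n x) \<longlonglongrightarrow> v x"
    and bound: "\<And>n. (\<integral>\<^sup>+ x. u n x \<partial>M) \<le> c n" and c: "c \<longlonglongrightarrow> (\<integral>\<^sup>+ x. v x \<partial>M)"
  shows "(\<lambda>n. \<integral>\<^sup>+ x. u n x \<partial>M) \<longlonglongrightarrow> (\<integral>\<^sup>+ x. v x \<partial>M)"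
proof -
  let ?I = "\<lambda>n. \<integral>\<^sup>+ x. u n x \<partial>M" and ?v = "\<integral>\<^sup>+ x. v x \<partial>M"
  have "?v = (\<integral>\<^sup>+ x. liminf (\<lambda>n. u n x) \<partial>M)"
    using lim by (intro nn_integral_cong_AE, eventually_elim) (simp add: lim_imp_Liminf)
  also have "\<dots> \<le> liminf ?I"
    by (rule nn_integral_liminf) simp
  finally have lower: "?v \<le> liminf ?I" .
  have "limsup ?I \<le> limsup c"
    using bound by (intro Limsup_mono) auto
  also have "limsup c = ?v"
    using c by (simp add: lim_imp_Limsup)
  finally have upper: "limsup ?I \<le> ?v" .
  have "liminf ?I \<le> limsup ?I" by (simp add: Liminf_le_Limsup)
  with lower upper show ?thesis
    by (intro Liminf_eq_Limsup) auto
qed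

section \<open>Means of the error weights under the kernel law\<close>

lemma scaled_gamma_const:
  assumes "b > 0"
  shows "has_bochner_integral (scaled_gamma b) (\<lambda>v. c) (c::real)"
proof -
  interpret prob_space "scaled_gamma b" by (rule prob_space_scaled_gamma) fact
  show ?thesis
    using has_bochner_integral_integrable[of "scaled_gamma b" "\<lambda>_. c"] prob_space by simp
qed

text \<open>As a function of \<open>v\<close> the weight is \<open>1 / v - 2 + v\<close>. Its mean
  is exactly \<open>b\<close>, the source of the leading bias
  \<open>b * x ^ 2 * f' x / 2\<close>.\<close>

lemma scaled_gamma_quadratic:
  assumes "b > 0"
  shows "has_bochner_integral (scaled_gamma b) (\<lambda>v. (1 / v - 1)\<^sup>2 / (1 / v)) b"
proof -
  have "has_bochner_integral (scaled_gamma b) (\<lambda>v. 1 / v - 2 + v) (1 - 2 + (1 + b))"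
    by (intro has_bochner_integral_add has_bochner_integral_diff scaled_gamma_moments scaled_gamma_const assms)
  moreover have "AE v in scaled_gamma b. 1 / v - 2 + v = (1 / v - 1)\<^sup>2 / (1 / v)"
    using AE_scaled_gamma_pos[OF assms]
    by eventually_elim (simp add: field_simps power2_eq_square)
  ultimately show ?thesis
    by (subst has_bochner_integral_cong_AE[symmetric]) auto
qed

lemma scaled_gamma_quartic:
  assumes "b > 0"
  shows "has_bochner_integral (scaled_gamma b) (\<lambda>v. (1 / v - 1) ^ 4 / (1 / v) ^ 3) (3 * b\<^sup>2 + 6 * b ^ 3)"
proof -
  have "has_bochner_integral (scaled_gamma b) (\<lambda>v. 1 / v - 4 + 6 * v - 4 * v ^ 2 + v ^ 3)
      (1 - 4 + 6 * (1 + b) - 4 * ((1 + b) * (1 + 2 * b)) + (1 + b) * (1 + 2 * b) * (1 + 3 * b))"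
    by (intro has_bochner_integral_add has_bochner_integral_diff has_bochner_integral_mult_right
      scaled_gamma_moments scaled_gamma_const assms)
  also have "1 - 4 + 6 * (1 + b) - 4 * ((1 + b) * (1 + 2 * b)) + (1 + b) * (1 + 2 * b) * (1 + 3 * b) = 3 * b\<^sup>2 + 6 * b ^ 3"
    by (simp add: algebra_simps power2_eq_square power3_eq_cube)
  moreover have "AE v in scaled_gamma b. 1 / v - 4 + 6 * v - 4 * v ^ 2 + v ^ 3 = (1 / v - 1) ^ 4 / (1 / v) ^ 3"
    using AE_scaled_gamma_pos[OF assms]
    by eventually_elim (simp add: field_simps power2_eq_square power3_eq_cube power4_eq_xxxx)
  ultimately show ?thesis
    by (subst has_bochner_integral_cong_AE[symmetric]) auto
qed

text \<open>The arithmetic-geometric inequality bounds \<open>2 * |w - 1|\<close> by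
  \<open>(w - 1) ^ 2 / (w * sqrt b) + sqrt b * w\<close>; the factor \<open>sqrt b\<close> is chosen
  so that both summands have mean \<open>sqrt b\<close>. This avoids the second moment of
  \<open>w\<close>.\<close>

lemma scaled_gamma_linear:
  assumes b: "b > 0"
  shows "(\<integral>\<^sup>+ v. ennreal \<bar>1 / v - 1\<bar> \<partial>scaled_gamma b) \<le> ennreal (sqrt b)"
proof -
  have sb: "sqrt b > 0" using b by simp
  have "(\<integral>\<^sup>+ v. ennreal \<bar>1 / v - 1\<bar> \<partial>scaled_gamma b) \<le>
      (\<integral>\<^sup>+ v. ennreal (((1 / v - 1)\<^sup>2 / (1 / v) / sqrt b + sqrt b * (1 / v)) / 2) \<partial>scaled_gamma b)"
  proof (rule nn_integral_mono_AE, use AE_scaled_gamma_pos[OF b] in eventually_elim)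
    fix v :: real assume v: "0 < v"
    define w where "w = 1 / v"
    have w: "w > 0" using v by (simp add: w_def)
    have "0 \<le> (\<bar>w - 1\<bar> - sqrt b * w)\<^sup>2 / (w * sqrt b)" using w sb by simp
    also have "\<dots> = (w - 1)\<^sup>2 / w / sqrt b + sqrt b * w - 2 * \<bar>w - 1\<bar>"
      using w sb by (simp add: power2_diff field_simps power2_eq_square)
    finally show "ennreal \<bar>1 / v - 1\<bar> \<le> ennreal (((1 / v - 1)\<^sup>2 / (1 / v) / sqrt b + sqrt b * (1 / v)) / 2)"
      unfolding w_def[symmetric] by (intro ennreal_leI) simp
  qed
  also have "\<dots> = ennreal ((b / sqrt b + sqrt b * 1) / 2)"
  proof -
    have *: "has_bochner_integral (scaled_gamma b) (\<lambda>v. ((1 / v - 1)\<^sup>2 / (1 / v) / sqrt b + sqrt b * (1 / v)) / 2)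
        ((b / sqrt b + sqrt b * 1) / 2)"
      by (intro has_bochner_integral_divide has_bochner_integral_add has_bochner_integral_mult_right
        scaled_gamma_quadratic scaled_gamma_moments b)
    have "AE v in scaled_gamma b. 0 \<le> ((1 / v - 1)\<^sup>2 / (1 / v) / sqrt b + sqrt b * (1 / v)) / 2"
      using AE_scaled_gamma_pos[OF b] by eventually_elim (use sb in simp)
    from nn_integral_eq_integral[OF integrable.intros[OF *] this] show ?thesis
      by (simp only: has_bochner_integral_integral_eq[OF *])
  qed
  also have "(b / sqrt b + sqrt b * 1) / 2 = sqrt b" using b by (simp add: real_div_sqrt)
  finally show ?thesis .
qed

text \<open>The leading term \<open>b / 2\<close> must be exact. The bound
  \<open>ln v \<le> v - 1\<close> would give \<open>b\<close>, and the quadratic Taylor polynomial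
  is no upper bound for \<open>v > 1\<close>. The cubic one is a global bound, since its difference
  to \<open>ln v\<close> has derivative \<open>(v - 1) ^ 3 / v\<close> and so is minimal at
  1.\<close>

lemma scaled_gamma_log:
  assumes b: "b > 0"
  shows "(\<integral>\<^sup>+ v. ennreal (1 / v - 1 - ln (1 / v)) \<partial>scaled_gamma b) \<le> ennreal (b / 2 + 2 / 3 * b\<^sup>2 + 2 * b ^ 3)"
proof -
  define P where "P v = 1 / v - 1 + ((v - 1) - (v - 1)\<^sup>2 / 2 + (v - 1) ^ 3 / 3)" for v :: real
  have ln_le: "ln v \<le> (v - 1) - (v - 1)\<^sup>2 / 2 + (v - 1) ^ 3 / 3" if "v > 0" for v :: real
  proof -
    define \<phi> where "\<phi> v = (v - 1) - (v - 1)\<^sup>2 / 2 + (v - 1) ^ 3 / 3 - ln v" for v :: real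
    have der: "(\<phi> has_real_derivative (v - 1) ^ 3 / v) (at v)" if "v > 0" for v
      unfolding \<phi>_def using that
      by (auto intro!: derivative_eq_intros simp: field_simps power2_eq_square power3_eq_cube)
    have "\<phi> 1 \<le> \<phi> v"
    proof (cases "v \<ge> 1")
      case True
      then show ?thesis
      proof (rule DERIV_nonneg_imp_nondecreasing)
        fix t assume "1 \<le> t" "t \<le> v"
        then show "\<exists>y. (\<phi> has_real_derivative y) (at t) \<and> 0 \<le> y"
          by (intro exI[of _ "(t - 1) ^ 3 / t"] conjI der) auto
      qed
    next
      case False
      then have "v \<le> 1" by simp
      then show ?thesis
      proof (rule DERIV_nonpos_imp_nonincreasing)
        fix t assume "v \<le> t" "t \<le> 1"
        then show "\<exists>y. (\<phi> has_real_derivative y) (at t) \<and> y \<le> 0"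
          using that by (intro exI[of _ "(t - 1) ^ 3 / t"] conjI der) (auto simp: divide_le_0_iff power_le_zero_eq)
      qed
    qed
    then show ?thesis by (simp add: \<phi>_def)
  qed
  have "(\<integral>\<^sup>+ v. ennreal (1 / v - 1 - ln (1 / v)) \<partial>scaled_gamma b) \<le> (\<integral>\<^sup>+ v. ennreal (P v) \<partial>scaled_gamma b)"
    by (rule nn_integral_mono_AE, use AE_scaled_gamma_pos[OF b] in eventually_elim)
       (auto intro!: ennreal_leI simp: P_def ln_div dest: ln_le)
  also have "\<dots> = ennreal (b / 2 + 2 / 3 * b\<^sup>2 + 2 * b ^ 3)"
  proof -
    have "has_bochner_integral (scaled_gamma b) (\<lambda>v. 1 / v - 17 / 6 + 3 * v - 3 / 2 * v ^ 2 + 1 / 3 * v ^ 3)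
        (1 - 17 / 6 + 3 * (1 + b) - 3 / 2 * ((1 + b) * (1 + 2 * b)) + 1 / 3 * ((1 + b) * (1 + 2 * b) * (1 + 3 * b)))"
      by (intro has_bochner_integral_add has_bochner_integral_diff has_bochner_integral_mult_right
        scaled_gamma_moments scaled_gamma_const b)
    also have "(\<lambda>v. 1 / v - 17 / 6 + 3 * v - 3 / 2 * v ^ 2 + 1 / 3 * v ^ 3) = P"
      by (auto simp: fun_eq_iff P_def field_simps power2_eq_square power3_eq_cube)
    also have "1 - 17 / 6 + 3 * (1 + b) - 3 / 2 * ((1 + b) * (1 + 2 * b)) + 1 / 3 * ((1 + b) * (1 + 2 * b) * (1 + 3 * b)) =
        b / 2 + 2 / 3 * b\<^sup>2 + 2 * b ^ 3"
      by (simp add: field_simps power2_eq_square power3_eq_cube)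
    finally have *: "has_bochner_integral (scaled_gamma b) P (b / 2 + 2 / 3 * b\<^sup>2 + 2 * b ^ 3)" .
    have "AE v in scaled_gamma b. 0 \<le> P v"
      using AE_scaled_gamma_pos[OF b]
    proof eventually_elim
      case (elim v)
      have "0 \<le> 1 / v - 1 - ln (1 / v)" using ln_le_minus_one[of "1 / v"] elim by simp
      then show ?case using ln_le[OF elim] elim by (simp add: P_def ln_div)
    qed
    from nn_integral_eq_integral[OF integrable.intros[OF *] this] show ?thesis
      by (simp only: has_bochner_integral_integral_eq[OF *])
  qed
  finally show ?thesis .
qed

section \<open>Bias of the estimator: L1 bound, L2 bound, pointwise limit\<close>

context igam_target
begin

text \<open>The mean of the estimator at \<open>x > 0\<close>, as \<open>estimator_moments\<close>
  shows; \<open>sbias\<close> is then its bias.\<close>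

definition smoothed :: "real \<Rightarrow> real \<Rightarrow> real" where
  "smoothed b x = (\<integral> v. F (x * (1 / v)) \<partial>scaled_gamma b)"

definition sbias :: "real \<Rightarrow> real \<Rightarrow> real" where
  "sbias b x = smoothed b x - F x"

lemma smoothed_measurable [measurable]: "b > 0 \<Longrightarrow> smoothed b \<in> borel_measurable borel"
proof -
  assume "b > 0"
  then interpret G: prob_space "scaled_gamma b" by (rule prob_space_scaled_gamma)
  show ?thesis unfolding smoothed_def by measurable
qed

lemma sbias_measurable [measurable]: "b > 0 \<Longrightarrow> sbias b \<in> borel_measurable borel"
  unfolding sbias_def by measurable

text \<open>The linear term of \<open>dev (1 / v) x\<close> averages to zero because
  \<open>1 / v\<close> has mean 1.\<close>

lemma sbias_conv_dev:
  assumes b: "b > 0"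
  shows "has_bochner_integral (scaled_gamma b) (\<lambda>v. dev (1 / v) x) (sbias b x)"
proof -
  interpret G: prob_space "scaled_gamma b" by (rule prob_space_scaled_gamma) fact
  have "has_bochner_integral (scaled_gamma b) (\<lambda>v. F (x * (1 / v))) (smoothed b x)"
    unfolding smoothed_def using F_bounds
    by (intro has_bochner_integral_integrable G.integrable_const_bound[where B = 1]) auto
  moreover have "has_bochner_integral (scaled_gamma b) (\<lambda>v. F x) (F x)"
    using has_bochner_integral_integrable[of "scaled_gamma b" "\<lambda>_. F x"] G.prob_space by simp
  moreover have "has_bochner_integral (scaled_gamma b) (\<lambda>v. (1 / v - 1) * (x * f x)) ((1 - 1) * (x * f x))"
    using has_bochner_integral_integrable[of "scaled_gamma b" "\<lambda>_. 1::real"] G.prob_space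
    by (intro has_bochner_integral_mult_left has_bochner_integral_diff scaled_gamma_moments(1) b) simp
  ultimately have "has_bochner_integral (scaled_gamma b) (\<lambda>v. F (x * (1 / v)) - F x - (1 / v - 1) * (x * f x))
      (smoothed b x - F x - (1 - 1) * (x * f x))"
    by (intro has_bochner_integral_diff)
  then show ?thesis by (simp add: dev_def sbias_def)
qed

lemma nn_integral_dev_swap:
  fixes \<phi> :: "real \<times> real \<Rightarrow> ennreal"
  assumes b: "b > 0" and [measurable]: "\<phi> \<in> borel_measurable (borel \<Otimes>\<^sub>M borel)"
  shows "(\<integral>\<^sup>+ x. \<integral>\<^sup>+ v. \<phi> (x, v) \<partial>scaled_gamma b \<partial>lborel) = (\<integral>\<^sup>+ v. \<integral>\<^sup>+ x. \<phi> (x, v) \<partial>lborel \<partial>scaled_gamma b)"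
proof -
  interpret G: prob_space "scaled_gamma b" by (rule prob_space_scaled_gamma) fact
  interpret P: pair_sigma_finite "lborel :: real measure" "scaled_gamma b" ..
  have "case_prod (\<lambda>x v. \<phi> (x, v)) \<in> borel_measurable (lborel \<Otimes>\<^sub>M scaled_gamma b)"
    by (simp add: case_prod_beta) measurable
  from P.Fubini'[of "\<lambda>x v. \<phi> (x, v)", OF this] show ?thesis by (rule sym)
qed

text \<open>Averaging \<open>dev_L1_bound\<close> over \<open>w = 1 / v\<close> gives
  \<open>\<epsilon> * sqrt b\<close> from \<open>scaled_gamma_linear\<close> and
  \<open>C * b\<close> from \<open>scaled_gamma_quadratic\<close>. As \<open>\<epsilon>\<close> is
  arbitrary, the L1 norm of the bias is of smaller order than \<open>sqrt b\<close>.\<close>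

lemma sbias_L1_bound:
  assumes "\<epsilon> > 0"
  shows "\<exists>C\<ge>0. \<forall>b>0. (\<integral>\<^sup>+ x. ennreal (indicator {0<..} x * \<bar>sbias b x\<bar>) \<partial>lborel) \<le> ennreal (\<epsilon> * sqrt b + C * b)"
proof -
  obtain C where C: "C \<ge> 0" "\<And>w. w > 0 \<Longrightarrow>
    (\<integral> x. indicator {0<..} x * \<bar>dev w x\<bar> \<partial>lborel) \<le> \<epsilon> * \<bar>w - 1\<bar> + C * ((w - 1)\<^sup>2 / w)"
    using dev_L1_bound[OF assms] by auto
  have "(\<integral>\<^sup>+ x. ennreal (indicator {0<..} x * \<bar>sbias b x\<bar>) \<partial>lborel) \<le> ennreal (\<epsilon> * sqrt b + C * b)"
    if b: "b > 0" for b
  proof -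
    have "(\<integral>\<^sup>+ x. ennreal (indicator {0<..} x * \<bar>sbias b x\<bar>) \<partial>lborel) \<le>
        (\<integral>\<^sup>+ x. \<integral>\<^sup>+ v. ennreal (indicator {0<..} x * \<bar>dev (1 / v) x\<bar>) \<partial>scaled_gamma b \<partial>lborel)"
    proof (rule nn_integral_mono)
      fix x :: real
      have "ennreal \<bar>sbias b x\<bar> \<le> (\<integral>\<^sup>+ v. ennreal \<bar>dev (1 / v) x\<bar> \<partial>scaled_gamma b)"
        using integral_norm_bound_ennreal[of "scaled_gamma b" "\<lambda>v. dev (1 / v) x"] sbias_conv_dev[OF b, of x]
        by (simp add: has_bochner_integral_iff)
      then show "ennreal (indicator {0<..} x * \<bar>sbias b x\<bar>) \<le>
          (\<integral>\<^sup>+ v. ennreal (indicator {0<..} x * \<bar>dev (1 / v) x\<bar>) \<partial>scaled_gamma b)"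
        by (cases "x > 0") auto
    qed
    also have "\<dots> = (\<integral>\<^sup>+ v. \<integral>\<^sup>+ x. ennreal (indicator {0<..} x * \<bar>dev (1 / v) x\<bar>) \<partial>lborel \<partial>scaled_gamma b)"
      using nn_integral_dev_swap[OF b, of "\<lambda>(x, v). ennreal (indicator {0<..} x * \<bar>dev (1 / v) x\<bar>)"]
      by simp
    also have "\<dots> \<le> (\<integral>\<^sup>+ v. ennreal \<epsilon> * ennreal \<bar>1 / v - 1\<bar> + ennreal C * ennreal ((1 / v - 1)\<^sup>2 / (1 / v)) \<partial>scaled_gamma b)"
    proof (rule nn_integral_mono_AE, use AE_scaled_gamma_pos[OF b] in eventually_elim)
      fix v :: real assume v: "0 < v"
      then have w: "1 / v > 0" by simp
      have "(\<integral>\<^sup>+ x. ennreal (indicator {0<..} x * \<bar>dev (1 / v) x\<bar>) \<partial>lborel) =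
          ennreal (\<integral> x. indicator {0<..} x * \<bar>dev (1 / v) x\<bar> \<partial>lborel)"
        using integrable_abs[OF integrable_dev[OF w]]
        by (intro nn_integral_eq_integral) (auto simp: abs_mult)
      also have "\<dots> \<le> ennreal (\<epsilon> * \<bar>1 / v - 1\<bar> + C * ((1 / v - 1)\<^sup>2 / (1 / v)))"
        by (intro ennreal_leI C w)
      also have "\<dots> = ennreal \<epsilon> * ennreal \<bar>1 / v - 1\<bar> + ennreal C * ennreal ((1 / v - 1)\<^sup>2 / (1 / v))"
        using assms C(1) v by (simp add: ennreal_plus ennreal_mult)
      finally show "(\<integral>\<^sup>+ x. ennreal (indicator {0<..} x * \<bar>dev (1 / v) x\<bar>) \<partial>lborel) \<le> \<dots>" .
    qed
    also have "\<dots> = ennreal \<epsilon> * (\<integral>\<^sup>+ v. ennreal \<bar>1 / v - 1\<bar> \<partial>scaled_gamma b) +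
        ennreal C * (\<integral>\<^sup>+ v. ennreal ((1 / v - 1)\<^sup>2 / (1 / v)) \<partial>scaled_gamma b)"
      by (subst nn_integral_add) (auto simp: nn_integral_cmult)
    also have "(\<integral>\<^sup>+ v. ennreal ((1 / v - 1)\<^sup>2 / (1 / v)) \<partial>scaled_gamma b) = ennreal b"
    proof -
      have "AE v in scaled_gamma b. 0 \<le> (1 / v - 1)\<^sup>2 / (1 / v)"
        using AE_scaled_gamma_pos[OF b] by eventually_elim simp
      from nn_integral_eq_integral[OF integrable.intros[OF scaled_gamma_quadratic[OF b]] this] show ?thesis
        by (simp only: has_bochner_integral_integral_eq[OF scaled_gamma_quadratic[OF b]])
    qed
    also have "ennreal \<epsilon> * (\<integral>\<^sup>+ v. ennreal \<bar>1 / v - 1\<bar> \<partial>scaled_gamma b) + ennreal C * ennreal b \<le>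
        ennreal \<epsilon> * ennreal (sqrt b) + ennreal C * ennreal b"
      by (intro add_mono mult_left_mono scaled_gamma_linear b) auto
    also have "\<dots> = ennreal (\<epsilon> * sqrt b + C * b)"
      using assms C(1) b by (simp add: ennreal_plus ennreal_mult)
    finally show ?thesis .
  qed
  with C(1) show ?thesis by blast
qed

text \<open>Cauchy-Schwarz in \<open>v\<close>, with the factor \<open>(w - 1) ^ 2 / (2 * w)\<close>
  of \<open>dev_L2_bound\<close> as weight. The weight has mean \<open>b / 2\<close>; dividing by it
  cancels that factor and leaves \<open>(w - 1 - ln w) * Q\<close>, whose mean
  \<open>scaled_gamma_log\<close> bounds.\<close>

lemma sbias_L2_bound:
  assumes b: "b > 0"
  shows "(\<integral>\<^sup>+ x. ennreal (indicator {0<..} x * (sbias b x)\<^sup>2) \<partial>lborel) \<le>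
    ennreal (b / 2 * ((b / 2 + 2 / 3 * b\<^sup>2 + 2 * b ^ 3) * Q))"
proof -
  let ?G = "scaled_gamma b"
  let ?p = "\<lambda>v. (1 / v - 1)\<^sup>2 / (2 * (1 / v))"
  have p: "has_bochner_integral ?G ?p (b / 2)"
    using has_bochner_integral_divide[OF scaled_gamma_quadratic[OF b], of 2] by (simp add: mult.commute)
  have pointwise: "ennreal (indicator {0<..} x * (sbias b x)\<^sup>2) \<le>
      ennreal (b / 2) * (\<integral>\<^sup>+ v. ennreal (indicator {0<..} x * ((dev (1 / v) x)\<^sup>2 / ?p v)) \<partial>?G)" for x
  proof (cases "x > 0")
    case True
    have "ennreal ((\<integral> v. dev (1 / v) x \<partial>?G)\<^sup>2) \<le>
        ennreal (\<integral> v. ?p v \<partial>?G) * (\<integral>\<^sup>+ v. ennreal ((dev (1 / v) x)\<^sup>2 / ?p v) \<partial>?G)"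
    proof (rule weighted_Cauchy_Schwarz)
      show "AE v in ?G. 0 \<le> ?p v" "AE v in ?G. ?p v = 0 \<longrightarrow> dev (1 / v) x = 0"
        using AE_scaled_gamma_pos[OF b] by (force elim: eventually_mono)+
    qed (use p sbias_conv_dev[OF b, of x] in \<open>auto simp: has_bochner_integral_iff\<close>)
    then show ?thesis
      using True p sbias_conv_dev[OF b, of x] by (simp add: has_bochner_integral_iff)
  qed simp
  have "(\<integral>\<^sup>+ x. ennreal (indicator {0<..} x * (sbias b x)\<^sup>2) \<partial>lborel) \<le>
      (\<integral>\<^sup>+ x. ennreal (b / 2) * (\<integral>\<^sup>+ v. ennreal (indicator {0<..} x * ((dev (1 / v) x)\<^sup>2 / ?p v)) \<partial>?G) \<partial>lborel)"
    by (intro nn_integral_mono pointwise)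
  also have "\<dots> = ennreal (b / 2) * (\<integral>\<^sup>+ x. \<integral>\<^sup>+ v. ennreal (indicator {0<..} x * ((dev (1 / v) x)\<^sup>2 / ?p v)) \<partial>?G \<partial>lborel)"
  proof (rule nn_integral_cmult)
    interpret G: prob_space ?G by (rule prob_space_scaled_gamma) fact
    show "(\<lambda>x. \<integral>\<^sup>+ v. ennreal (indicator {0<..} x * ((dev (1 / v) x)\<^sup>2 / ?p v)) \<partial>?G) \<in> borel_measurable lborel"
      by measurable
  qed
  also have "(\<integral>\<^sup>+ x. \<integral>\<^sup>+ v. ennreal (indicator {0<..} x * ((dev (1 / v) x)\<^sup>2 / ?p v)) \<partial>?G \<partial>lborel) =
      (\<integral>\<^sup>+ v. \<integral>\<^sup>+ x. ennreal (indicator {0<..} x * ((dev (1 / v) x)\<^sup>2 / ?p v)) \<partial>lborel \<partial>?G)"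
    using nn_integral_dev_swap[OF b, of "\<lambda>(x, v). ennreal (indicator {0<..} x * ((dev (1 / v) x)\<^sup>2 / ?p v))"]
    by simp
  also have "\<dots> \<le> (\<integral>\<^sup>+ v. ennreal (1 / v - 1 - ln (1 / v)) * ennreal Q \<partial>?G)"
  proof (rule nn_integral_mono_AE, use AE_scaled_gamma_pos[OF b] in eventually_elim)
    fix v :: real assume v: "0 < v"
    define w where "w = 1 / v"
    have w: "w > 0" using v by (simp add: w_def)
    define p where "p = (w - 1)\<^sup>2 / (2 * w)"
    have p: "p \<ge> 0" using w by (simp add: p_def)
    have "(\<integral>\<^sup>+ x. ennreal (indicator {0<..} x * ((dev w x)\<^sup>2 / p)) \<partial>lborel) =
        (\<integral>\<^sup>+ x. ennreal (1 / p) * ennreal (indicator {0<..} x * (dev w x)\<^sup>2) \<partial>lborel)"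
      using p by (intro nn_integral_cong) (simp add: ennreal_mult'[symmetric])
    also have "\<dots> = ennreal (1 / p) * (\<integral>\<^sup>+ x. ennreal (indicator {0<..} x * (dev w x)\<^sup>2) \<partial>lborel)"
      by (rule nn_integral_cmult) measurable
    also have "\<dots> \<le> ennreal (1 / p) * ennreal (p * ((w - 1 - ln w) * Q))"
      using dev_L2_bound[OF w] unfolding p_def by (rule mult_left_mono) simp
    also have "\<dots> = ennreal (1 / p * (p * ((w - 1 - ln w) * Q)))"
      using p by (intro ennreal_mult'[symmetric]) simp
    \<comment> \<open>\<open>p\<close> vanishes at \<open>w = 1\<close>; there \<open>1 / p\<close>
      is 0 and so is the left side.\<close>
    also have "\<dots> \<le> ennreal ((w - 1 - ln w) * Q)"
      using ln_le_minus_one[OF w] Q_nonneg by (cases "p = 0") (auto intro!: ennreal_leI)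
    also have "\<dots> = ennreal (w - 1 - ln w) * ennreal Q"
      using Q_nonneg by (simp add: ennreal_mult'')
    finally show "(\<integral>\<^sup>+ x. ennreal (indicator {0<..} x * ((dev (1 / v) x)\<^sup>2 / ?p v)) \<partial>lborel) \<le>
        ennreal (1 / v - 1 - ln (1 / v)) * ennreal Q"
      unfolding p_def w_def .
  qed
  also have "\<dots> = (\<integral>\<^sup>+ v. ennreal (1 / v - 1 - ln (1 / v)) \<partial>?G) * ennreal Q"
    by (rule nn_integral_multc) measurable
  also have "\<dots> \<le> ennreal (b / 2 + 2 / 3 * b\<^sup>2 + 2 * b ^ 3) * ennreal Q"
    by (intro mult_right_mono scaled_gamma_log b) auto
  finally have "(\<integral>\<^sup>+ x. ennreal (indicator {0<..} x * (sbias b x)\<^sup>2) \<partial>lborel) \<le>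
      ennreal (b / 2) * (ennreal (b / 2 + 2 / 3 * b\<^sup>2 + 2 * b ^ 3) * ennreal Q)"
    by (simp add: mult_left_mono)
  also have "\<dots> = ennreal (b / 2 * ((b / 2 + 2 / 3 * b\<^sup>2 + 2 * b ^ 3) * Q))"
  proof -
    have "ennreal (b / 2 + 2 / 3 * b\<^sup>2 + 2 * b ^ 3) * ennreal Q = ennreal ((b / 2 + 2 / 3 * b\<^sup>2 + 2 * b ^ 3) * Q)"
      using Q_nonneg by (rule ennreal_mult''[symmetric])
    then show ?thesis using b by (simp only: ennreal_mult'[symmetric, of "b / 2"])
  qed
  finally show ?thesis .
qed

text \<open>Averaging \<open>dev_pointwise_bound\<close> gives the main term \<open>A * b\<close>,
  an error \<open>e / 2 * b\<close>, and a multiple of the quartic mean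
  \<open>3 * b ^ 2 + 6 * b ^ 3\<close>, which is negligible against \<open>b\<close>.\<close>

lemma sbias_pointwise_limit:
  assumes x: "x > 0"
  shows "((\<lambda>b. sbias b x / b) \<longlongrightarrow> x\<^sup>2 * f' x / 2) (at_right 0)"
proof (rule tendstoI)
  fix e :: real assume e: "e > 0"
  define A where "A = x\<^sup>2 * f' x / 2"
  obtain C where C: "C \<ge> 0" "\<And>w. w > 0 \<Longrightarrow>
    \<bar>dev w x - A * ((w - 1)\<^sup>2 / w)\<bar> \<le> e / 2 * ((w - 1)\<^sup>2 / w) + C * ((w - 1) ^ 4 / w ^ 3)"
    using dev_pointwise_bound[OF x, of "e / 2"] e unfolding A_def by auto
  have bound: "\<bar>sbias b x / b - A\<bar> \<le> e / 2 + C * (3 * b + 6 * b\<^sup>2)" if b: "b > 0" for b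
  proof -
    let ?q = "\<lambda>v. (1 / v - 1)\<^sup>2 / (1 / v)" and ?r = "\<lambda>v. (1 / v - 1) ^ 4 / (1 / v) ^ 3"
    have d: "has_bochner_integral (scaled_gamma b) (\<lambda>v. dev (1 / v) x - A * ?q v) (sbias b x - A * b)"
      by (intro has_bochner_integral_diff has_bochner_integral_mult_right scaled_gamma_quadratic sbias_conv_dev b)
    have u: "has_bochner_integral (scaled_gamma b) (\<lambda>v. e / 2 * ?q v + C * ?r v) (e / 2 * b + C * (3 * b\<^sup>2 + 6 * b ^ 3))"
      by (intro has_bochner_integral_add has_bochner_integral_mult_right scaled_gamma_quadratic scaled_gamma_quartic b)
    have "\<bar>\<integral> v. dev (1 / v) x - A * ?q v \<partial>scaled_gamma b\<bar> \<le> (\<integral> v. \<bar>dev (1 / v) x - A * ?q v\<bar> \<partial>scaled_gamma b)"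
      by (rule integral_abs_bound)
    also have "\<dots> \<le> (\<integral> v. e / 2 * ?q v + C * ?r v \<partial>scaled_gamma b)"
    proof (rule integral_mono_AE)
      show "AE v in scaled_gamma b. \<bar>dev (1 / v) x - A * ?q v\<bar> \<le> e / 2 * ?q v + C * ?r v"
        using AE_scaled_gamma_pos[OF b] by eventually_elim (rule C(2), simp)
    qed (intro integrable_abs integrable.intros[OF d] integrable.intros[OF u])+
    finally have "\<bar>sbias b x - A * b\<bar> \<le> e / 2 * b + C * (3 * b\<^sup>2 + 6 * b ^ 3)"
      by (simp only: has_bochner_integral_integral_eq[OF d] has_bochner_integral_integral_eq[OF u])
    also have "\<dots> = b * (e / 2 + C * (3 * b + 6 * b\<^sup>2))"
      by (simp add: algebra_simps power2_eq_square power3_eq_cube)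
    finally have "\<bar>sbias b x - A * b\<bar> / b \<le> e / 2 + C * (3 * b + 6 * b\<^sup>2)"
      using b by (simp add: divide_le_eq mult.commute)
    moreover have "\<bar>sbias b x / b - A\<bar> = \<bar>sbias b x - A * b\<bar> / b"
      using b by (simp add: abs_if field_simps)
    ultimately show ?thesis by simp
  qed
  have "((\<lambda>b::real. e / 2 + C * (3 * b + 6 * b\<^sup>2)) \<longlongrightarrow> e / 2 + C * (3 * 0 + 6 * 0\<^sup>2)) (at_right 0)"
    by (intro tendsto_intros)
  from order_tendstoD(2)[OF this, of e] e have "\<forall>\<^sub>F b in at_right 0. e / 2 + C * (3 * b + 6 * b\<^sup>2) < e"
    by simp
  then show "\<forall>\<^sub>F b in at_right 0. dist (sbias b x / b) (x\<^sup>2 * f' x / 2) < e"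
    using eventually_at_right_less[of "0::real"]
  proof eventually_elim
    case (elim b)
    then show ?case using bound[of b] by (simp add: dist_real_def A_def)
  qed
qed

definition ibias2 :: "real \<Rightarrow> real" where
  "ibias2 b = (\<integral> x. indicator {0<..} x * (sbias b x)\<^sup>2 \<partial>lborel)"

lemma nn_integral_sbias2:
  assumes b: "b > 0"
  shows "(\<integral>\<^sup>+ x. ennreal (indicator {0<..} x * (sbias b x)\<^sup>2) \<partial>lborel) = ennreal (ibias2 b)"
  unfolding ibias2_def using sbias_measurable[OF b]
  by (intro nn_integral_eq_integral integrableI_nonneg le_less_trans[OF sbias_L2_bound[OF b]]) auto

text \<open>Divided by \<open>b ^ 2\<close>, the bound of \<open>sbias_L2_bound\<close> tends to
  \<open>Q / 4\<close>, which is precisely the integral of the squared pointwise limit of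
  \<open>sbias b x / b\<close>.\<close>

lemma ibias2_limit: "((\<lambda>b. ibias2 b / b\<^sup>2) \<longlongrightarrow> Q / 4) (at_right 0)"
  unfolding tendsto_at_iff_sequentially
proof (intro allI impI)
  fix b :: "nat \<Rightarrow> real"
  assume "\<forall>n. b n \<in> {0<..} - {0}" and lim: "b \<longlonglongrightarrow> 0"
  then have b: "b n > 0" for n by auto
  have b_at: "filterlim b (at_right 0) sequentially"
    using lim b by (auto simp: filterlim_at intro!: always_eventually less_imp_neq[symmetric])
  define u where "u n x = ennreal (indicator {0<..} x * (sbias (b n) x / b n)\<^sup>2)" for n x
  have int_u: "(\<integral>\<^sup>+ x. u n x \<partial>lborel) = ennreal (1 / (b n)\<^sup>2) * ennreal (ibias2 (b n))" for n
    unfolding u_def nn_integral_sbias2[OF b, symmetric] using sbias_measurable[OF b[of n]]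
    by (subst nn_integral_cmult[symmetric]) (auto intro!: nn_integral_cong simp: ennreal_mult'[symmetric] power_divide)
  have "(\<lambda>n. \<integral>\<^sup>+ x. u n x \<partial>lborel) \<longlonglongrightarrow> (\<integral>\<^sup>+ x. ennreal (x ^ 4 * (f' x)\<^sup>2 / 4) \<partial>lborel)"
  proof (rule tendsto_nn_integral_of_upper_bound)
    show "u n \<in> borel_measurable lborel" for n
      unfolding u_def using sbias_measurable[OF b[of n]] by measurable
    show "AE x in lborel. (\<lambda>n. u n x) \<longlonglongrightarrow> ennreal (x ^ 4 * (f' x)\<^sup>2 / 4)"
    proof (rule AE_I2)
      fix x :: real
      show "(\<lambda>n. u n x) \<longlonglongrightarrow> ennreal (x ^ 4 * (f' x)\<^sup>2 / 4)"
      proof (cases "x > 0")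
        case True
        have "(\<lambda>n. ennreal ((sbias (b n) x / b n)\<^sup>2)) \<longlonglongrightarrow> ennreal ((x\<^sup>2 * f' x / 2)\<^sup>2)"
          by (intro tendsto_ennrealI tendsto_power filterlim_compose[OF sbias_pointwise_limit[OF True] b_at])
        then show ?thesis
          using True by (simp add: u_def power_divide power_mult_distrib flip: power_mult)
      qed (simp add: u_def f'_nonpos)
    qed
    show "(\<integral>\<^sup>+ x. u n x \<partial>lborel) \<le> ennreal (1 / 2 * ((1 / 2 + 2 / 3 * b n + 2 * (b n)\<^sup>2) * Q))" for n
    proof -
      have "(\<integral>\<^sup>+ x. u n x \<partial>lborel) \<le>
          ennreal (1 / (b n)\<^sup>2) * ennreal (b n / 2 * ((b n / 2 + 2 / 3 * (b n)\<^sup>2 + 2 * b n ^ 3) * Q))"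
        unfolding int_u nn_integral_sbias2[OF b, symmetric] by (intro mult_left_mono sbias_L2_bound b) auto
      also have "\<dots> = ennreal (1 / (b n)\<^sup>2 * (b n / 2 * ((b n / 2 + 2 / 3 * (b n)\<^sup>2 + 2 * b n ^ 3) * Q)))"
        by (rule ennreal_mult'[symmetric]) simp
      also have "1 / (b n)\<^sup>2 * (b n / 2 * ((b n / 2 + 2 / 3 * (b n)\<^sup>2 + 2 * b n ^ 3) * Q)) =
          1 / 2 * ((1 / 2 + 2 / 3 * b n + 2 * (b n)\<^sup>2) * Q)"
        using b[of n] by (simp add: field_simps power2_eq_square power3_eq_cube)
      finally show ?thesis .
    qed
    have "(\<integral>\<^sup>+ x. ennreal (x ^ 4 * (f' x)\<^sup>2 / 4) \<partial>lborel) = ennreal (Q / 4)"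
      using int_f' by (subst nn_integral_eq_integral) (auto simp: Q_def)
    moreover have "(\<lambda>n. ennreal (1 / 2 * ((1 / 2 + 2 / 3 * b n + 2 * (b n)\<^sup>2) * Q))) \<longlonglongrightarrow>
        ennreal (1 / 2 * ((1 / 2 + 2 / 3 * 0 + 2 * 0\<^sup>2) * Q))"
      by (intro tendsto_ennrealI tendsto_intros lim)
    ultimately show "(\<lambda>n. ennreal (1 / 2 * ((1 / 2 + 2 / 3 * b n + 2 * (b n)\<^sup>2) * Q))) \<longlonglongrightarrow>
        (\<integral>\<^sup>+ x. ennreal (x ^ 4 * (f' x)\<^sup>2 / 4) \<partial>lborel)"
      by simp
  qed
  also have "(\<lambda>n. \<integral>\<^sup>+ x. u n x \<partial>lborel) = (\<lambda>n. ennreal (ibias2 (b n) / (b n)\<^sup>2))"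
    unfolding int_u by (simp add: ennreal_mult'[symmetric])
  also have "(\<integral>\<^sup>+ x. ennreal (x ^ 4 * (f' x)\<^sup>2 / 4) \<partial>lborel) = ennreal (Q / 4)"
    using int_f' by (subst nn_integral_eq_integral) (auto simp: Q_def)
  finally show "((\<lambda>b. ibias2 b / b\<^sup>2) \<circ> b) \<longlonglongrightarrow> Q / 4"
    unfolding comp_def
    by (rule tendsto_ennrealD) (auto simp: Q_nonneg ibias2_def intro!: divide_nonneg_nonneg Bochner_Integration.integral_nonneg)
qed

end

section \<open>Integrated variance\<close>

text \<open>Its distribution function is the square of that of \<open>scaled_gamma b\<close>.
  Squared kernel values are thus kernel values for another law, and second moments need no separate
  computation.\<close>

definition max_measure :: "real \<Rightarrow> real measure" where
  "max_measure b = distr (scaled_gamma b \<Otimes>\<^sub>M scaled_gamma b) borel (\<lambda>(v, w). max v w)"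

lemma sets_max_measure [simp, measurable_cong]: "sets (max_measure b) = sets borel"
  by (simp add: max_measure_def)

lemma max_measure:
  assumes b: "b > 0"
  shows prob_space_max_measure: "prob_space (max_measure b)"
    and AE_max_measure_pos: "AE v in max_measure b. 0 < v"
    and measure_max_measure: "measure (max_measure b) {..u} = (measure (scaled_gamma b) {..u})\<^sup>2"
    and nn_integral_max_measure: "(\<integral>\<^sup>+ v. ennreal v \<partial>max_measure b) = ennreal (mean_max b)"
proof -
  let ?G = "scaled_gamma b"
  interpret G: prob_space ?G by (rule prob_space_scaled_gamma) fact
  interpret P: pair_prob_space ?G ?G ..
  have [measurable]: "(\<lambda>(v, w). max v w :: real) \<in> borel_measurable (?G \<Otimes>\<^sub>M ?G)" by measurable
  show "prob_space (max_measure b)"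
    unfolding max_measure_def by (rule P.prob_space_distr) simp
  have "AE v in ?G. AE w in ?G. 0 < max v w"
    using AE_scaled_gamma_pos[OF b] by eventually_elim (auto simp: less_max_iff_disj)
  moreover have "Measurable.pred (?G \<Otimes>\<^sub>M ?G) (\<lambda>p. 0 < (case p of (v, w) \<Rightarrow> max v w))"
    by measurable
  ultimately have "AE p in ?G \<Otimes>\<^sub>M ?G. 0 < (case p of (v, w) \<Rightarrow> max v w)"
    by (intro P.AE_pair_measure) (simp_all only: pred_def split)
  then show "AE v in max_measure b. 0 < v"
    unfolding max_measure_def by (subst AE_distr_iff) auto
  have "(\<lambda>(v, w). max v w) -` {..u} \<inter> space (?G \<Otimes>\<^sub>M ?G) = {..u} \<times> {..u}"
    by (auto simp: space_pair_measure)
  then show "measure (max_measure b) {..u} = (measure ?G {..u})\<^sup>2"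
    unfolding max_measure_def
    by (subst measure_distr) (simp_all add: measure_def G.emeasure_pair_measure_Times enn2real_mult power2_eq_square)
  have "(\<integral>\<^sup>+ v. ennreal v \<partial>max_measure b) = (\<integral>\<^sup>+ p. ennreal (case p of (v, w) \<Rightarrow> max v w) \<partial>(?G \<Otimes>\<^sub>M ?G))"
    unfolding max_measure_def by (subst nn_integral_distr) auto
  also have "\<dots> = (\<integral>\<^sup>+ v. \<integral>\<^sup>+ w. ennreal (max v w) \<partial>?G \<partial>?G)"
    by (subst G.nn_integral_fst[symmetric]) (auto simp: case_prod_beta)
  also have "\<dots> = ennreal (mean_max b)"
    using nn_integral_scaled_gamma_max[OF b] by (simp add: max.commute)
  finally show "(\<integral>\<^sup>+ v. ennreal v \<partial>max_measure b) = ennreal (mean_max b)" .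
qed

section \<open>Mixtures over the kernel law and the exact integrated variance\<close>

context igam_target
begin

text \<open>At \<open>x \<le> 0\<close> no two-sided derivative is at hand, but an atom there would
  make \<open>F x\<close> positive.\<close>

lemma isCont_F: "isCont F x"
proof (cases "x > 0")
  case True
  then show ?thesis using cdf_deriv DERIV_isCont by blast
next
  case False
  have "measure D {x} \<le> measure D {..x}" by (intro finite_measure_mono) auto
  also have "\<dots> = 0" using cdf_nonpos[of x] False by (simp add: cdf_def)
  finally have "measure D {x} = 0" using measure_nonneg[of D "{x}"] by linarith
  then show ?thesis using isCont_cdf by simp
qed

lemma AE_D_pos: "AE t in D. 0 < t"
proof (rule AE_I[of _ _ "{..0}"])
  show "emeasure D {..0} = 0"
    using cdf_nonpos[of 0] by (simp add: cdf_def emeasure_eq_measure)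
qed auto

text \<open>The law is a parameter because two are needed: \<open>scaled_gamma b\<close> gives the
  mean of a kernel value and \<open>max_measure b\<close> its second moment.\<close>

definition mix :: "real measure \<Rightarrow> real \<Rightarrow> real" where
  "mix T x = (\<integral> v. F (x * (1 / v)) \<partial>T)"

lemma smoothed_eq_mix: "smoothed b = mix (scaled_gamma b)"
  by (simp add: smoothed_def mix_def fun_eq_iff)

lemma mix_bounds:
  assumes T: "prob_space T" "sets T = sets borel"
  shows "0 \<le> mix T x" "mix T x \<le> 1" "integrable T (\<lambda>v. F (x * (1 / v)))"
proof -
  interpret T: prob_space T by fact
  note [measurable_cong] = T(2)
  show int: "integrable T (\<lambda>v. F (x * (1 / v)))"
    using F_bounds by (intro T.integrable_const_bound[where B = 1]) auto
  show "0 \<le> mix T x"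
    unfolding mix_def using F_bounds by (intro Bochner_Integration.integral_nonneg) auto
  show "mix T x \<le> 1"
    unfolding mix_def by (rule T.integral_le_const[OF int]) (simp add: F_bounds)
qed

lemma mix_measurable [measurable]:
  assumes T: "prob_space T" "sets T = sets borel"
  shows "mix T \<in> borel_measurable borel"
proof -
  interpret T: prob_space T by fact
  note [measurable_cong] = T(2)
  show ?thesis unfolding mix_def by measurable
qed

text \<open>\<open>mix T\<close> is the c.d.f. of \<open>X V\<close> for independent \<open>X \<sim> D\<close>, \<open>V \<sim> T\<close>, and the kernel is \<open>P (V \<le> x / t)\<close>.\<close>

lemma integral_kernel:
  assumes T: "prob_space T" "sets T = sets borel" and pos: "AE v in T. 0 < v" and x: "x > 0"
  shows "has_bochner_integral D (\<lambda>t. measure T {..x / t}) (mix T x)"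
proof -
  interpret T: prob_space T by fact
  note [measurable_cong] = T(2)
  interpret P: pair_sigma_finite D T ..
  have [measurable]: "(\<lambda>t. measure T {..x / t}) \<in> borel_measurable D"
  proof -
    have "(\<lambda>p. indicator {p. snd p \<le> x / fst p} p :: real) \<in> borel_measurable (D \<Otimes>\<^sub>M T)"
      by measurable
    then have "(\<lambda>(t, v). indicator {p. snd p \<le> x / fst p} (t, v) :: real) \<in> borel_measurable (D \<Otimes>\<^sub>M T)"
      by (simp add: case_prod_beta)
    then have "(\<lambda>t. \<integral> v. (indicator {p. snd p \<le> x / fst p} (t, v) :: real) \<partial>T) \<in> borel_measurable D"
      by (rule T.borel_measurable_lebesgue_integral)
    also have "(\<lambda>t. \<integral> v. indicator {p. snd p \<le> x / fst p} (t, v) \<partial>T) = (\<lambda>t. measure T {..x / t})"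
    proof
      fix t
      have "(\<integral> v. indicator {p. snd p \<le> x / fst p} (t, v) \<partial>T) = (\<integral> v. indicator {..x / t} v \<partial>T)"
        by (intro Bochner_Integration.integral_cong) (auto simp: indicator_def)
      also have "\<dots> = measure T {..x / t}"
        using T(2) sets_eq_imp_space_eq[OF T(2)] by simp
      finally show "(\<integral> v. indicator {p. snd p \<le> x / fst p} (t, v) \<partial>T) = measure T {..x / t}" .
    qed
    finally show ?thesis .
  qed
  show ?thesis
  proof (rule has_bochner_integral_nn_integral)
    have "(\<integral>\<^sup>+ t. ennreal (measure T {..x / t}) \<partial>D) =
        (\<integral>\<^sup>+ t. \<integral>\<^sup>+ v. indicator {p. snd p \<le> x / fst p} (t, v) \<partial>T \<partial>D)"
    proof (rule nn_integral_cong)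
      fix t
      have "(\<integral>\<^sup>+ v. indicator {p. snd p \<le> x / fst p} (t, v) \<partial>T) = (\<integral>\<^sup>+ v. indicator {..x / t} v \<partial>T)"
        by (intro nn_integral_cong) (auto simp: indicator_def)
      then show "ennreal (measure T {..x / t}) = (\<integral>\<^sup>+ v. indicator {p. snd p \<le> x / fst p} (t, v) \<partial>T)"
        using T(2) by (simp add: T.emeasure_eq_measure)
    qed
    also have "\<dots> = (\<integral>\<^sup>+ v. \<integral>\<^sup>+ t. indicator {p. snd p \<le> x / fst p} (t, v) \<partial>D \<partial>T)"
      by (rule P.Fubini'[of "\<lambda>t v. indicator {p. snd p \<le> x / fst p} (t, v)", symmetric]) (simp, measurable)
    also have "\<dots> = (\<integral>\<^sup>+ v. ennreal (F (x * (1 / v))) \<partial>T)"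
    proof (rule nn_integral_cong_AE, use pos in eventually_elim)
      fix v :: real assume v: "0 < v"
      have "(\<integral>\<^sup>+ t. indicator {p. snd p \<le> x / fst p} (t, v) \<partial>D) = (\<integral>\<^sup>+ t. indicator {..x * (1 / v)} t \<partial>D)"
        by (rule nn_integral_cong_AE, use AE_D_pos in eventually_elim)
           (use v in \<open>auto simp: indicator_def field_simps\<close>)
      then show "(\<integral>\<^sup>+ t. indicator {p. snd p \<le> x / fst p} (t, v) \<partial>D) = ennreal (F (x * (1 / v)))"
        by (simp add: cdf_def emeasure_eq_measure)
    qed
    also have "\<dots> = ennreal (mix T x)"
      unfolding mix_def using mix_bounds(3)[OF T] F_bounds by (intro nn_integral_eq_integral) auto
    finally show "(\<integral>\<^sup>+ t. ennreal (measure T {..x / t}) \<partial>D) = ennreal (mix T x)" .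
  qed (use mix_bounds[OF T] in auto)
qed

lemma integral_mix_tail:
  assumes T: "prob_space T" "sets T = sets borel" and pos: "AE v in T. 0 < v"
    and mean: "(\<integral>\<^sup>+ v. ennreal v \<partial>T) = ennreal c" "c \<ge> 0"
  shows "has_bochner_integral lborel (\<lambda>x. indicator {0<..} x * (1 - mix T x)) (\<mu> * c)"
proof -
  interpret T: prob_space T by fact
  note [measurable_cong] = T(2)
  interpret P: pair_sigma_finite "lborel :: real measure" T ..
  have [measurable]: "mix T \<in> borel_measurable borel" by (rule mix_measurable[OF T])
  show ?thesis
  proof (rule has_bochner_integral_nn_integral)
    have "(\<integral>\<^sup>+ x. ennreal (indicator {0<..} x * (1 - mix T x)) \<partial>lborel) =
        (\<integral>\<^sup>+ x. \<integral>\<^sup>+ v. ennreal (indicator {0<..} x * (1 - F (x * (1 / v)))) \<partial>T \<partial>lborel)"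
    proof (rule nn_integral_cong)
      fix x :: real
      have "(\<integral>\<^sup>+ v. ennreal (indicator {0<..} x * (1 - F (x * (1 / v)))) \<partial>T) =
          ennreal (\<integral> v. indicator {0<..} x * (1 - F (x * (1 / v))) \<partial>T)"
        using mix_bounds(3)[OF T] F_bounds by (intro nn_integral_eq_integral) auto
      also have "(\<integral> v. indicator {0<..} x * (1 - F (x * (1 / v))) \<partial>T) = indicator {0<..} x * (1 - mix T x)"
        using mix_bounds(3)[OF T] by (simp add: mix_def T.prob_space)
      finally show "ennreal (indicator {0<..} x * (1 - mix T x)) =
          (\<integral>\<^sup>+ v. ennreal (indicator {0<..} x * (1 - F (x * (1 / v)))) \<partial>T)" ..
    qed
    also have "\<dots> = (\<integral>\<^sup>+ v. \<integral>\<^sup>+ x. ennreal (indicator {0<..} x * (1 - F (x * (1 / v)))) \<partial>lborel \<partial>T)"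
      by (rule P.Fubini'[symmetric]) measurable
    also have "\<dots> = (\<integral>\<^sup>+ v. ennreal \<mu> * ennreal v \<partial>T)"
    proof (rule nn_integral_cong_AE, use pos in eventually_elim)
      fix v :: real assume v: "0 < v"
      then have h: "has_bochner_integral lborel (\<lambda>x. indicator {0<..} x * (1 - F (x * (1 / v)))) (\<mu> / (1 / v))"
        by (intro has_bochner_integral_tail) simp
      have "(\<integral>\<^sup>+ x. ennreal (indicator {0<..} x * (1 - F (x * (1 / v)))) \<partial>lborel) =
          ennreal (\<integral> x. indicator {0<..} x * (1 - F (x * (1 / v))) \<partial>lborel)"
        by (rule nn_integral_eq_integral[OF integrable.intros[OF h]]) (simp add: F_bounds)
      also have "\<dots> = ennreal (\<mu> / (1 / v))" by (simp only: has_bochner_integral_integral_eq[OF h])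
      also have "\<dots> = ennreal \<mu> * ennreal v" using v \<mu>_nonneg by (simp add: ennreal_mult)
      finally show "(\<integral>\<^sup>+ x. ennreal (indicator {0<..} x * (1 - F (x * (1 / v)))) \<partial>lborel) = ennreal \<mu> * ennreal v" .
    qed
    also have "\<dots> = ennreal (\<mu> * c)"
      using \<mu>_nonneg mean by (simp add: nn_integral_cmult ennreal_mult)
    finally show "(\<integral>\<^sup>+ x. ennreal (indicator {0<..} x * (1 - mix T x)) \<partial>lborel) = ennreal (\<mu> * c)" .
  qed (use mix_bounds[OF T] \<mu>_nonneg mean in auto)
qed

definition V0 :: real where
  "V0 = (\<integral> x. indicator {0<..} x * (F x * (1 - F x)) \<partial>lborel)"

text \<open>This is \<open>\<integral> (m\<^sup>2 - F\<^sup>2)\<close> for the smoothed distribution function \<open>m\<close>.\<close>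

definition cross :: "real \<Rightarrow> real" where
  "cross b = (\<integral> x. indicator {0<..} x * (sbias b x * (smoothed b x + F x)) \<partial>lborel)"

lemma integrable_F_tail: "integrable lborel (\<lambda>x. indicator {0<..} x * (F x * (1 - F x)))"
proof (rule Bochner_Integration.integrable_bound[OF integrable.intros[OF has_bochner_integral_tail[of 1]]])
  show "AE x in lborel. norm (indicator {0<..} x * (F x * (1 - F x))) \<le> norm (indicator {0<..} x * (1 - F (x * 1)))"
    using F_bounds by (intro AE_I2) (auto simp: abs_mult indicator_def intro: mult_left_le_one_le)
qed auto

lemma smoothed_facts:
  assumes b: "b > 0"
  shows smoothed_bounds: "0 \<le> smoothed b x" "smoothed b x \<le> 1"
    and smoothed_tail: "has_bochner_integral lborel (\<lambda>x. indicator {0<..} x * (1 - smoothed b x)) (\<mu> * (1 + b))"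
proof -
  note G = prob_space_scaled_gamma[OF b] sets_scaled_gamma[of b]
  show "0 \<le> smoothed b x" "smoothed b x \<le> 1"
    using mix_bounds[OF G] by (simp_all add: smoothed_eq_mix)
  have "AE v in scaled_gamma b. 0 \<le> v"
    using AE_scaled_gamma_pos[OF b] by eventually_elim simp
  then have "(\<integral>\<^sup>+ v. ennreal v \<partial>scaled_gamma b) = ennreal (1 + b)"
    using scaled_gamma_moments(2)[OF b] by (subst nn_integral_eq_integral) (auto simp: has_bochner_integral_iff)
  then show "has_bochner_integral lborel (\<lambda>x. indicator {0<..} x * (1 - smoothed b x)) (\<mu> * (1 + b))"
    unfolding smoothed_eq_mix using b
    by (intro integral_mix_tail G AE_scaled_gamma_pos) auto
qed

lemma integrable_sbias: "b > 0 \<Longrightarrow> integrable lborel (\<lambda>x. indicator {0<..} x * sbias b x)"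
proof -
  assume b: "b > 0"
  have "integrable lborel (\<lambda>x. indicator {0<..} x * (1 - F (x * 1)) - indicator {0<..} x * (1 - smoothed b x))"
    by (intro Bochner_Integration.integrable_diff integrable.intros[OF has_bochner_integral_tail]
      integrable.intros[OF smoothed_tail] b) simp
  then show ?thesis by (simp add: sbias_def algebra_simps)
qed

lemma integrable_cross:
  assumes b: "b > 0"
  shows "integrable lborel (\<lambda>x. indicator {0<..} x * (sbias b x * (smoothed b x + F x)))"
    and "\<bar>cross b\<bar> \<le> 2 * (\<integral> x. indicator {0<..} x * \<bar>sbias b x\<bar> \<partial>lborel)"
proof -
  note [measurable] = sbias_measurable[OF b] smoothed_measurable[OF b]
  have int: "integrable lborel (\<lambda>x. 2 * \<bar>indicator {0<..} x * sbias b x\<bar>)"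
    using integrable_abs[OF integrable_sbias[OF b]] by simp
  have le: "\<bar>indicator {0<..} x * (sbias b x * (smoothed b x + F x))\<bar> \<le> 2 * \<bar>indicator {0<..} x * sbias b x\<bar>" for x
  proof -
    have "\<bar>sbias b x\<bar> * \<bar>smoothed b x + F x\<bar> \<le> \<bar>sbias b x\<bar> * 2"
      using smoothed_bounds[OF b, of x] F_bounds[of x] by (intro mult_left_mono) auto
    then show ?thesis by (simp add: abs_mult indicator_def)
  qed
  show 1: "integrable lborel (\<lambda>x. indicator {0<..} x * (sbias b x * (smoothed b x + F x)))"
    by (rule Bochner_Integration.integrable_bound[OF int]) (use le in auto)
  have "\<bar>cross b\<bar> \<le> (\<integral> x. \<bar>indicator {0<..} x * (sbias b x * (smoothed b x + F x))\<bar> \<partial>lborel)"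
    unfolding cross_def by (rule integral_abs_bound)
  also have "\<dots> \<le> (\<integral> x. 2 * \<bar>indicator {0<..} x * sbias b x\<bar> \<partial>lborel)"
    by (rule integral_mono[OF integrable_abs[OF 1] int le])
  finally show "\<bar>cross b\<bar> \<le> 2 * (\<integral> x. indicator {0<..} x * \<bar>sbias b x\<bar> \<partial>lborel)"
    by (simp add: abs_mult)
qed

lemma cross_limit: "((\<lambda>b. cross b / sqrt b) \<longlongrightarrow> 0) (at_right 0)"
proof (rule tendstoI)
  fix e :: real assume e: "e > 0"
  obtain C where C: "C \<ge> 0" "\<And>b. b > 0 \<Longrightarrow>
      (\<integral>\<^sup>+ x. ennreal (indicator {0<..} x * \<bar>sbias b x\<bar>) \<partial>lborel) \<le> ennreal (e / 4 * sqrt b + C * b)"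
    using sbias_L1_bound[of "e / 4"] e by auto
  have bound: "\<bar>cross b / sqrt b\<bar> \<le> 2 * (e / 4 + C * sqrt b)" if b: "b > 0" for b
  proof -
    have "ennreal (\<integral> x. indicator {0<..} x * \<bar>sbias b x\<bar> \<partial>lborel) =
        (\<integral>\<^sup>+ x. ennreal (indicator {0<..} x * \<bar>sbias b x\<bar>) \<partial>lborel)"
      using integrable_abs[OF integrable_sbias[OF b]] by (intro nn_integral_eq_integral[symmetric]) (auto simp: abs_mult)
    also note C(2)[OF b]
    finally have "(\<integral> x. indicator {0<..} x * \<bar>sbias b x\<bar> \<partial>lborel) \<le> e / 4 * sqrt b + C * b"
      using e C(1) b by (subst (asm) ennreal_le_iff) auto
    then have "\<bar>cross b\<bar> \<le> 2 * (e / 4 * sqrt b + C * b)"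
      by (intro order_trans[OF integrable_cross(2)[OF b]] mult_left_mono) auto
    also have "\<dots> = 2 * (e / 4 + C * sqrt b) * sqrt b"
      using b by (simp add: distrib_right mult.assoc)
    finally show ?thesis using b by (simp add: abs_divide divide_le_eq)
  qed
  have "((\<lambda>b::real. 2 * (e / 4 + C * sqrt b)) \<longlongrightarrow> 2 * (e / 4 + C * sqrt 0)) (at_right 0)"
    by (intro tendsto_intros)
  from order_tendstoD(2)[OF this, of e] e have "\<forall>\<^sub>F b in at_right 0. 2 * (e / 4 + C * sqrt b) < e"
    by simp
  then show "\<forall>\<^sub>F b in at_right 0. dist (cross b / sqrt b) 0 < e"
    using eventually_at_right_less[of "0::real"]
    by eventually_elim (use bound in \<open>force simp: dist_real_def\<close>)
qed

text \<open>The variance of a single summand of the estimator at \<open>x > 0\<close>.\<close>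

definition kvar :: "real \<Rightarrow> real \<Rightarrow> real" where
  "kvar b x = mix (max_measure b) x - (smoothed b x)\<^sup>2"

text \<open>The two terms of \<open>kvar\<close> tend to 1 at infinity and are not integrable
  separately. Writing m for \<open>smoothed b\<close>, \<open>kvar\<close> is regrouped as
  \<open>F (1 - F) + (1 - F) - (1 - mix) - (m ^ 2 - F ^ 2)\<close>, in which every part is
  integrable.\<close>

lemma integral_kvar:
  assumes b: "b > 0"
  shows "has_bochner_integral lborel (\<lambda>x. indicator {0<..} x * kvar b x) (V0 + \<mu> - \<mu> * mean_max b - cross b)"
proof -
  have mean_nonneg: "0 \<le> mean_max b"
    using b by (auto simp: mean_max_def add_pos_pos intro!: add_nonneg_nonneg mult_nonneg_nonneg divide_nonneg_nonneg)
  have t: "has_bochner_integral lborel (\<lambda>x. indicator {0<..} x * (1 - F (x * 1))) (\<mu> / 1)"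
    by (rule has_bochner_integral_tail) simp
  have v: "has_bochner_integral lborel (\<lambda>x. indicator {0<..} x * (F x * (1 - F x))) V0"
    unfolding V0_def by (rule has_bochner_integral_integrable[OF integrable_F_tail])
  have c: "has_bochner_integral lborel (\<lambda>x. indicator {0<..} x * (sbias b x * (smoothed b x + F x))) (cross b)"
    unfolding cross_def by (rule has_bochner_integral_integrable[OF integrable_cross(1)[OF b]])
  have m: "has_bochner_integral lborel (\<lambda>x. indicator {0<..} x * (1 - mix (max_measure b) x)) (\<mu> * mean_max b)"
    by (rule integral_mix_tail)
       (auto simp: b max_measure mean_nonneg)
  have "has_bochner_integral lborel (\<lambda>x. indicator {0<..} x * (F x * (1 - F x)) + indicator {0<..} x * (1 - F (x * 1))
       - indicator {0<..} x * (1 - mix (max_measure b) x) - indicator {0<..} x * (sbias b x * (smoothed b x + F x)))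
     (V0 + \<mu> / 1 - \<mu> * mean_max b - cross b)"
    by (intro has_bochner_integral_add has_bochner_integral_diff t v c m)
  also have "(\<lambda>x. indicator {0<..} x * (F x * (1 - F x)) + indicator {0<..} x * (1 - F (x * 1))
       - indicator {0<..} x * (1 - mix (max_measure b) x) - indicator {0<..} x * (sbias b x * (smoothed b x + F x))) =
      (\<lambda>x. indicator {0<..} x * kvar b x)"
    by (auto simp: fun_eq_iff indicator_def kvar_def sbias_def algebra_simps power2_eq_square)
  finally show ?thesis by simp
qed

end

section \<open>The estimator\<close>

lemma (in prob_space) variance_add_indep:
  fixes Y Z :: "'a \<Rightarrow> real"
  assumes ind: "indep_var borel Y borel Z"
    and Y: "integrable M Y" "integrable M (\<lambda>\<omega>. (Y \<omega>)\<^sup>2)"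
    and Z: "integrable M Z" "integrable M (\<lambda>\<omega>. (Z \<omega>)\<^sup>2)"
  shows "integrable M (\<lambda>\<omega>. (Y \<omega> + Z \<omega>)\<^sup>2)"
    and "variance (\<lambda>\<omega>. Y \<omega> + Z \<omega>) = variance Y + variance Z"
proof -
  have YZ: "integrable M (\<lambda>\<omega>. Y \<omega> * Z \<omega>)"
    "expectation (\<lambda>\<omega>. Y \<omega> * Z \<omega>) = expectation Y * expectation Z"
    using indep_var_integrable[OF ind Y(1) Z(1)] indep_var_lebesgue_integral[OF ind Y(1) Z(1)] by auto
  have eq: "(Y \<omega> + Z \<omega>)\<^sup>2 = (Y \<omega>)\<^sup>2 + (Z \<omega>)\<^sup>2 + 2 * (Y \<omega> * Z \<omega>)" for \<omega>
    by (simp add: power2_sum)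
  show int: "integrable M (\<lambda>\<omega>. (Y \<omega> + Z \<omega>)\<^sup>2)"
    unfolding eq using Y Z YZ by auto
  show "variance (\<lambda>\<omega>. Y \<omega> + Z \<omega>) = variance Y + variance Z"
  proof (subst (1 2 3) variance_eq)
    have "expectation (\<lambda>\<omega>. (Y \<omega> + Z \<omega>)\<^sup>2) =
        expectation (\<lambda>\<omega>. (Y \<omega>)\<^sup>2) + expectation (\<lambda>\<omega>. (Z \<omega>)\<^sup>2) + 2 * (expectation Y * expectation Z)"
      unfolding eq using Y Z YZ by simp
    then show "expectation (\<lambda>\<omega>. (Y \<omega> + Z \<omega>)\<^sup>2) - (expectation (\<lambda>\<omega>. Y \<omega> + Z \<omega>))\<^sup>2 =
        expectation (\<lambda>\<omega>. (Y \<omega>)\<^sup>2) - (expectation Y)\<^sup>2 + (expectation (\<lambda>\<omega>. (Z \<omega>)\<^sup>2) - (expectation Z)\<^sup>2)"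
      using Y Z by (simp add: power2_sum)
  qed (use Y Z int in auto)
qed

lemma (in prob_space) variance_sum_indep:
  fixes Z :: "'i \<Rightarrow> 'a \<Rightarrow> real"
  assumes "finite I" "indep_vars (\<lambda>_. borel) Z I"
    and "\<And>i. i \<in> I \<Longrightarrow> integrable M (Z i)" "\<And>i. i \<in> I \<Longrightarrow> integrable M (\<lambda>\<omega>. (Z i \<omega>)\<^sup>2)"
  shows "integrable M (\<lambda>\<omega>. (\<Sum>i\<in>I. Z i \<omega>)\<^sup>2) \<and>
    variance (\<lambda>\<omega>. \<Sum>i\<in>I. Z i \<omega>) = (\<Sum>i\<in>I. variance (Z i))"
  using assms
proof (induction I rule: finite_induct)
  case empty
  then show ?case by (simp add: prob_space)
next
  case (insert i I)
  have IH: "integrable M (\<lambda>\<omega>. (\<Sum>i\<in>I. Z i \<omega>)\<^sup>2) \<and>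
      variance (\<lambda>\<omega>. \<Sum>i\<in>I. Z i \<omega>) = (\<Sum>i\<in>I. variance (Z i))"
    using insert.prems by (intro insert.IH indep_vars_subset[OF insert.prems(1)]) auto
  have ind: "indep_var borel (Z i) borel (\<lambda>\<omega>. \<Sum>i\<in>I. Z i \<omega>)"
    by (rule indep_vars_sum[OF insert.hyps(1,2) insert.prems(1)])
  have "integrable M (\<lambda>\<omega>. \<Sum>i\<in>I. Z i \<omega>)"
    using insert.prems by (intro Bochner_Integration.integrable_sum) auto
  from variance_add_indep[OF ind _ _ this] IH insert show ?case by simp
qed

lemma upper_Gamma_measurable [measurable]: "upper_Gamma a \<in> borel_measurable borel"
proof -
  have "(\<lambda>p. indicator {p. fst p < snd p} p *\<^sub>R (snd p powr (a - 1) * exp (- snd p)) :: real) \<in> borel_measurable (borel \<Otimes>\<^sub>M lborel)"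
    by measurable
  then have "(\<lambda>(z, t). indicator {z<..} t *\<^sub>R (t powr (a - 1) * exp (- t)) :: real) \<in> borel_measurable (borel \<Otimes>\<^sub>M lborel)"
    by (simp add: case_prod_beta indicator_def)
  then have "(\<lambda>z. \<integral> t. indicator {z<..} t *\<^sub>R (t powr (a - 1) * exp (- t)) \<partial>lborel) \<in> borel_measurable borel"
    by (rule lborel.borel_measurable_lebesgue_integral)
  then show ?thesis
    by (simp add: upper_Gamma_def[abs_def] set_lebesgue_integral_def)
qed

lemma igam_survival_measurable [measurable]:
  assumes [measurable]: "g \<in> borel_measurable N" "h \<in> borel_measurable N"
  shows "(\<lambda>p. igam_survival a (g p) (h p)) \<in> borel_measurable N"
  unfolding igam_survival_def by measurable

text \<open>Scaling a Gamma variable by \<open>b\<close> moves the threshold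
  \<open>1 / (t * (b / x))\<close> of the incomplete Gamma function to \<open>x / t\<close>, and the
  complement of its upper tail is the distribution function.\<close>

lemma igam_survival_eq_measure:
  assumes b: "b > 0" and x: "x > 0" and t: "t > 0"
  shows "igam_survival (1 / b + 1) (b / x) t = measure (scaled_gamma b) {..x / t}"
proof -
  let ?a = "1 / b + 1"
  have a: "?a > 0" using b by (simp add: add_pos_pos)
  interpret prob_space "gamma_measure ?a" by (rule prob_space_gamma_measure[OF a])
  define z where "z = 1 / (t * (b / x))"
  have z: "z \<ge> 0" using b x t by (simp add: z_def)
  have "(*) b -` {..x / t} = {..z}"
    using b x t by (auto simp: z_def field_simps)
  then have "measure (scaled_gamma b) {..x / t} = prob {..z}"
    by (simp add: scaled_gamma_def measure_distr)
  also have "{..z} = space (gamma_measure ?a) - {z<..}" by auto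
  also have "prob (space (gamma_measure ?a) - {z<..}) = 1 - prob {z<..}"
    by (rule prob_compl) simp
  also have "prob {z<..} = upper_Gamma ?a z / Gamma ?a"
  proof -
    have "0 \<le> upper_Gamma ?a z"
      unfolding upper_Gamma_def set_lebesgue_integral_def by (intro Bochner_Integration.integral_nonneg) auto
    then show ?thesis
      using emeasure_gamma_measure_greaterThan[OF a z] a by (simp add: measure_def)
  qed
  finally show ?thesis by (simp add: igam_survival_def z_def)
qed

locale igam_sample = igam_target D f f' for D f f' +
  fixes M :: "'a measure" and X :: "nat \<Rightarrow> 'a \<Rightarrow> real"
  assumes prob_space_M: "prob_space M"
    and indep: "prob_space.indep_vars M (\<lambda>_. borel) X {1..}"
    and distr_X: "i \<ge> 1 \<Longrightarrow> distr M borel (X i) = D"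
begin

sublocale M: prob_space M by (rule prob_space_M)

lemma X_measurable [measurable]: "i \<ge> 1 \<Longrightarrow> X i \<in> borel_measurable M"
  using indep by (auto simp: M.indep_vars_def)

abbreviation ker :: "real \<Rightarrow> real \<Rightarrow> real \<Rightarrow> real" where
  "ker b x t \<equiv> igam_survival (1 / b + 1) (b / x) t"

text \<open>Observations are almost surely positive, so the kernel may be replaced by a distribution
  function at \<open>x / t\<close>; its square is the distribution function of
  \<open>max_measure b\<close>. Both moments then follow from
  \<open>integral_kernel\<close>.\<close>

lemma ker_facts:
  assumes b: "b > 0" and x: "x > 0" and i: "i \<ge> 1"
  shows "has_bochner_integral M (\<lambda>\<omega>. ker b x (X i \<omega>)) (smoothed b x)"
    and "has_bochner_integral M (\<lambda>\<omega>. (ker b x (X i \<omega>))\<^sup>2) (mix (max_measure b) x)"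
proof -
  have ae: "AE t in D. measure (scaled_gamma b) {..x / t} = ker b x t"
    using AE_D_pos by eventually_elim (simp add: igam_survival_eq_measure b x)
  have *: "has_bochner_integral M (\<lambda>\<omega>. g (X i \<omega>)) c"
    if "has_bochner_integral D g c" "g \<in> borel_measurable borel" for g :: "real \<Rightarrow> real" and c
    using that i unfolding distr_X[OF i, symmetric] has_bochner_integral_iff
    by (simp add: integrable_distr_eq integral_distr)
  have "has_bochner_integral D (\<lambda>t. measure (scaled_gamma b) {..x / t}) (smoothed b x)"
    unfolding smoothed_eq_mix
    by (intro integral_kernel prob_space_scaled_gamma AE_scaled_gamma_pos b x) simp
  note kernel = this this[THEN borel_measurable_has_bochner_integral]
  then have "has_bochner_integral D (\<lambda>t. ker b x t) (smoothed b x)"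
    using ae by (subst (asm) has_bochner_integral_cong_AE) auto
  then show "has_bochner_integral M (\<lambda>\<omega>. ker b x (X i \<omega>)) (smoothed b x)"
    by (rule *) measurable
  have "has_bochner_integral D (\<lambda>t. (measure (scaled_gamma b) {..x / t})\<^sup>2) (mix (max_measure b) x)"
    unfolding measure_max_measure[OF b, symmetric]
    by (intro integral_kernel max_measure b x) simp
  then have "has_bochner_integral D (\<lambda>t. (ker b x t)\<^sup>2) (mix (max_measure b) x)"
    using ae kernel(2) by (subst (asm) has_bochner_integral_cong_AE) (auto elim: eventually_mono)
  then show "has_bochner_integral M (\<lambda>\<omega>. (ker b x (X i \<omega>))\<^sup>2) (mix (max_measure b) x)"
    by (rule *) measurable
qed

lemma estimator_moments:
  assumes b: "b > 0" and x: "x > 0" and n: "n \<ge> 1"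
  shows "integrable M (igam_cdf_estimator X n b x)"
    and "integrable M (\<lambda>\<omega>. (igam_cdf_estimator X n b x \<omega>)\<^sup>2)"
    and "M.expectation (igam_cdf_estimator X n b x) = smoothed b x"
    and "M.variance (igam_cdf_estimator X n b x) = 1 / real n * kvar b x"
proof -
  let ?Z = "\<lambda>i \<omega>. ker b x (X i \<omega>)"
  let ?S = "\<lambda>\<omega>. \<Sum>i = 1..n. ?Z i \<omega>"
  have Z: "integrable M (?Z i)" "integrable M (\<lambda>\<omega>. (?Z i \<omega>)\<^sup>2)"
    "M.expectation (?Z i) = smoothed b x" "M.expectation (\<lambda>\<omega>. (?Z i \<omega>)\<^sup>2) = mix (max_measure b) x"
    if "i \<in> {1..n}" for i
    using ker_facts[OF b x, of i] that by (auto simp: has_bochner_integral_iff)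
  have varZ: "M.variance (?Z i) = kvar b x" if "i \<in> {1..n}" for i
    unfolding kvar_def using Z[OF that] by (subst M.variance_eq) auto
  have ind: "M.indep_vars (\<lambda>_. borel) ?Z {1..n}"
    by (rule M.indep_vars_compose2[OF M.indep_vars_subset[OF indep]]) auto
  have S: "integrable M (\<lambda>\<omega>. (?S \<omega>)\<^sup>2)" "M.variance ?S = (\<Sum>i = 1..n. M.variance (?Z i))"
    using M.variance_sum_indep[OF _ ind Z(1,2)] by auto
  have est: "igam_cdf_estimator X n b x = (\<lambda>\<omega>. 1 / real n * ?S \<omega>)"
    by (simp add: igam_cdf_estimator_def fun_eq_iff)
  have intS: "integrable M ?S" using Z(1) by (rule Bochner_Integration.integrable_sum)
  then show "integrable M (igam_cdf_estimator X n b x)"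
    unfolding est by (rule integrable_mult_right)
  show "integrable M (\<lambda>\<omega>. (igam_cdf_estimator X n b x \<omega>)\<^sup>2)"
    unfolding est power_mult_distrib using S(1) by (rule integrable_mult_right)
  have ES: "M.expectation ?S = real n * smoothed b x"
    using Z by (subst Bochner_Integration.integral_sum) auto
  then show E: "M.expectation (igam_cdf_estimator X n b x) = smoothed b x"
    unfolding est using intS n by simp
  have "(igam_cdf_estimator X n b x \<omega> - smoothed b x)\<^sup>2 = (1 / real n)\<^sup>2 * (?S \<omega> - M.expectation ?S)\<^sup>2" for \<omega>
    unfolding ES est power_mult_distrib[symmetric] using n by (simp add: right_diff_distrib)
  then have "M.variance (igam_cdf_estimator X n b x) = (1 / real n)\<^sup>2 * M.variance ?S"
    unfolding E by simp
  also have "M.variance ?S = real n * kvar b x"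
    unfolding S(2) using varZ by simp
  also have "(1 / real n)\<^sup>2 * (real n * kvar b x) = 1 / real n * kvar b x"
    using n by (simp add: power2_eq_square)
  finally show "M.variance (igam_cdf_estimator X n b x) = 1 / real n * kvar b x" .
qed

lemma estimator_error:
  assumes b: "b > 0" and x: "x > 0" and n: "n \<ge> 1"
  shows "(\<integral>\<^sup>+ \<omega>. ennreal ((igam_cdf_estimator X n b x \<omega> - F x)\<^sup>2) \<partial>M) =
    ennreal (1 / real n * kvar b x) + ennreal ((sbias b x)\<^sup>2)"
proof -
  let ?Y = "igam_cdf_estimator X n b x"
  note Y = estimator_moments[OF b x n]
  have eq: "(?Y \<omega> - F x)\<^sup>2 = (?Y \<omega> - M.expectation ?Y)\<^sup>2 + 2 * sbias b x * (?Y \<omega> - smoothed b x) + (sbias b x)\<^sup>2" for \<omega>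
    unfolding Y(3) sbias_def by (simp add: power2_eq_square algebra_simps)
  have int: "integrable M (\<lambda>\<omega>. (?Y \<omega> - M.expectation ?Y)\<^sup>2)"
    using Y(1,2) by (simp add: power2_diff)
  have "M.expectation (\<lambda>\<omega>. (?Y \<omega> - F x)\<^sup>2) =
      M.variance ?Y + 2 * sbias b x * (M.expectation ?Y - smoothed b x) + (sbias b x)\<^sup>2"
    unfolding eq using int Y(1) by (simp add: M.prob_space)
  also have "\<dots> = 1 / real n * kvar b x + (sbias b x)\<^sup>2"
    unfolding Y(4) unfolding Y(3) by simp
  finally have E: "M.expectation (\<lambda>\<omega>. (?Y \<omega> - F x)\<^sup>2) = 1 / real n * kvar b x + (sbias b x)\<^sup>2" .
  have "(\<integral>\<^sup>+ \<omega>. ennreal ((?Y \<omega> - F x)\<^sup>2) \<partial>M) = ennreal (M.expectation (\<lambda>\<omega>. (?Y \<omega> - F x)\<^sup>2))"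
  proof (rule nn_integral_eq_integral)
    show "integrable M (\<lambda>\<omega>. (?Y \<omega> - F x)\<^sup>2)"
      using Y(1,2) by (simp add: power2_diff)
  qed simp
  also have "\<dots> = ennreal (1 / real n * kvar b x) + ennreal ((sbias b x)\<^sup>2)"
    unfolding E using M.variance_positive[of ?Y] unfolding Y(4) by (intro ennreal_plus) auto
  finally show ?thesis .
qed

definition exact_mise :: "nat \<Rightarrow> real \<Rightarrow> real" where
  "exact_mise n b = 1 / real n * (V0 + \<mu> - \<mu> * mean_max b - cross b) + ibias2 b"

lemma kvar_measurable: "b > 0 \<Longrightarrow> (\<lambda>x. indicator {0<..} x * kvar b x) \<in> borel_measurable borel"
  using integral_kvar[of b] by (auto dest: borel_measurable_has_bochner_integral)

text \<open>Tonelli exchanges expectation and integration over \<open>x\<close>, which is possible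
  without prior finiteness; at each \<open>x\<close> the error then splits into variance and squared
  bias.\<close>

lemma MISE_decomposition:
  assumes b: "b > 0" and n: "n \<ge> 1"
  defines "Y \<equiv> igam_cdf_estimator X n b"
  shows "MISE M Y F = (\<integral>\<^sup>+ x \<in> {0<..}. ennreal (M.variance (Y x)) \<partial>lborel) +
      (\<integral>\<^sup>+ x \<in> {0<..}. ennreal ((bias M Y F x)\<^sup>2) \<partial>lborel)"
    and "MISE M Y F = ennreal (exact_mise n b)" and "exact_mise n b \<ge> 0"
proof -
  interpret P: pair_sigma_finite M "lborel :: real measure" ..
  \<comment> \<open>The sign is read off from \<open>kvar\<close> being a multiple of a variance; it
    permits the passage between \<open>ennreal\<close> and real integrals.\<close>
  have var_nonneg: "0 \<le> 1 / real n * (indicator {0<..} x * kvar b x)" for x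
    using M.variance_positive[of "igam_cdf_estimator X n b x"] estimator_moments(4)[OF b _ n, of x]
    by (cases "x > 0") auto
  have var: "(\<integral>\<^sup>+ x \<in> {0<..}. ennreal (M.variance (Y x)) \<partial>lborel) =
      (\<integral>\<^sup>+ x. ennreal (1 / real n * (indicator {0<..} x * kvar b x)) \<partial>lborel)"
    unfolding Y_def by (intro nn_integral_cong) (auto simp: indicator_def estimator_moments(4)[OF b _ n])
  have bias: "(\<integral>\<^sup>+ x \<in> {0<..}. ennreal ((bias M Y F x)\<^sup>2) \<partial>lborel) =
      (\<integral>\<^sup>+ x. ennreal (indicator {0<..} x * (sbias b x)\<^sup>2) \<partial>lborel)"
    unfolding Y_def by (intro nn_integral_cong)
      (auto simp: indicator_def bias_def sbias_def estimator_moments(3)[OF b _ n])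
  have [measurable]: "(\<lambda>(\<omega>, x). ennreal ((Y x \<omega> - F x)\<^sup>2) * indicator {0<..} x) \<in> borel_measurable (M \<Otimes>\<^sub>M lborel)"
    unfolding Y_def igam_cdf_estimator_def by measurable
  have "MISE M Y F = (\<integral>\<^sup>+ x. \<integral>\<^sup>+ \<omega>. ennreal ((Y x \<omega> - F x)\<^sup>2) * indicator {0<..} x \<partial>M \<partial>lborel)"
    unfolding MISE_def by (rule P.Fubini'[symmetric]) measurable
  also have "\<dots> = (\<integral>\<^sup>+ x. ennreal (1 / real n * (indicator {0<..} x * kvar b x)) +
      ennreal (indicator {0<..} x * (sbias b x)\<^sup>2) \<partial>lborel)"
    unfolding Y_def by (intro nn_integral_cong) (auto simp: indicator_def estimator_error[OF b _ n])
  also have "\<dots> = (\<integral>\<^sup>+ x. ennreal (1 / real n * (indicator {0<..} x * kvar b x)) \<partial>lborel) +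
      (\<integral>\<^sup>+ x. ennreal (indicator {0<..} x * (sbias b x)\<^sup>2) \<partial>lborel)"
    using kvar_measurable[OF b] sbias_measurable[OF b] by (intro nn_integral_add) auto
  finally have split: "MISE M Y F = \<dots>" .
  with var bias show "MISE M Y F = (\<integral>\<^sup>+ x \<in> {0<..}. ennreal (M.variance (Y x)) \<partial>lborel) +
      (\<integral>\<^sup>+ x \<in> {0<..}. ennreal ((bias M Y F x)\<^sup>2) \<partial>lborel)"
    by simp
  have kv: "has_bochner_integral lborel (\<lambda>x. 1 / real n * (indicator {0<..} x * kvar b x))
      (1 / real n * (V0 + \<mu> - \<mu> * mean_max b - cross b))"
    by (intro has_bochner_integral_mult_right integral_kvar b)
  have "(\<integral>\<^sup>+ x. ennreal (1 / real n * (indicator {0<..} x * kvar b x)) \<partial>lborel) =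
      ennreal (\<integral> x. 1 / real n * (indicator {0<..} x * kvar b x) \<partial>lborel)"
    by (rule nn_integral_eq_integral[OF integrable.intros[OF kv]]) (use var_nonneg in auto)
  also have "\<dots> = ennreal (1 / real n * (V0 + \<mu> - \<mu> * mean_max b - cross b))"
    by (simp only: has_bochner_integral_integral_eq[OF kv])
  finally have 1: "(\<integral>\<^sup>+ x. ennreal (1 / real n * (indicator {0<..} x * kvar b x)) \<partial>lborel) = \<dots>" .
  have "0 \<le> (\<integral> x. 1 / real n * (indicator {0<..} x * kvar b x) \<partial>lborel)"
    using var_nonneg by (intro Bochner_Integration.integral_nonneg)
  then have 2: "0 \<le> 1 / real n * (V0 + \<mu> - \<mu> * mean_max b - cross b)"
    by (simp only: has_bochner_integral_integral_eq[OF kv])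
  have 3: "0 \<le> ibias2 b" unfolding ibias2_def by (intro Bochner_Integration.integral_nonneg) auto
  show "MISE M Y F = ennreal (exact_mise n b)"
    unfolding split 1 nn_integral_sbias2[OF b] exact_mise_def using 2 3 by simp
  show "exact_mise n b \<ge> 0" unfolding exact_mise_def using 2 3 by simp
qed

end

section \<open>Asymptotic expansion\<close>

text \<open>In \<open>t = sqrt c\<close> the function is \<open>K - a * t + B * t ^ 4\<close>, with
  critical point \<open>u\<close> given by \<open>a = 4 * B * u ^ 3\<close>. Its excess over the
  value at \<open>u\<close> factors as
  \<open>B * (t - u) ^ 2 * (t ^ 2 + 2 * t * u + 3 * u ^ 2)\<close>, which gives a unique global
  minimum without calculus.\<close>

lemma is_arg_min_quartic:
  fixes a B K c :: real
  assumes a: "a > 0" and B: "B > 0"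
  shows "is_arg_min (\<lambda>c. K - a * sqrt c + c\<^sup>2 * B) (\<lambda>c. c > 0) c \<longleftrightarrow> c = (4 * B / a) powr (- 2 / 3)"
proof -
  define u where "u = (4 * B / a) powr (- 1 / 3)"
  define c0 where "c0 = (4 * B / a) powr (- 2 / 3)"
  have u: "u > 0" using a B by (simp add: u_def)
  have c0: "c0 = u\<^sup>2"
    unfolding u_def c0_def using a B by (simp add: powr_power)
  have "u ^ 3 = (4 * B / a) powr (- 1)"
    unfolding u_def using a B by (simp add: powr_power)
  then have u3: "a = 4 * B * u ^ 3"
    using a B by (simp add: powr_minus field_simps)
  have less: "K - a * sqrt c0 + c0\<^sup>2 * B < K - a * sqrt c + c\<^sup>2 * B" if c: "c > 0" "c \<noteq> c0" for c
  proof -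
    define t where "t = sqrt c"
    have t: "t > 0" "c = t\<^sup>2" "t \<noteq> u" using c c0 u by (auto simp: t_def)
    have "K - a * t + (t\<^sup>2)\<^sup>2 * B - (K - a * u + (u\<^sup>2)\<^sup>2 * B) = B * ((t - u)\<^sup>2 * (t\<^sup>2 + 2 * t * u + 3 * u\<^sup>2))"
      unfolding u3 by (simp add: algebra_simps eval_nat_numeral)
    also have "\<dots> > 0"
      using B t u by (intro mult_pos_pos add_pos_pos) auto
    finally show ?thesis using t u by (simp add: c0)
  qed
  have "c0 > 0" using a B by (simp add: c0_def)
  then show ?thesis
    unfolding is_arg_min_def c0_def[symmetric] using less by (metis less_asym)
qed

context igam_target
begin

text \<open>Continuity at 0, where \<open>F\<close> vanishes, keeps \<open>1 - F\<close> above
  \<open>1 / 2\<close> on an interval \<open>(0, d)\<close>. Positivity of \<open>\<mu>\<close>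
  makes the divisor in \<open>b_opt\<close> positive.\<close>

lemma \<mu>_pos: "0 < \<mu>"
proof -
  have "F \<midarrow>0\<rightarrow> F 0" using isCont_F[of 0] by (simp add: isCont_def)
  then have "F \<midarrow>0\<rightarrow> 0" by (simp add: cdf_nonpos)
  then have "\<forall>\<^sub>F x in at 0. F x < 1 / 2" by (rule order_tendstoD) simp
  then obtain d where d: "d > 0" "\<And>x. x \<noteq> 0 \<Longrightarrow> \<bar>x\<bar> < d \<Longrightarrow> F x < 1 / 2"
    unfolding eventually_at by (auto simp: dist_real_def)
  have t: "has_bochner_integral lborel (\<lambda>x. indicator {0<..} x * (1 - F (x * 1))) (\<mu> / 1)"
    by (rule has_bochner_integral_tail) simp
  have "(\<integral> x. indicator {0<..<d} x * (1 / 2) \<partial>lborel) \<le> (\<integral> x. indicator {0<..} x * (1 - F (x * 1)) \<partial>lborel)"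
  proof (rule integral_mono[OF _ integrable.intros[OF t]])
    show "integrable lborel (\<lambda>x. indicator {0<..<d} x * (1 / 2) :: real)"
      using d(1) by (intro integrable_mult_left integrable_real_indicator) auto
    show "indicator {0<..<d} x * (1 / 2) \<le> indicator {0<..} x * (1 - F (x * 1))" for x
      using d(2)[of x] F_bounds[of x] by (auto simp: indicator_def)
  qed
  also have "\<dots> = \<mu>" using has_bochner_integral_integral_eq[OF t] by simp
  finally show ?thesis using d(1) by simp
qed

text \<open>The error of the variance expansion multiplied by \<open>n\<close>. It is a function of
  \<open>b\<close> only, so its limit at 0 can be composed with any sequence of bandwidths.\<close>

definition var_remainder :: "real \<Rightarrow> real" where
  "var_remainder b = sqrt b * (\<mu> / sqrt pi) + \<mu> - \<mu> * mean_max b - cross b"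

definition bias_remainder :: "real \<Rightarrow> real" where
  "bias_remainder b = ibias2 b - b\<^sup>2 * (Q / 4)"

lemma var_remainder_limit: "((\<lambda>b. var_remainder b / sqrt b) \<longlongrightarrow> 0) (at_right 0)"
proof -
  have "((\<lambda>b. \<mu> / sqrt pi - \<mu> * ((mean_max b - 1) / sqrt b) - cross b / sqrt b) \<longlongrightarrow>
      \<mu> / sqrt pi - \<mu> * (1 / sqrt pi) - 0) (at_right 0)"
    by (intro tendsto_diff tendsto_mult tendsto_const mean_max_asymp cross_limit)
  moreover have "\<forall>\<^sub>F b in at_right 0. \<mu> / sqrt pi - \<mu> * ((mean_max b - 1) / sqrt b) - cross b / sqrt b =
      var_remainder b / sqrt b"
    using eventually_at_right_less[of "0::real"]
    by eventually_elim (simp add: var_remainder_def add_divide_distrib diff_divide_distrib right_diff_distrib)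
  ultimately show ?thesis by (auto dest: Lim_transform_eventually)
qed

lemma bias_remainder_limit: "((\<lambda>b. bias_remainder b / b\<^sup>2) \<longlongrightarrow> 0) (at_right 0)"
proof -
  have "((\<lambda>b. ibias2 b / b\<^sup>2 - Q / 4) \<longlongrightarrow> Q / 4 - Q / 4) (at_right 0)"
    by (intro tendsto_diff tendsto_const ibias2_limit)
  moreover have "\<forall>\<^sub>F b in at_right 0. ibias2 b / b\<^sup>2 - Q / 4 = bias_remainder b / b\<^sup>2"
    using eventually_at_right_less[of "0::real"]
    by eventually_elim (simp add: bias_remainder_def diff_divide_distrib)
  ultimately show ?thesis by (auto dest: Lim_transform_eventually)
qed

lemma remainder_smallo:
  assumes pos: "\<And>n. n \<ge> 1 \<Longrightarrow> b n > 0" and lim: "b \<longlonglongrightarrow> 0"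
  shows "(\<lambda>n. 1 / real n * var_remainder (b n)) \<in> o(\<lambda>n. 1 / real n * sqrt (b n))"
    and "(\<lambda>n. bias_remainder (b n)) \<in> o(\<lambda>n. (b n)\<^sup>2)"
proof -
  have ev: "\<forall>\<^sub>F n in sequentially. b n > 0 \<and> real n > 0"
    using eventually_ge_at_top[of 1] by eventually_elim (simp add: pos)
  have at: "filterlim b (at_right 0) sequentially"
    using lim ev by (auto simp: filterlim_at elim: eventually_mono)
  show "(\<lambda>n. 1 / real n * var_remainder (b n)) \<in> o(\<lambda>n. 1 / real n * sqrt (b n))"
  proof (rule smalloI_tendsto)
    show "\<forall>\<^sub>F n in sequentially. 1 / real n * sqrt (b n) \<noteq> 0"
      using ev by eventually_elim simp
    have "(\<lambda>n. var_remainder (b n) / sqrt (b n)) \<longlonglongrightarrow> 0"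
      by (rule filterlim_compose[OF var_remainder_limit at])
    moreover have "\<forall>\<^sub>F n in sequentially. var_remainder (b n) / sqrt (b n) =
        1 / real n * var_remainder (b n) / (1 / real n * sqrt (b n))"
      using ev by eventually_elim simp
    ultimately show "(\<lambda>n. 1 / real n * var_remainder (b n) / (1 / real n * sqrt (b n))) \<longlonglongrightarrow> 0"
      by (rule Lim_transform_eventually)
  qed
  show "(\<lambda>n. bias_remainder (b n)) \<in> o(\<lambda>n. (b n)\<^sup>2)"
  proof (rule smalloI_tendsto)
    show "\<forall>\<^sub>F n in sequentially. (b n)\<^sup>2 \<noteq> 0"
      using ev by eventually_elim simp
    show "(\<lambda>n. bias_remainder (b n) / (b n)\<^sup>2) \<longlonglongrightarrow> 0"
      by (rule filterlim_compose[OF bias_remainder_limit at])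
  qed
qed

end

theorem proposition5p3:
  fixes M :: "'a measure" and X :: "nat \<Rightarrow> 'a \<Rightarrow> real"
    and F f f' :: "real \<Rightarrow> real" and b :: "nat \<Rightarrow> real"
  assumes "prob_space M"
    and indep: "prob_space.indep_vars M (\<lambda>_. borel) X {1..}"
    and cdf: "\<And>i. i \<ge> 1 \<Longrightarrow> cdf (distr M borel (X i)) = F"
    and supp: "\<And>x. x \<le> 0 \<Longrightarrow> F x = 0"
    and deriv1: "\<And>x. x \<ge> 0 \<Longrightarrow> (F has_real_derivative f x) (at x within {0..})"
    and deriv2: "\<And>x. x \<ge> 0 \<Longrightarrow> (f has_real_derivative f' x) (at x within {0..})"
    and cont: "continuous_on {0..} f" "continuous_on {0..} f'"
    and bdd: "bounded (f ` {0..})" "bounded (f' ` {0..})"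
    and int1: "set_integrable lborel {0<..} (\<lambda>x. x * f x)"
    and int2: "set_integrable lborel {0<..} (\<lambda>x. x ^ 4 * (f' x)\<^sup>2)"
    and b_pos: "\<And>n. n \<ge> 1 \<Longrightarrow> b n > 0"
    and b_lim: "b \<longlonglongrightarrow> 0"
  shows
    "let Fhat = igam_cdf_estimator X;
         V = (LBINT x:{0<..}. F x * (1 - F x));
         A = (LBINT x:{0<..}. x * f x / sqrt pi);
         B = (LBINT x:{0<..}. x ^ 4 / 4 * (f' x)\<^sup>2);
         expansion = (\<lambda>n c. 1 / real n * V - 1 / real n * sqrt c * A + c\<^sup>2 * B);
         b_opt = (\<lambda>n. real n powr (- 2 / 3) * (4 * B / A) powr (- 2 / 3))
     in set_integrable lborel {0<..} (\<lambda>x. F x * (1 - F x)) \<and>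
        (\<forall>n\<ge>1. MISE M (Fhat n (b n)) F < \<infinity> \<and>
           MISE M (Fhat n (b n)) F =
             (\<integral>\<^sup>+ x \<in> {0<..}. ennreal (prob_space.variance M (Fhat n (b n) x)) \<partial>lborel) +
             (\<integral>\<^sup>+ x \<in> {0<..}. ennreal ((bias M (Fhat n (b n)) F x)\<^sup>2) \<partial>lborel)) \<and>
        (\<exists>r1 r2. r1 \<in> o(\<lambda>n. 1 / real n * sqrt (b n)) \<and> r2 \<in> o(\<lambda>n. (b n)\<^sup>2) \<and>
           (\<forall>n\<ge>1. enn2real (MISE M (Fhat n (b n)) F) = expansion n (b n) + r1 n + r2 n)) \<and>
        ((LBINT x:{0<..}. x ^ 4 * (f' x)\<^sup>2) > 0 \<longrightarrow>
           (\<forall>n\<ge>1. \<forall>c. is_arg_min (expansion n) (\<lambda>c. c > 0) c \<longleftrightarrow> c = b_opt n) \<and>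
           (\<forall>n\<ge>1. MISE M (Fhat n (b_opt n)) F < \<infinity>) \<and>
           (\<exists>r. r \<in> o(\<lambda>n. real n powr (- 4 / 3)) \<and>
             (\<forall>n\<ge>1. enn2real (MISE M (Fhat n (b_opt n)) F) =
                1 / real n * V
                - real n powr (- 4 / 3) * (3 / 4) * (A ^ 4 / (4 * B)) powr (1 / 3) + r n)))"
proof -
  interpret M: prob_space M by fact
  define D where "D = distr M borel (X 1)"
  have X_meas: "X i \<in> borel_measurable M" if "i \<ge> 1" for i
    using indep that by (auto simp: M.indep_vars_def)
  have F: "F = cdf D" using cdf[of 1] by (simp add: D_def)
  have D: "real_distribution D" unfolding D_def by (rule M.real_distribution_distr) (simp add: X_meas)
  \<comment> \<open>A distribution on the reals is determined by its distribution function, so equal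
    c.d.f.s make the observations identically distributed.\<close>
  have distr: "distr M borel (X i) = D" if "i \<ge> 1" for i
    using that D by (intro cdf_unique M.real_distribution_distr) (auto simp: X_meas cdf F)
  \<comment> \<open>Extension by zero, as the locale demands. At positive points the derivatives
    within \<open>{0..}\<close> become two-sided, because \<open>{0<..}\<close> is open.\<close>
  define g where "g x = (if x > 0 then f x else 0)" for x
  define g' where "g' x = (if x > 0 then f' x else 0)" for x
  have at_pos: "at x within {0<..} = at x" if "x > 0" for x :: real
    using that by (intro at_within_open) auto
  have sub: "{0<..} \<subseteq> {0::real..}" by auto
  have d1: "(F has_real_derivative g x) (at x)" if "x > 0" for x
    using has_field_derivative_subset[OF deriv1 sub, of x] that at_pos[OF that] by (auto simp: g_def)
  have "(f has_real_derivative g' x) (at x)" if "x > 0" for x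
    using has_field_derivative_subset[OF deriv2 sub, of x] that at_pos[OF that] by (auto simp: g'_def)
  then have d2: "(g has_real_derivative g' x) (at x)" if "x > 0" for x
    by (rule has_field_derivative_transform_within_open[where S = "{0<..}"]) (use that in \<open>auto simp: g_def\<close>)
  have "continuous_on {0<..} f'" by (rule continuous_on_subset[OF cont(2)]) auto
  then have c: "continuous_on {0<..} g'"
    by (rule continuous_on_eq) (auto simp: g'_def)
  have xg: "(\<lambda>x. x * g x) = (\<lambda>x. indicator {0<..} x *\<^sub>R (x * f x))"
    by (auto simp: fun_eq_iff indicator_def g_def)
  have xg': "(\<lambda>x. x ^ 4 * (g' x)\<^sup>2) = (\<lambda>x. indicator {0<..} x *\<^sub>R (x ^ 4 * (f' x)\<^sup>2))"
    by (auto simp: fun_eq_iff indicator_def g'_def)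
  interpret I: igam_sample D g g' M X
  proof (intro igam_sample.intro igam_target.intro D igam_target_axioms.intro igam_sample_axioms.intro)
    show "integrable lborel (\<lambda>x. x * g x)"
      unfolding xg using int1 by (simp only: set_integrable_def)
    show "integrable lborel (\<lambda>x. x ^ 4 * (g' x)\<^sup>2)"
      unfolding xg' using int2 by (simp only: set_integrable_def)
  qed (use supp d1 d2 c assms(1) indep distr in \<open>auto simp: g_def g'_def F\<close>)
  define V where "V = (LBINT x:{0<..}. F x * (1 - F x))"
  define A where "A = (LBINT x:{0<..}. x * f x / sqrt pi)"
  define B where "B = (LBINT x:{0<..}. x ^ 4 / 4 * (f' x)\<^sup>2)"
  define expansion where "expansion = (\<lambda>n c. 1 / real n * V - 1 / real n * sqrt c * A + c\<^sup>2 * B)"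
  define b_opt where "b_opt = (\<lambda>n. real n powr (- 2 / 3) * (4 * B / A) powr (- 2 / 3))"
  define Fhat where "Fhat = igam_cdf_estimator X"
  have Q: "I.Q = (LBINT x:{0<..}. x ^ 4 * (f' x)\<^sup>2)"
    unfolding I.Q_def xg' set_lebesgue_integral_def ..
  have V: "V = I.V0"
    unfolding V_def I.V0_def F set_lebesgue_integral_def by simp
  have A: "A = I.\<mu> / sqrt pi"
    unfolding A_def I.\<mu>_def xg set_lebesgue_integral_def by simp
  have B: "B = I.Q / 4"
  proof -
    have "B = (\<integral> x. indicator {0<..} x *\<^sub>R (x ^ 4 * (f' x)\<^sup>2) / 4 \<partial>lborel)"
      by (simp add: B_def set_lebesgue_integral_def)
    also have "\<dots> = I.Q / 4"
      unfolding Q set_lebesgue_integral_def by (rule integral_divide_zero)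
    finally show ?thesis .
  qed
  have mise: "MISE M (Fhat n c) F = ennreal (I.exact_mise n c)" "I.exact_mise n c \<ge> 0" if "c > 0" "n \<ge> 1" for n c
    using I.MISE_decomposition(2,3)[OF that] by (simp_all add: Fhat_def F)
  have exact_mise: "I.exact_mise n c = expansion n c + 1 / real n * I.var_remainder c + I.bias_remainder c" for n c
    by (simp add: I.exact_mise_def expansion_def I.var_remainder_def I.bias_remainder_def V A B algebra_simps)
  have part1: "set_integrable lborel {0<..} (\<lambda>x. F x * (1 - F x))"
    using I.integrable_F_tail by (simp add: set_integrable_def F)
  have part2: "\<forall>n\<ge>1. MISE M (Fhat n (b n)) F < \<infinity> \<and>
           MISE M (Fhat n (b n)) F =
             (\<integral>\<^sup>+ x \<in> {0<..}. ennreal (prob_space.variance M (Fhat n (b n) x)) \<partial>lborel) +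
             (\<integral>\<^sup>+ x \<in> {0<..}. ennreal ((bias M (Fhat n (b n)) F x)\<^sup>2) \<partial>lborel)"
  proof (intro allI impI conjI)
    fix n :: nat assume n: "n \<ge> 1"
    show "MISE M (Fhat n (b n)) F < \<infinity>" using mise(1)[OF b_pos[OF n] n] by simp
    show "MISE M (Fhat n (b n)) F =
             (\<integral>\<^sup>+ x \<in> {0<..}. ennreal (prob_space.variance M (Fhat n (b n) x)) \<partial>lborel) +
             (\<integral>\<^sup>+ x \<in> {0<..}. ennreal ((bias M (Fhat n (b n)) F x)\<^sup>2) \<partial>lborel)"
      using I.MISE_decomposition(1)[OF b_pos[OF n] n] by (simp add: Fhat_def F)
  qed
  have part3: "\<exists>r1 r2. r1 \<in> o(\<lambda>n. 1 / real n * sqrt (b n)) \<and> r2 \<in> o(\<lambda>n. (b n)\<^sup>2) \<and>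
           (\<forall>n\<ge>1. enn2real (MISE M (Fhat n (b n)) F) = expansion n (b n) + r1 n + r2 n)"
  proof (rule exI[of _ "\<lambda>n. 1 / real n * I.var_remainder (b n)"], rule exI[of _ "\<lambda>n. I.bias_remainder (b n)"], intro conjI allI impI)
    show "enn2real (MISE M (Fhat n (b n)) F) =
        expansion n (b n) + 1 / real n * I.var_remainder (b n) + I.bias_remainder (b n)" if n: "n \<ge> 1" for n
      using mise[OF b_pos[OF n] n] by (simp add: exact_mise)
  qed (use I.remainder_smallo[OF b_pos b_lim] in blast)+
  have part4: "(\<forall>n\<ge>1. \<forall>c. is_arg_min (expansion n) (\<lambda>c. c > 0) c \<longleftrightarrow> c = b_opt n) \<and>
           (\<forall>n\<ge>1. MISE M (Fhat n (b_opt n)) F < \<infinity>) \<and>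
           (\<exists>r. r \<in> o(\<lambda>n. real n powr (- 4 / 3)) \<and>
             (\<forall>n\<ge>1. enn2real (MISE M (Fhat n (b_opt n)) F) =
                1 / real n * V
                - real n powr (- 4 / 3) * (3 / 4) * (A ^ 4 / (4 * B)) powr (1 / 3) + r n))"
    if "(LBINT x:{0<..}. x ^ 4 * (f' x)\<^sup>2) > 0"
  proof -
    have A0: "A > 0" unfolding A using I.\<mu>_pos by simp
    have B0: "B > 0" unfolding B Q using that by simp
    \<comment> \<open>\<open>s n * j\<close> is the square root of \<open>b_opt n\<close>. In these
      variables all powers of \<open>n\<close> and of \<open>4 * B / A\<close> become integer
      powers.\<close>
    define j where "j = (4 * B / A) powr (- 1 / 3)"
    define s where "s n = real n powr (- 1 / 3)" for n
    have j: "j > 0" "(4 * B / A) powr (- 2 / 3) = j\<^sup>2"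
      using A0 B0 by (simp_all add: j_def powr_power)
    have "j ^ 3 = (4 * B / A) powr (- 1)"
      unfolding j_def using A0 B0 by (simp add: powr_power)
    then have j3: "4 * B * j ^ 3 = A"
      using A0 B0 by (simp add: powr_minus field_simps)
    have s: "s n > 0" "real n powr (- 2 / 3) = (s n)\<^sup>2" "1 / real n = s n ^ 3" "real n powr (- 4 / 3) = s n ^ 4"
      if "n \<ge> 1" for n
    proof -
      show "s n > 0" using that by (simp add: s_def)
      have "s n ^ k = real n powr (- 1 / 3 * real k)" for k
        using that by (simp add: s_def powr_power)
      from this[of 2] this[of 3] this[of 4]
      show "real n powr (- 2 / 3) = (s n)\<^sup>2" "1 / real n = s n ^ 3" "real n powr (- 4 / 3) = s n ^ 4"
        using that by (simp_all add: powr_minus_divide)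
    qed
    have opt: "b_opt n = (s n * j)\<^sup>2" if "n \<ge> 1" for n
      using s[OF that] j by (simp add: b_opt_def power_mult_distrib)
    have opt_pos: "b_opt n > 0" if "n \<ge> 1" for n
      using s[OF that] j by (simp add: opt[OF that])
    have sqrt_opt: "sqrt (b_opt n) = s n * j" if "n \<ge> 1" for n
      using s(1)[OF that] j by (simp add: opt[OF that] abs_mult)
    have opt_lim: "b_opt \<longlonglongrightarrow> 0"
    proof -
      have "(\<lambda>n. real n powr (- 2 / 3) * (4 * B / A) powr (- 2 / 3)) \<longlonglongrightarrow> 0 * (4 * B / A) powr (- 2 / 3)"
        by (intro tendsto_mult tendsto_const tendsto_neg_powr filterlim_real_sequentially) simp
      then show ?thesis by (simp add: b_opt_def)
    qed
    have min: "is_arg_min (expansion n) (\<lambda>c. c > 0) c \<longleftrightarrow> c = b_opt n" if n: "n \<ge> 1" for n c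
    proof -
      have "expansion n = (\<lambda>c. 1 / real n * V - A / real n * sqrt c + c\<^sup>2 * B)"
        by (auto simp: expansion_def fun_eq_iff)
      \<comment> \<open>The expansion has \<open>A / n\<close> in the place of \<open>a\<close>, and
        this division by \<open>n\<close> produces the factor \<open>n\<close> to the power
        \<open>- 2 / 3\<close>.\<close>
      moreover have "(4 * B / (A / real n)) powr (- 2 / 3) = b_opt n"
      proof -
        have "4 * B / (A / real n) = real n * (4 * B / A)" using n A0 by simp
        then show ?thesis using n A0 B0 by (simp only: powr_mult b_opt_def)
      qed
      ultimately show ?thesis
        using is_arg_min_quartic[of "A / real n" B "1 / real n * V" c] n A0 B0 by simp
    qed
    define r where "r n = 1 / real n * I.var_remainder (b_opt n) + I.bias_remainder (b_opt n)" for n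
    have ev: "\<forall>\<^sub>F n in sequentially. n \<ge> (1::nat)" by (rule eventually_ge_at_top)
    have r_small: "r \<in> o(\<lambda>n. real n powr (- 4 / 3))"
    proof -
      have "(\<lambda>n. 1 / real n * sqrt (b_opt n)) \<in> O(\<lambda>n. real n powr (- 4 / 3))"
      proof (rule bigoI[of _ j])
        show "\<forall>\<^sub>F n in sequentially. norm (1 / real n * sqrt (b_opt n)) \<le> j * norm (real n powr (- 4 / 3))"
          using ev
        proof eventually_elim
          case (elim n)
          have "1 / real n * sqrt (b_opt n) = j * real n powr (- 4 / 3)"
            unfolding s(3,4)[OF elim] sqrt_opt[OF elim] by (simp add: eval_nat_numeral)
          then show ?case using j by (simp only: norm_mult) simp
        qed
      qed
      moreover have "(\<lambda>n. (b_opt n)\<^sup>2) \<in> O(\<lambda>n. real n powr (- 4 / 3))"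
      proof (rule bigoI[of _ "j ^ 4"])
        show "\<forall>\<^sub>F n in sequentially. norm ((b_opt n)\<^sup>2) \<le> j ^ 4 * norm (real n powr (- 4 / 3))"
          using ev
        proof eventually_elim
          case (elim n)
          have "(b_opt n)\<^sup>2 = j ^ 4 * real n powr (- 4 / 3)"
            unfolding s(4)[OF elim] opt[OF elim] by (simp add: eval_nat_numeral)
          then show ?case using j by (simp only: norm_mult) simp
        qed
      qed
      ultimately show ?thesis
        unfolding r_def using I.remainder_smallo[OF opt_pos opt_lim]
        by (intro sum_in_smallo) (auto intro: landau_o.small_big_trans)
    qed
    \<comment> \<open>Since \<open>4 * B * j ^ 3 = A\<close>, the bias term
      \<open>B * (s n * j) ^ 4\<close> is a quarter of the variance term
      \<open>s n ^ 4 * j * A\<close>; the difference is the factor \<open>3 / 4\<close>. The same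
      relation shows that \<open>A * j\<close> is the cube root of
      \<open>A ^ 4 / (4 * B)\<close>.\<close>
    have opt_val: "expansion n (b_opt n) = 1 / real n * V - real n powr (- 4 / 3) * (3 / 4) * (A ^ 4 / (4 * B)) powr (1 / 3)"
      if n: "n \<ge> 1" for n
    proof -
      have "A ^ 4 / (4 * B) = (A * j) ^ 3"
        using A0 B0 j3 by (simp add: power_mult_distrib field_simps eval_nat_numeral)
      then have "(A ^ 4 / (4 * B)) powr (1 / 3) = A * j"
        using A0 j by (simp add: powr_powr flip: powr_numeral)
      moreover have "expansion n (b_opt n) = 1 / real n * V - 1 / real n * (s n * j) * A + ((s n * j)\<^sup>2)\<^sup>2 * B"
        unfolding expansion_def sqrt_opt[OF n] unfolding opt[OF n] ..
      moreover have "1 / real n * (s n * j) * A = s n ^ 4 * j * A"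
        unfolding s(3)[OF n] by (simp add: eval_nat_numeral)
      moreover have "((s n * j)\<^sup>2)\<^sup>2 * B = s n ^ 4 * j * (4 * B * j ^ 3) / 4"
        by (simp add: eval_nat_numeral)
      ultimately show ?thesis
        unfolding j3 s(4)[OF n] by (simp only:) (simp add: algebra_simps)
    qed
    show ?thesis
    proof (intro conjI allI impI exI[of _ r])
      show "enn2real (MISE M (Fhat n (b_opt n)) F) =
          1 / real n * V - real n powr (- 4 / 3) * (3 / 4) * (A ^ 4 / (4 * B)) powr (1 / 3) + r n"
        if n: "n \<ge> 1" for n
        using mise[OF opt_pos[OF n] n] by (simp add: exact_mise opt_val[OF n] r_def)
    qed (use min mise opt_pos r_small in auto)
  qed
  show ?thesis
    unfolding Let_def
    using part1 part2 part3 part4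
    unfolding Fhat_def expansion_def b_opt_def V_def A_def B_def by blast
qed

end
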